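(* Let $R$ be an almost hereditary ring, let $N\in\mathbb{N}$, $D=R[X_1,\dots,X_N]$, and let $A=(a_{ij})\in D^{m\times n}$ be an $m\times n$-matrix with entries in $D$, $A\neq 0$. Then the $D$-module of solutions $\{y\in D^n: Ay=0\}$ is generated by elements of degree $$\leq (2m\deg A)^{2((N+1)^N-1)}.$$
   Context: All rings are commutative with unit. For a ring $R$, $\operatorname{Frac}(R)$ denotes the ring of fractions of $R$, i.e. the localization $S^{-1}R$ where $S$ is the set of non-zero-divisors of $R$. A ring $R$ is called almost hereditary if $\operatorname{Frac}(R)$ is von Neumann regular and $R_{\mathfrak m}$ is a discrete valuation ring (DVR) for every maximal ideal $\mathfrak m$ of $R$. Degree means total degree, with $\deg(0)=-\infty$; the degree of a vector or matrix of polynomials is the maximum of the degrees of its entries. $\mathbb{N}=\{0,1,2,\dots\}$. *)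

theory Defs
  imports "HOL-Algebra.Algebra" "HOL-Library.Extended_Real"
begin

section \<open>Rings of fractions\<close>

definition fraction_rel :: "('a, 'b) ring_scheme \<Rightarrow> 'a set \<Rightarrow> (('a \<times> 'a) \<times> ('a \<times> 'a)) set"
  where "fraction_rel R S =
    {((a, s), (b, t)). a \<in> carrier R \<and> s \<in> S \<and> b \<in> carrier R \<and> t \<in> S \<and>
       (\<exists>u\<in>S. u \<otimes>\<^bsub>R\<^esub> (a \<otimes>\<^bsub>R\<^esub> t \<ominus>\<^bsub>R\<^esub> b \<otimes>\<^bsub>R\<^esub> s) = \<zero>\<^bsub>R\<^esub>)}"

text \<open>The localization of \<open>R\<close> at \<open>S\<close>. It is meant for commutative \<open>R\<close> and for a
  submonoid \<open>S\<close> of its multiplicative monoid. The pair \<open>(a, s)\<close> stands for the fraction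
  \<open>a / s\<close>, and the operations on classes are taken over all representatives.\<close>

definition localization :: "('a, 'b) ring_scheme \<Rightarrow> 'a set \<Rightarrow> ('a \<times> 'a) set ring"
  where "localization R S =
    \<lparr> carrier = (carrier R \<times> S) // fraction_rel R S,
      monoid.mult = (\<lambda>F G. \<Union>p\<in>F. \<Union>q\<in>G.
                fraction_rel R S `` {(fst p \<otimes>\<^bsub>R\<^esub> fst q, snd p \<otimes>\<^bsub>R\<^esub> snd q)}),
      monoid.one = fraction_rel R S `` {(\<one>\<^bsub>R\<^esub>, \<one>\<^bsub>R\<^esub>)},
      ring.zero = fraction_rel R S `` {(\<zero>\<^bsub>R\<^esub>, \<one>\<^bsub>R\<^esub>)},
      ring.add = (\<lambda>F G. \<Union>p\<in>F. \<Union>q\<in>G.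
                fraction_rel R S ``
                  {(fst p \<otimes>\<^bsub>R\<^esub> snd q \<oplus>\<^bsub>R\<^esub> fst q \<otimes>\<^bsub>R\<^esub> snd p, snd p \<otimes>\<^bsub>R\<^esub> snd q)}) \<rparr>"

definition non_zero_divisors :: "('a, 'b) ring_scheme \<Rightarrow> 'a set"
  where "non_zero_divisors R =
    {s \<in> carrier R. \<forall>a\<in>carrier R. s \<otimes>\<^bsub>R\<^esub> a = \<zero>\<^bsub>R\<^esub> \<longrightarrow> a = \<zero>\<^bsub>R\<^esub>}"

definition Frac :: "('a, 'b) ring_scheme \<Rightarrow> ('a \<times> 'a) set ring"
  where "Frac R = localization R (non_zero_divisors R)"

definition localization_at :: "('a, 'b) ring_scheme \<Rightarrow> 'a set \<Rightarrow> ('a \<times> 'a) set ring"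
  where "localization_at R P = localization R (carrier R - P)"


section \<open>Almost hereditary rings\<close>

locale von_neumann_regular = ring +
  assumes regular: "a \<in> carrier R \<Longrightarrow> \<exists>x\<in>carrier R. a = a \<otimes> x \<otimes> a"

text \<open>Fields are not counted as discrete valuation rings.\<close>

locale discrete_valuation_ring = principal_domain +
  assumes local_ring: "\<exists>!M. maximalideal M R"
    and not_field: "\<not> field R"

locale almost_hereditary = cring +
  assumes Frac_regular: "von_neumann_regular (Frac R)"
    and localization_dvr: "maximalideal M R \<Longrightarrow> discrete_valuation_ring (localization_at R M)"


section \<open>Polynomials in N variables\<close>

text \<open>The variables are indexed by \<open>0, \<dots>, N - 1\<close>. As in
  \<^theory>\<open>HOL-Algebra.Indexed_Polynomials\<close>, a monomial is the multiset of its variables and a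
  polynomial maps every monomial to its coefficient.\<close>

definition mpoly_ring :: "('a, 'b) ring_scheme \<Rightarrow> nat \<Rightarrow> (nat multiset \<Rightarrow> 'a) ring"
  where "mpoly_ring R N =
    \<lparr> carrier = ring.indexed_pset R {..<N} (carrier R),
      monoid.mult = (\<lambda>P Q m. \<Oplus>\<^bsub>R\<^esub>k\<in>{k. k \<subseteq># m}. P k \<otimes>\<^bsub>R\<^esub> Q (m - k)),
      monoid.one = ring.indexed_const R \<one>\<^bsub>R\<^esub>,
      ring.zero = ring.indexed_const R \<zero>\<^bsub>R\<^esub>,
      ring.add = ring.indexed_padd R \<rparr>"

text \<open>The supremum of the empty set in \<^typ>\<open>ereal\<close> is \<open>- \<infinity>\<close>, the degree of \<open>0\<close>.\<close>

definition total_degree :: "('a, 'b) ring_scheme \<Rightarrow> (nat multiset \<Rightarrow> 'a) \<Rightarrow> ereal"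
  where "total_degree R P = (SUP k\<in>{k. P k \<noteq> \<zero>\<^bsub>R\<^esub>}. ereal (real (size k)))"

definition vec_degree :: "('a, 'b) ring_scheme \<Rightarrow> nat \<Rightarrow> (nat \<Rightarrow> nat multiset \<Rightarrow> 'a) \<Rightarrow> ereal"
  where "vec_degree R n y = (SUP j\<in>{..<n}. total_degree R (y j))"

definition mat_degree ::
    "('a, 'b) ring_scheme \<Rightarrow> nat \<Rightarrow> nat \<Rightarrow> (nat \<Rightarrow> nat \<Rightarrow> nat multiset \<Rightarrow> 'a) \<Rightarrow> ereal"
  where "mat_degree R m n A = (SUP i\<in>{..<m}. SUP j\<in>{..<n}. total_degree R (A i j))"


section \<open>Modules of solutions\<close>

text \<open>The free module \<open>D\<^sup>n\<close>. Module records extend ring records; the fields \<open>mult\<close> and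
  \<open>one\<close> play no role for modules and are filled componentwise.\<close>

definition free_module :: "('d, 'e) ring_scheme \<Rightarrow> nat \<Rightarrow> ('d, nat \<Rightarrow> 'd) module"
  where "free_module D n =
    \<lparr> carrier = {..<n} \<rightarrow>\<^sub>E carrier D,
      monoid.mult = (\<lambda>x y. \<lambda>j\<in>{..<n}. x j \<otimes>\<^bsub>D\<^esub> y j),
      monoid.one = (\<lambda>j\<in>{..<n}. \<one>\<^bsub>D\<^esub>),
      ring.zero = (\<lambda>j\<in>{..<n}. \<zero>\<^bsub>D\<^esub>),
      ring.add = (\<lambda>x y. \<lambda>j\<in>{..<n}. x j \<oplus>\<^bsub>D\<^esub> y j),
      smult = (\<lambda>c x. \<lambda>j\<in>{..<n}. c \<otimes>\<^bsub>D\<^esub> x j) \<rparr>"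

definition generated_submodule ::
    "('d, 'e) ring_scheme \<Rightarrow> ('d, 'v, 'f) module_scheme \<Rightarrow> 'v set \<Rightarrow> 'v set"
  where "generated_submodule D M G = \<Inter>{H. submodule H D M \<and> G \<subseteq> H}"

definition solutions :: "('d, 'e) ring_scheme \<Rightarrow> nat \<Rightarrow> nat \<Rightarrow> (nat \<Rightarrow> nat \<Rightarrow> 'd) \<Rightarrow> (nat \<Rightarrow> 'd) set"
  where "solutions D m n A =
    {y \<in> carrier (free_module D n).
       \<forall>i<m. (\<Oplus>\<^bsub>D\<^esub>j\<in>{..<n}. A i j \<otimes>\<^bsub>D\<^esub> y j) = \<zero>\<^bsub>D\<^esub>}"

end

(*
The quotients of R by local data are handled without ever forming them: R is the image of the free
commutative ring on its elements, an object of a type class, and the localization of R at a maximal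
ideal is recorded by a pair of prime ideals I \<subseteq> M of this free ring (what becomes 0, what becomes a
non-unit). That the localization is a discrete valuation ring is used only through: of two elements,
one divides the other, up to a factor outside M and modulo I.

Over such a local domain the proof is Hermann's elimination. Homogenize the system. Among the nonzero
minors of maximal order take one with minimal content and divide by this content; this yields Cramer
solutions whose pivot is primitive and homogeneous. A linear change of coordinates makes the pivot
monic in the last variable up to a unit: homogeneity prevents non-unit coefficients of higher degree,
which would otherwise call for Weierstrass preparation. Dividing by the pivot bounds the degree of a
solution in the last variable by m * deg A, and comparing coefficients replaces (m, deg A) by
(m * (m * deg A + deg A), deg A), with one variable less. The change of coordinates needs an infinite
residue field, which is obtained by adjoining an indeterminate T; since a generating set over R[T]
may be replaced by the T-coefficients of its members, this does no harm.

Finally, for a solution y over R, the r in R such that r y lies in the module generated by the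
solutions of small degree form an ideal that is contained in no maximal ideal.
*)
theory Submission
  imports Defs "HOL-Library.Poly_Mapping" "HOL-Library.Multiset_Order"
    "HOL-Computational_Algebra.Polynomial" "Jordan_Normal_Form.Determinant"
begin

section \<open>Polynomials as finitely supported functions on multisets\<close>

text \<open>Over a field any nonzero minor can serve as pivot. Over a valuation ring all
  coefficients of a minor may be non-units, and then no change of coordinates produces an invertible
  leading coefficient; hence the division by the content. It has to be one content for all minors of
  maximal order, because a Cramer solution combines several of them, and it respects the equations
  because a content that is nonzero modulo I cancels in a domain.

  Homogenizing costs one variable, so there are N + 1 eliminations. With d = deg A, each one
  contributes m d to the degree and replaces 2 m d by 2 m (m d + d) d, which is at most (2 m d)^2.
  Twice the total is therefore at most the sum of (2 m d)^(2^k) over k \<le> N. This yields (2 m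
  d)^(2^N), and 2^N \<le> 2 ((N + 1)^N - 1) for N > 0. For N = 0 all solutions are constants.

  Adjoining T replaces M by M[T]: every polynomial in T with one coefficient outside M then counts
  as a unit.\<close>

type_synonym 'p mpol = "nat multiset \<Rightarrow>\<^sub>0 'p"

abbreviation coef :: "('k \<Rightarrow>\<^sub>0 'p::zero) \<Rightarrow> 'k \<Rightarrow> 'p"
  where "coef \<equiv> Poly_Mapping.lookup"

abbreviation mon :: "'k \<Rightarrow> 'p::zero \<Rightarrow> ('k \<Rightarrow>\<^sub>0 'p)"
  where "mon \<equiv> Poly_Mapping.single"

lemma poly_mapping_sum_mons:
  fixes f :: "'k \<Rightarrow>\<^sub>0 'p::comm_monoid_add"
  shows "f = (\<Sum>k\<in>Poly_Mapping.keys f. mon k (coef f k))"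
proof (rule poly_mapping_eqI)
  fix k
  have "coef (\<Sum>k\<in>Poly_Mapping.keys f. mon k (coef f k)) k
      = (\<Sum>l\<in>Poly_Mapping.keys f. if l = k then coef f l else 0)"
    by (auto simp: lookup_sum lookup_single when_def intro!: sum.cong)
  also have "\<dots> = coef f k"
    by (simp add: sum.delta in_keys_iff)
  finally show "coef f k = coef (\<Sum>k\<in>Poly_Mapping.keys f. mon k (coef f k)) k" by simp
qed

text \<open>Identities that are additive in each argument need to be checked on monomials only. The
  product rules for substitution, for \<open>xcoef\<close> and for evaluation are obtained in this
  way.\<close>

lemma poly_mapping_additive_induct [case_names mon add]:
  fixes f :: "'k \<Rightarrow>\<^sub>0 'p::comm_monoid_add"
  assumes "\<And>k a. P (mon k a)" "\<And>f g. P f \<Longrightarrow> P g \<Longrightarrow> P (f + g)"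
  shows "P f"
proof -
  have z: "P 0" using assms(1)[of undefined 0] by simp
  have "P (\<Sum>k\<in>A. mon k (coef f k))" if "finite A" for A
    using that by (induction A rule: finite_induct) (auto simp: z assms)
  from this[of "Poly_Mapping.keys f"] show ?thesis
    using poly_mapping_sum_mons[of f] by simp
qed

lemma coef_mon_times:
  fixes f :: "nat multiset \<Rightarrow>\<^sub>0 'p::comm_ring_1"
  shows "coef (mon k a * f) m = (if k \<subseteq># m then a * coef f (m - k) else 0)"
proof (induction f rule: poly_mapping_additive_induct)
  case (mon l b)
  have "k + l = m \<longleftrightarrow> k \<subseteq># m \<and> l = m - k"
    by (metis add_diff_cancel_left' mset_subset_eq_add_left subset_mset.add_diff_inverse)
  then show ?case
    by (auto simp: mult_single lookup_single when_def)
next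
  case (add f g)
  then show ?case by (simp add: distrib_left lookup_add)
qed

lemma coef_const_times [simp]:
  fixes f :: "nat multiset \<Rightarrow>\<^sub>0 'p::comm_ring_1"
  shows "coef (mon 0 a * f) m = a * coef f m"
  by (simp add: coef_mon_times)

lemma finite_submultisets: "finite {k. k \<subseteq># (m :: 'c multiset)}"
proof (induction m)
  case empty
  then show ?case by simp
next
  case (add x m)
  have "{k. k \<subseteq># add_mset x m} \<subseteq> {k. k \<subseteq># m} \<union> add_mset x ` {k. k \<subseteq># m}"
  proof
    fix k assume k: "k \<in> {k. k \<subseteq># add_mset x m}"
    show "k \<in> {k. k \<subseteq># m} \<union> add_mset x ` {k. k \<subseteq># m}"
    proof (cases "x \<in># k")
      case True
      then obtain k' where "k = add_mset x k'" by (meson multi_member_split)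
      with k show ?thesis by auto
    next
      case False
      have "count k a \<le> count m a" for a
      proof (cases "a = x")
        case True
        with False show ?thesis by (simp add: not_in_iff)
      next
        case a: False
        have "count k a \<le> count (add_mset x m) a"
          using k by (intro mset_subset_eq_count) simp
        with a show ?thesis by simp
      qed
      then show ?thesis by (simp add: mset_subset_eqI)
    qed
  qed
  with add show ?case by (meson finite_UnI finite_imageI finite_subset)
qed

lemma coef_times:
  fixes f g :: "nat multiset \<Rightarrow>\<^sub>0 'p::comm_ring_1"
  shows "coef (f * g) m = (\<Sum>k\<in>{k. k \<subseteq># m}. coef f k * coef g (m - k))"
proof (induction f rule: poly_mapping_additive_induct)
  case (mon l a)
  have "(\<Sum>k\<in>{k. k \<subseteq># m}. coef (mon l a) k * coef g (m - k))
     = (\<Sum>k\<in>{k. k \<subseteq># m}. if k = l then a * coef g (m - k) else 0)"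
    by (auto simp: lookup_single when_def intro!: sum.cong)
  also have "\<dots> = (if l \<subseteq># m then a * coef g (m - l) else 0)"
    using finite_submultisets[of m] by (simp add: sum.delta)
  finally show ?case by (simp add: coef_mon_times)
next
  case (add f1 f2)
  then show ?case by (simp add: distrib_right lookup_add sum.distrib)
qed

subsection \<open>Degrees and variables\<close>

text \<open>A bound instead of a degree: 0 satisfies every bound, so no value for its degree has to
  be fixed.\<close>

definition deg_le :: "nat \<Rightarrow> 'p::zero mpol \<Rightarrow> bool"
  where "deg_le d f \<longleftrightarrow> (\<forall>k. coef f k \<noteq> 0 \<longrightarrow> size k \<le> d)"

text \<open>The degree is an integer since it will be a difference of weights
  \<open>w j - u i\<close>. If this is negative, only the zero polynomial qualifies.\<close>

definition homogeneous :: "int \<Rightarrow> 'p::zero mpol \<Rightarrow> bool"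
  where "homogeneous d f \<longleftrightarrow> (\<forall>k. coef f k \<noteq> 0 \<longrightarrow> int (size k) = d)"

definition vars_below :: "nat \<Rightarrow> 'p::zero mpol \<Rightarrow> bool"
  where "vars_below v f \<longleftrightarrow> (\<forall>k. coef f k \<noteq> 0 \<longrightarrow> set_mset k \<subseteq> {..<v})"

lemma coef_times_nonzero:
  fixes f g :: "'p::comm_ring_1 mpol"
  assumes "coef (f * g) m \<noteq> 0"
  obtains k l where "coef f k \<noteq> 0" "coef g l \<noteq> 0" "m = k + l"
proof -
  have "\<exists>k\<in>{k. k \<subseteq># m}. coef f k * coef g (m - k) \<noteq> 0"
  proof (rule ccontr)
    assume "\<not> ?thesis"
    then have "coef (f * g) m = 0" unfolding coef_times by (intro sum.neutral) blast
    with assms show False by contradiction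
  qed
  then obtain k where k: "k \<subseteq># m" "coef f k * coef g (m - k) \<noteq> 0" by auto
  show ?thesis by (rule that[of k "m - k"]) (use k in auto)
qed

lemma coef_sum_nonzero:
  assumes "coef (\<Sum>x\<in>A. f x) m \<noteq> (0::'p::comm_monoid_add)"
  obtains x where "x \<in> A" "coef (f x) m \<noteq> 0"
proof -
  have "\<exists>x\<in>A. coef (f x) m \<noteq> 0"
  proof (rule ccontr)
    assume "\<not> ?thesis"
    then have "coef (\<Sum>x\<in>A. f x) m = 0" unfolding lookup_sum by (intro sum.neutral) blast
    with assms show False by contradiction
  qed
  with that show ?thesis by blast
qed

lemma coef_add_nonzero:
  assumes "coef (f + g) m \<noteq> (0::'p::comm_monoid_add)"
  shows "coef f m \<noteq> 0 \<or> coef g m \<noteq> 0"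
  using assms by (auto simp: lookup_add)

lemma deg_le_0 [simp]: "deg_le d 0" by (simp add: deg_le_def)

lemma deg_le_mono: "deg_le d f \<Longrightarrow> d \<le> e \<Longrightarrow> deg_le e f"
  by (auto simp: deg_le_def)

lemma deg_le_add: "deg_le d f \<Longrightarrow> deg_le d g \<Longrightarrow> deg_le d (f + (g::'p::comm_monoid_add mpol))"
  by (auto simp: deg_le_def dest!: coef_add_nonzero)

lemma deg_le_sum: "(\<And>x. x \<in> A \<Longrightarrow> deg_le d (f x)) \<Longrightarrow> deg_le d (\<Sum>x\<in>A. f x :: 'p::comm_monoid_add mpol)"
  by (auto simp: deg_le_def elim!: coef_sum_nonzero)

lemma deg_le_times: "deg_le d f \<Longrightarrow> deg_le e g \<Longrightarrow> deg_le (d + e) (f * (g::'p::comm_ring_1 mpol))"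
  unfolding deg_le_def by (metis coef_times_nonzero size_union add_mono)

lemma deg_le_mon_iff: "deg_le d (mon k a) \<longleftrightarrow> a = 0 \<or> size k \<le> d"
  by (auto simp: deg_le_def lookup_single when_def)

lemma deg_le_1 [simp]: "deg_le d (1::'p::comm_ring_1 mpol)"
  by (auto simp: deg_le_def lookup_one when_def)

lemma deg_le_uminus [simp]: "deg_le d (- f) \<longleftrightarrow> deg_le d (f::'p::ab_group_add mpol)"
  by (simp add: deg_le_def)

lemma deg_le_prod:
  "(\<And>x. x \<in> A \<Longrightarrow> deg_le (d x) (f x)) \<Longrightarrow> deg_le (\<Sum>x\<in>A. d x) (\<Prod>x\<in>A. f x :: 'p::comm_ring_1 mpol)"
  by (induction A rule: infinite_finite_induct) (auto intro: deg_le_times)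

lemma homogeneous_0 [simp]: "homogeneous d 0" by (simp add: homogeneous_def)

lemma homogeneous_add: "homogeneous d f \<Longrightarrow> homogeneous d g \<Longrightarrow> homogeneous d (f + (g::'p::comm_monoid_add mpol))"
  by (auto simp: homogeneous_def dest!: coef_add_nonzero)

lemma homogeneous_sum: "(\<And>x. x \<in> A \<Longrightarrow> homogeneous d (f x)) \<Longrightarrow> homogeneous d (\<Sum>x\<in>A. f x :: 'p::comm_monoid_add mpol)"
  by (auto simp: homogeneous_def elim!: coef_sum_nonzero)

lemma homogeneous_times: "homogeneous d f \<Longrightarrow> homogeneous e g \<Longrightarrow> homogeneous (d + e) (f * (g::'p::comm_ring_1 mpol))"
  unfolding homogeneous_def by (metis coef_times_nonzero size_union of_nat_add)

lemma homogeneous_mon: "int (size k) = d \<Longrightarrow> homogeneous d (mon k a)"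
  by (auto simp: homogeneous_def lookup_single when_def)

lemma homogeneous_1 [simp]: "homogeneous 0 (1::'p::comm_ring_1 mpol)"
  by (auto simp: homogeneous_def lookup_one when_def)

lemma homogeneous_uminus [simp]: "homogeneous d (- f) \<longleftrightarrow> homogeneous d (f::'p::ab_group_add mpol)"
  by (simp add: homogeneous_def)

lemma homogeneous_prod:
  "(\<And>x. x \<in> A \<Longrightarrow> homogeneous (d x) (f x)) \<Longrightarrow> homogeneous (\<Sum>x\<in>A. d x) (\<Prod>x\<in>A. f x :: 'p::comm_ring_1 mpol)"
  by (induction A rule: infinite_finite_induct) (auto intro: homogeneous_times)

lemma vars_below_0 [simp]: "vars_below v 0" by (simp add: vars_below_def)

lemma vars_below_add: "vars_below v f \<Longrightarrow> vars_below v g \<Longrightarrow> vars_below v (f + (g::'p::comm_monoid_add mpol))"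
  by (auto simp: vars_below_def dest!: coef_add_nonzero)

lemma vars_below_sum: "(\<And>x. x \<in> A \<Longrightarrow> vars_below v (f x)) \<Longrightarrow> vars_below v (\<Sum>x\<in>A. f x :: 'p::comm_monoid_add mpol)"
  by (auto simp: vars_below_def elim!: coef_sum_nonzero)

lemma vars_below_times: "vars_below v f \<Longrightarrow> vars_below v g \<Longrightarrow> vars_below v (f * (g::'p::comm_ring_1 mpol))"
  unfolding vars_below_def by (metis coef_times_nonzero set_mset_union Un_least)

lemma vars_below_mon: "set_mset k \<subseteq> {..<v} \<Longrightarrow> vars_below v (mon k a)"
  by (auto simp: vars_below_def lookup_single when_def)

lemma vars_below_1 [simp]: "vars_below v (1::'p::comm_ring_1 mpol)"
  by (auto simp: vars_below_def lookup_one when_def)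

lemma vars_below_uminus [simp]: "vars_below v (- f) \<longleftrightarrow> vars_below v (f::'p::ab_group_add mpol)"
  by (simp add: vars_below_def)

lemma vars_below_diff: "vars_below v f \<Longrightarrow> vars_below v g \<Longrightarrow> vars_below v (f - (g::'p::ab_group_add mpol))"
  using vars_below_add[of v f "-g"] by simp

lemma vars_below_prod:
  "(\<And>x. x \<in> A \<Longrightarrow> vars_below v (f x)) \<Longrightarrow> vars_below v (\<Prod>x\<in>A. f x :: 'p::comm_ring_1 mpol)"
  by (induction A rule: infinite_finite_induct) (auto intro: vars_below_times)

lemma vars_below_power: "vars_below v f \<Longrightarrow> vars_below v (f ^ n :: 'p::comm_ring_1 mpol)"
  by (induction n) (auto intro: vars_below_times)

subsection \<open>Substitution\<close>

definition psubst :: "(nat \<Rightarrow> 'p mpol) \<Rightarrow> 'p::comm_ring_1 mpol \<Rightarrow> 'p mpol"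
  where "psubst \<sigma> f = (\<Sum>k\<in>Poly_Mapping.keys f. mon 0 (coef f k) * (\<Prod>x\<in>#k. \<sigma> x))"

lemma psubst_superset:
  assumes "finite A" "Poly_Mapping.keys f \<subseteq> A"
  shows "psubst \<sigma> f = (\<Sum>k\<in>A. mon 0 (coef f k) * (\<Prod>x\<in>#k. \<sigma> x))"
  unfolding psubst_def using assms by (intro sum.mono_neutral_left) (auto simp: in_keys_iff)

lemma psubst_add: "psubst \<sigma> (f + g) = psubst \<sigma> f + psubst \<sigma> g"
proof -
  let ?A = "Poly_Mapping.keys f \<union> Poly_Mapping.keys g"
  have "Poly_Mapping.keys (f + g) \<subseteq> ?A" by (rule keys_add)
  then show ?thesis
    by (simp add: psubst_superset[of ?A] lookup_add single_add distrib_right sum.distrib)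
qed

lemma psubst_mono: "psubst \<sigma> (mon k a) = mon 0 a * (\<Prod>x\<in>#k. \<sigma> x)"
  by (subst psubst_superset[of "{k}"]) auto

lemma psubst_const [simp]: "psubst \<sigma> (mon 0 a) = mon 0 a"
  by (simp add: psubst_mono)

lemma psubst_1 [simp]: "psubst \<sigma> 1 = 1"
  using psubst_const[of \<sigma> 1] by simp

lemma psubst_0 [simp]: "psubst \<sigma> 0 = 0"
  by (simp add: psubst_def)

lemma psubst_uminus: "psubst \<sigma> (- f) = - psubst \<sigma> f"
  using psubst_add[of \<sigma> "-f" f] by (simp add: eq_neg_iff_add_eq_0)

lemma psubst_diff: "psubst \<sigma> (f - g) = psubst \<sigma> f - psubst \<sigma> g"
  using psubst_add[of \<sigma> f "-g"] by (simp add: psubst_uminus)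

lemma psubst_sum: "psubst \<sigma> (\<Sum>x\<in>A. f x) = (\<Sum>x\<in>A. psubst \<sigma> (f x))"
  by (induction A rule: infinite_finite_induct) (auto simp: psubst_add)

lemma psubst_times: "psubst \<sigma> (f * g) = psubst \<sigma> f * psubst \<sigma> g"
proof (induction f rule: poly_mapping_additive_induct)
  case (mon k a)
  show ?case
  proof (induction g rule: poly_mapping_additive_induct)
    case (mon l b)
    have e: "mon k a * mon l b = mon (k + l) (a * b)"
      "mon 0 (a * b) = mon (0::nat multiset) a * mon 0 b" by (simp_all add: mult_single)
    show ?case unfolding e(1) psubst_mono e(2) by (simp add: ac_simps)
  next
    case (add f g)
    then show ?case by (simp add: distrib_left psubst_add)
  qed
next
  case (add f1 f2)
  then show ?case by (simp add: distrib_right psubst_add)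
qed

lemma psubst_prod_mset: "psubst \<sigma> (\<Prod>x\<in>#k. f x) = (\<Prod>x\<in>#k. psubst \<sigma> (f x))"
  by (induction k) (auto simp: psubst_times)

lemma psubst_subst: "psubst \<sigma> (psubst \<rho> f) = psubst (\<lambda>x. psubst \<sigma> (\<rho> x)) f"
  unfolding psubst_def[of \<rho>] by (simp add: psubst_sum psubst_times psubst_prod_mset psubst_def[of "\<lambda>x. psubst \<sigma> (\<rho> x)"])

lemma prod_vars: "(\<Prod>x\<in>#k. mon {#x#} (1::'p::comm_ring_1)) = mon k 1"
  by (induction k) (auto simp: mult_single)

lemma psubst_cong:
  assumes "\<And>k x. coef f k \<noteq> 0 \<Longrightarrow> x \<in># k \<Longrightarrow> \<sigma> x = \<rho> x"
  shows "psubst \<sigma> f = psubst \<rho> f"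
  unfolding psubst_def
proof (intro sum.cong refl arg_cong2[of _ _ _ _ "(*)"] arg_cong[of _ _ prod_mset] image_mset_cong)
  fix k x assume "k \<in> Poly_Mapping.keys f" "x \<in># k"
  then show "\<sigma> x = \<rho> x" using assms by (simp add: in_keys_iff)
qed

lemma psubst_vars: "psubst (\<lambda>x. mon {#x#} 1) f = f"
proof -
  have "psubst (\<lambda>x. mon {#x#} 1) f = (\<Sum>k\<in>Poly_Mapping.keys f. mon k (coef f k))"
    unfolding psubst_def prod_vars by (simp add: mult_single)
  then show ?thesis using poly_mapping_sum_mons[of f] by simp
qed

definition map_coefs :: "('p::zero \<Rightarrow> 'q::zero) \<Rightarrow> ('k \<Rightarrow>\<^sub>0 'p) \<Rightarrow> ('k \<Rightarrow>\<^sub>0 'q)"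
  where "map_coefs h f = Abs_poly_mapping (\<lambda>k. h (coef f k))"

lemma coef_map_coefs:
  assumes "h 0 = 0"
  shows "coef (map_coefs h f) k = h (coef f k)"
proof -
  have "finite {k. h (coef f k) \<noteq> 0}"
    by (rule finite_subset[of _ "Poly_Mapping.keys f"]) (use assms in \<open>auto simp: in_keys_iff\<close>)
  then show ?thesis unfolding map_coefs_def by (simp add: lookup_Abs_poly_mapping)
qed

lemma map_coefs_preserves:
  assumes "h 0 = 0"
  shows "deg_le d f \<Longrightarrow> deg_le d (map_coefs h f)"
    and "homogeneous e f \<Longrightarrow> homogeneous e (map_coefs h f)"
    and "vars_below v f \<Longrightarrow> vars_below v (map_coefs h f)"
proof -
  have nz: "coef f k \<noteq> 0" if "coef (map_coefs h f) k \<noteq> 0" for k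
    using that assms by (auto simp: coef_map_coefs)
  show "deg_le d f \<Longrightarrow> deg_le d (map_coefs h f)" unfolding deg_le_def using nz by blast
  show "homogeneous e f \<Longrightarrow> homogeneous e (map_coefs h f)" unfolding homogeneous_def using nz by blast
  show "vars_below v f \<Longrightarrow> vars_below v (map_coefs h f)" unfolding vars_below_def using nz by blast
qed

lemma deg_le_psubst:
  assumes "deg_le d f" "\<And>x. deg_le 1 (\<sigma> x)"
  shows "deg_le d (psubst \<sigma> f)"
proof -
  have 1: "deg_le (size k) (\<Prod>x\<in>#k. \<sigma> x)" for k
    by (induction k) (use deg_le_times[of 1 "\<sigma> _"] assms(2) in auto)
  show ?thesis unfolding psubst_def
  proof (intro deg_le_sum)
    fix k assume "k \<in> Poly_Mapping.keys f"
    then have "size k \<le> d" using assms(1) by (auto simp: deg_le_def in_keys_iff)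
    with deg_le_times[of 0 "mon 0 (coef f k)", OF _ 1[of k]]
    show "deg_le d (mon 0 (coef f k) * (\<Prod>x\<in>#k. \<sigma> x))"
      by (auto simp: deg_le_mon_iff intro: deg_le_mono)
  qed
qed

lemma homogeneous_psubst:
  assumes "homogeneous d f" "\<And>x. homogeneous 1 (\<sigma> x)"
  shows "homogeneous d (psubst \<sigma> f)"
proof -
  have 1: "homogeneous (int (size k)) (\<Prod>x\<in>#k. \<sigma> x)" for k
    by (induction k) (use homogeneous_times[of 1 "\<sigma> _"] assms(2) in auto)
  show ?thesis unfolding psubst_def
  proof (intro homogeneous_sum)
    fix k assume "k \<in> Poly_Mapping.keys f"
    then have "int (size k) = d" using assms(1) by (auto simp: homogeneous_def in_keys_iff)
    with homogeneous_times[of 0 "mon 0 (coef f k)", OF _ 1[of k]]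
    show "homogeneous d (mon 0 (coef f k) * (\<Prod>x\<in>#k. \<sigma> x))"
      by (auto simp: homogeneous_mon)
  qed
qed

lemma vars_below_psubst:
  assumes "vars_below v f" "\<And>x. x < v \<Longrightarrow> vars_below w (\<sigma> x)"
  shows "vars_below w (psubst \<sigma> f)"
  unfolding psubst_def
proof (intro vars_below_sum vars_below_times vars_below_mon)
  fix k assume "k \<in> Poly_Mapping.keys f"
  then have "set_mset k \<subseteq> {..<v}" using assms(1) by (auto simp: vars_below_def in_keys_iff)
  then show "vars_below w (\<Prod>x\<in>#k. \<sigma> x)"
    using assms(2) by (induction k) (auto intro: vars_below_times)
qed auto

section \<open>Elimination of one variable\<close>

locale prime_ideal_set =
  fixes I :: "'p::comm_ring_1 set"
  assumes zero [simp]: "0 \<in> I"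
    and add: "a \<in> I \<Longrightarrow> b \<in> I \<Longrightarrow> a + b \<in> I"
    and mult: "a \<in> I \<Longrightarrow> c * a \<in> I"
    and prime: "a * b \<in> I \<Longrightarrow> a \<in> I \<or> b \<in> I"
    and one: "1 \<notin> I"
begin

lemma mult2: "a \<in> I \<Longrightarrow> a * c \<in> I"
  using mult[of a c] by (simp add: mult.commute)

lemma uminus: "a \<in> I \<Longrightarrow> - a \<in> I"
  using mult[of a "-1"] by simp

lemma diff: "a \<in> I \<Longrightarrow> b \<in> I \<Longrightarrow> a - b \<in> I"
  using add[of a "-b"] uminus[of b] by simp

lemma sum: "(\<And>x. x \<in> A \<Longrightarrow> f x \<in> I) \<Longrightarrow> (\<Sum>x\<in>A. f x) \<in> I"
  by (induction A rule: infinite_finite_induct) (auto intro: add)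

lemma add_cancel: "a - b \<in> I \<Longrightarrow> a \<in> I \<longleftrightarrow> b \<in> I"
  using add[of "a - b" b] diff[of a "a - b"] by auto

lemma power_notin: "a \<notin> I \<Longrightarrow> a ^ k \<notin> I"
  by (induction k) (auto simp: one dest!: prime)

end

definition coefs_in :: "'p::zero set \<Rightarrow> ('k \<Rightarrow>\<^sub>0 'p) set"
  where "coefs_in I = {f. \<forall>k. coef f k \<in> I}"

text \<open>Gauss's lemma. The multiset order is total and compatible with addition; if
  \<open>a\<close> and \<open>b\<close> are the largest exponents of \<open>f\<close> and
  \<open>g\<close> with coefficient outside \<open>I\<close>, then modulo \<open>I\<close> the
  coefficient of the product at \<open>a + b\<close> is the product of these two
  coefficients.\<close>

lemma (in prime_ideal_set) coefs_in_prime: "prime_ideal_set (coefs_in I :: 'p mpol set)"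
proof
  show "0 \<in> (coefs_in I :: 'p mpol set)" by (simp add: coefs_in_def)
  show "a + b \<in> coefs_in I" if "a \<in> coefs_in I" "b \<in> coefs_in I" for a b :: "'p mpol"
    using that by (auto simp: coefs_in_def lookup_add add)
  show "c * a \<in> coefs_in I" if "a \<in> coefs_in I" for a c :: "'p mpol"
    using that by (auto simp: coefs_in_def coef_times intro!: sum mult)
  show "1 \<notin> (coefs_in I :: 'p mpol set)"
    using one by (auto simp: coefs_in_def lookup_one when_def intro!: exI[of _ 0])
  show "f \<in> coefs_in I \<or> g \<in> coefs_in I" if fg: "f * g \<in> coefs_in I" for f g :: "'p mpol"
  proof (rule ccontr)
    assume "\<not> ?thesis"
    then have ex: "\<exists>k. coef f k \<notin> I" "\<exists>k. coef g k \<notin> I" by (auto simp: coefs_in_def)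
    have max: "\<exists>a. coef h a \<notin> I \<and> (\<forall>k. k > a \<longrightarrow> coef h k \<in> I)"
      if "\<exists>k. coef h k \<notin> I" for h :: "'p mpol"
    proof -
      let ?S = "{k. coef h k \<notin> I}"
      have "?S \<subseteq> Poly_Mapping.keys h" by (auto simp: in_keys_iff)
      then have fin: "finite ?S" by (rule finite_subset) simp
      have "Max ?S \<in> ?S" using that fin by (intro Max_in) auto
      moreover have "k \<notin> ?S" if "k > Max ?S" for k
        using Max_ge[OF fin] that by (meson leD)
      ultimately show ?thesis by blast
    qed
    obtain a where a: "coef f a \<notin> I" "\<And>k. k > a \<Longrightarrow> coef f k \<in> I" using max[OF ex(1)] by blast
    obtain b where b: "coef g b \<notin> I" "\<And>k. k > b \<Longrightarrow> coef g k \<in> I" using max[OF ex(2)] by blast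
    have rest: "(\<Sum>k\<in>{k. k \<subseteq># a + b} - {a}. coef f k * coef g (a + b - k)) \<in> I"
    proof (rule sum)
      fix k assume k: "k \<in> {k. k \<subseteq># a + b} - {a}"
      define l where "l = a + b - k"
      have kl: "k + l = a + b" using k by (simp add: l_def)
      show "coef f k * coef g (a + b - k) \<in> I"
      proof (cases "k > a")
        case True
        then show ?thesis using a(2) by (simp add: mult2)
      next
        case False
        then have "k < a" using k by auto
        then have "l > b" using kl by (metis add_less_le_mono less_irrefl not_less)
        then show ?thesis using b(2) by (simp add: mult l_def)
      qed
    qed
    have "coef (f * g) (a + b) = coef f a * coef g b
        + (\<Sum>k\<in>{k. k \<subseteq># a + b} - {a}. coef f k * coef g (a + b - k))"
      unfolding coef_times by (subst sum.remove[of _ a]) (auto simp: finite_submultisets)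
    then have "coef f a * coef g b = coef (f * g) (a + b)
        - (\<Sum>k\<in>{k. k \<subseteq># a + b} - {a}. coef f k * coef g (a + b - k))" by (simp only: add_diff_cancel_right')
    moreover have "coef (f * g) (a + b) \<in> I" using fg by (simp add: coefs_in_def)
    ultimately have "coef f a * coef g b \<in> I" using diff[OF _ rest] by (simp only:)
    with a(1) b(1) prime show False by blast
  qed
qed

lemma coefs_in_mon: "0 \<in> I \<Longrightarrow> a \<in> I \<Longrightarrow> mon k a \<in> coefs_in I"
  by (auto simp: coefs_in_def lookup_single when_def)

lemma coefs_in_psubst:
  assumes "prime_ideal_set I" "f \<in> coefs_in I"
  shows "psubst \<sigma> f \<in> coefs_in I"
proof -
  interpret prime_ideal_set I by fact
  interpret X: prime_ideal_set "coefs_in I :: 'a mpol set" by (rule coefs_in_prime)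
  show ?thesis unfolding psubst_def
    by (intro X.sum X.mult2 coefs_in_mon) (use assms(2) in \<open>auto simp: coefs_in_def\<close>)
qed

subsection \<open>Coefficients with respect to one variable\<close>

text \<open>The coefficient of the \<open>k\<close>-th power of the variable \<open>v\<close>, with
  \<open>f\<close> read as a polynomial in that variable. Monomials containing \<open>v\<close> get
  the value 0, which makes the result free of \<open>v\<close>.\<close>

definition xcoef :: "nat \<Rightarrow> nat \<Rightarrow> 'p::zero mpol \<Rightarrow> 'p mpol"
  where "xcoef v k f =
    Abs_poly_mapping (\<lambda>m. if v \<in># m then 0 else coef f (m + replicate_mset k v))"

lemma coef_xcoef:
  "coef (xcoef v k f) m = (if v \<in># m then 0 else coef f (m + replicate_mset k v))"
proof -
  have "finite {m. (if v \<in># m then 0 else coef f (m + replicate_mset k v)) \<noteq> 0}"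
  proof (rule finite_subset)
    show "{m. (if v \<in># m then 0 else coef f (m + replicate_mset k v)) \<noteq> 0}
        \<subseteq> (\<lambda>m. m - replicate_mset k v) ` Poly_Mapping.keys f"
      by (auto simp: in_keys_iff image_iff split: if_splits)
        (metis add_diff_cancel_right' in_keys_iff)
  qed simp
  then show ?thesis unfolding xcoef_def by (simp add: lookup_Abs_poly_mapping)
qed

lemma mset_split_var: "filter_mset (\<lambda>x. x \<noteq> v) m + replicate_mset (count m v) v = m"
  by (metis filter_eq_replicate_mset multiset_partition add.commute)

lemma coef_via_xcoef: "coef f m = coef (xcoef v (count m v) f) (filter_mset (\<lambda>x. x \<noteq> v) m)"
  by (simp add: coef_xcoef mset_split_var)

lemma xcoef_ext: "(\<And>k. xcoef v k f = xcoef v k g) \<Longrightarrow> f = g"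
  by (rule poly_mapping_eqI) (metis coef_via_xcoef)

lemma xcoef_add: "xcoef v k (f + g) = xcoef v k f + xcoef v k (g :: 'p::comm_monoid_add mpol)"
  by (rule poly_mapping_eqI) (simp add: coef_xcoef lookup_add)

lemma xcoef_0 [simp]: "xcoef v k 0 = 0"
  by (rule poly_mapping_eqI) (simp add: coef_xcoef)

lemma xcoef_diff: "xcoef v k (f - g) = xcoef v k f - xcoef v k (g :: 'p::ab_group_add mpol)"
  by (rule poly_mapping_eqI) (simp add: coef_xcoef lookup_minus)

lemma xcoef_sum: "xcoef v k (\<Sum>x\<in>A. f x) = (\<Sum>x\<in>A. xcoef v k (f x) :: 'p::comm_monoid_add mpol)"
  by (induction A rule: infinite_finite_induct) (auto simp: xcoef_add)

lemma filter_replicate_neq: "filter_mset (\<lambda>x. x \<noteq> v) (replicate_mset k v) = {#}"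
  by (induction k) auto

lemma xcoef_mon:
  "xcoef v k (mon m a) = (if count m v = k then mon (filter_mset (\<lambda>x. x \<noteq> v) m) a else 0)"
proof (rule poly_mapping_eqI)
  fix l
  have "m = l + replicate_mset k v \<and> v \<notin># l \<longleftrightarrow> count m v = k \<and> filter_mset (\<lambda>x. x \<noteq> v) m = l"
  proof
    assume m: "m = l + replicate_mset k v \<and> v \<notin># l"
    then have "filter_mset (\<lambda>x. x \<noteq> v) l = l"
      by (auto simp: filter_mset_eq_conv)
    moreover have "count m v = k" "filter_mset (\<lambda>x. x \<noteq> v) m = filter_mset (\<lambda>x. x \<noteq> v) l"
      using m by (simp_all add: not_in_iff filter_replicate_neq)
    ultimately show "count m v = k \<and> filter_mset (\<lambda>x. x \<noteq> v) m = l" by simp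
  next
    assume m: "count m v = k \<and> filter_mset (\<lambda>x. x \<noteq> v) m = l"
    then have "v \<notin># l" by (metis (mono_tags) count_filter_mset not_in_iff)
    with m show "m = l + replicate_mset k v \<and> v \<notin># l"
      using mset_split_var[of v m] by simp
  qed
  then show "coef (xcoef v k (mon m a)) l
      = coef (if count m v = k then mon (filter_mset (\<lambda>x. x \<noteq> v) m) a else 0) l"
    by (auto simp: coef_xcoef lookup_single when_def)
qed

lemma xcoef_times:
  fixes f g :: "'p::comm_ring_1 mpol"
  shows "xcoef v l (f * g) = (\<Sum>k\<le>l. xcoef v k f * xcoef v (l - k) g)"
proof (induction f rule: poly_mapping_additive_induct)
  case (mon a s)
  show ?case
  proof (induction g rule: poly_mapping_additive_induct)
    case (mon b t)
    let ?F = "\<lambda>m. filter_mset (\<lambda>x. x \<noteq> v) m"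
    have "(\<Sum>k\<le>l. xcoef v k (mon a s) * xcoef v (l - k) (mon b t))
        = (\<Sum>k\<le>l. if k = count a v then
             (if count b v = l - k then mon (?F a) s * mon (?F b) t else 0) else 0)"
      by (intro sum.cong) (auto simp: xcoef_mon)
    also have "\<dots> = (if count a v + count b v = l then mon (?F a) s * mon (?F b) t else 0)"
      by (auto simp: sum.delta)
    finally show ?case by (simp add: mult_single xcoef_mon)
  next
    case (add f g)
    then show ?case by (simp add: distrib_left xcoef_add sum.distrib)
  qed
next
  case (add f g)
  then show ?case by (simp add: distrib_right xcoef_add sum.distrib)
qed

lemma power_var: "mon {#v#} (1::'p::comm_ring_1) ^ k = mon (replicate_mset k v) 1"
  by (induction k) (auto simp: mult_single)

lemma xcoef_times_power:
  "xcoef v l (h * mon {#v#} (1::'p::comm_ring_1) ^ k) = (if k \<le> l then xcoef v (l - k) h else 0)"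
proof -
  have "xcoef v l (mon {#v#} (1::'p) ^ k * h) = (\<Sum>i\<le>l. if i = k then xcoef v (l - i) h else 0)"
    unfolding xcoef_times power_var
    by (intro sum.cong) (auto simp: xcoef_mon filter_replicate_neq)
  then show ?thesis by (simp add: mult.commute)
qed

lemma xcoef_xcoef: "xcoef v j (xcoef v k f) = (if j = 0 then xcoef v k f else 0)"
proof (rule poly_mapping_eqI)
  fix m
  show "coef (xcoef v j (xcoef v k f)) m = coef (if j = 0 then xcoef v k f else 0) m"
    by (cases j) (auto simp: coef_xcoef)
qed

lemma xcoef_vars_below: "vars_below v f \<Longrightarrow> xcoef v k f = (if k = 0 then f else 0)"
proof (rule poly_mapping_eqI)
  fix m assume f: "vars_below v f"
  have "coef f l = 0" if "v \<in># l" for l using f that by (auto simp: vars_below_def)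
  then show "coef (xcoef v k f) m = coef (if k = 0 then f else 0) m"
    by (cases k) (auto simp: coef_xcoef)
qed

lemma xcoef_expand:
  fixes f :: "'p::comm_ring_1 mpol"
  assumes "\<And>k. k \<ge> D \<Longrightarrow> xcoef v k f = 0"
  shows "f = (\<Sum>k<D. xcoef v k f * mon {#v#} 1 ^ k)"
proof (rule xcoef_ext)
  fix l
  have "xcoef v l (\<Sum>k<D. xcoef v k f * mon {#v#} 1 ^ k) = (\<Sum>k<D. if k = l then xcoef v k f else 0)"
    unfolding xcoef_sum xcoef_times_power xcoef_xcoef by (intro sum.cong) auto
  also have "\<dots> = xcoef v l f" using assms[of l] by (auto simp: sum.delta)
  finally show "xcoef v l f = xcoef v l (\<Sum>k<D. xcoef v k f * mon {#v#} 1 ^ k)" by simp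
qed

lemma vars_below_xcoef: "vars_below (Suc v) f \<Longrightarrow> vars_below v (xcoef v k f)"
  unfolding vars_below_def coef_xcoef by (fastforce split: if_splits simp: less_Suc_eq)

lemma vars_below_xcoef': "vars_below w f \<Longrightarrow> vars_below w (xcoef v k f)"
  unfolding vars_below_def
proof (intro allI impI)
  fix m assume f: "\<forall>k. coef f k \<noteq> 0 \<longrightarrow> set_mset k \<subseteq> {..<w}" and "coef (xcoef v k f) m \<noteq> 0"
  then have "coef f (m + replicate_mset k v) \<noteq> 0" by (auto simp: coef_xcoef split: if_splits)
  with f have "set_mset (m + replicate_mset k v) \<subseteq> {..<w}" by blast
  then show "set_mset m \<subseteq> {..<w}" by simp
qed

lemma homogeneous_xcoef: "homogeneous d f \<Longrightarrow> homogeneous (d - int k) (xcoef v k f)"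
  unfolding homogeneous_def coef_xcoef by (auto split: if_splits)

lemma deg_le_xcoef: "deg_le d f \<Longrightarrow> deg_le d (xcoef v k f)"
  unfolding deg_le_def coef_xcoef by (auto split: if_splits)

lemma xcoef_deg_le: "deg_le d f \<Longrightarrow> d < k \<Longrightarrow> xcoef v k f = 0"
  by (rule poly_mapping_eqI) (force simp: coef_xcoef deg_le_def)

lemma coefs_in_xcoef: "0 \<in> I \<Longrightarrow> f \<in> coefs_in I \<Longrightarrow> xcoef v k f \<in> coefs_in I"
  by (auto simp: coefs_in_def coef_xcoef)

lemma coefs_in_xcoefI: "(\<And>k. xcoef v k f \<in> coefs_in I) \<Longrightarrow> f \<in> coefs_in I"
  by (auto simp: coefs_in_def) (metis coef_via_xcoef)

subsection \<open>Syzygies of bounded degree\<close>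

text \<open>Solutions over the quotient by \<open>I\<close>, represented by vectors over the ring
  itself. Entries with index at least \<open>n\<close> are arbitrary.\<close>

definition syz :: "'p::comm_ring_1 set \<Rightarrow> nat \<Rightarrow> nat \<Rightarrow> (nat \<Rightarrow> nat \<Rightarrow> 'p mpol) \<Rightarrow> (nat \<Rightarrow> 'p mpol) set"
  where "syz I m n A = {y. \<forall>i<m. (\<Sum>j<n. A i j * y j) \<in> coefs_in I}"

text \<open>The rule \<open>gen_div\<close> makes the elements outside \<open>M\<close> act as units. Only the entries with index
  below \<open>n\<close> matter, as any vector whose entries below \<open>n\<close> vanish is contained by \<open>gen_null\<close>.\<close>

inductive_set gen :: "'p::comm_ring_1 set \<Rightarrow> 'p set \<Rightarrow> nat \<Rightarrow> nat \<Rightarrow> (nat \<Rightarrow> nat \<Rightarrow> 'p mpol) \<Rightarrow> nat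
    \<Rightarrow> (nat \<Rightarrow> 'p mpol) set"
  for I M m n A b where
  gen_syz: "z \<in> syz I m n A \<Longrightarrow> (\<And>j. j < n \<Longrightarrow> deg_le b (z j)) \<Longrightarrow> z \<in> gen I M m n A b"
| gen_null: "(\<And>j. j < n \<Longrightarrow> z j \<in> coefs_in I) \<Longrightarrow> z \<in> gen I M m n A b"
| gen_add: "y \<in> gen I M m n A b \<Longrightarrow> z \<in> gen I M m n A b \<Longrightarrow> (\<lambda>j. y j + z j) \<in> gen I M m n A b"
| gen_smult: "y \<in> gen I M m n A b \<Longrightarrow> (\<lambda>j. c * y j) \<in> gen I M m n A b"
| gen_div: "s \<notin> M \<Longrightarrow> (\<lambda>j. mon 0 s * y j) \<in> gen I M m n A b \<Longrightarrow> y \<in> gen I M m n A b"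

lemma gen_sum:
  assumes "0 \<in> I" "\<And>x. x \<in> S \<Longrightarrow> y x \<in> gen I M m n A b"
  shows "(\<lambda>j. \<Sum>x\<in>S. y x j) \<in> gen I M m n A b"
  using assms(2)
proof (induction S rule: infinite_finite_induct)
  case (insert x S)
  then have "(\<lambda>j. y x j + (\<Sum>x\<in>S. y x j)) \<in> gen I M m n A b" by (intro gen_add) auto
  with insert show ?case by simp
qed (use assms(1) in \<open>auto intro!: gen_null simp: coefs_in_def\<close>)

lemma gen_congruent:
  assumes "y \<in> gen I M m n A b" "\<And>j. j < n \<Longrightarrow> z j - y j \<in> coefs_in I"
  shows "z \<in> gen I M m n A b"
  using gen_add[OF assms(1) gen_null[of n "\<lambda>j. z j - y j"]] assms(2) by simp

lemma (in prime_ideal_set) syz_lincomb: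
  assumes "\<And>x. x \<in> S \<Longrightarrow> y x \<in> syz I m n A"
  shows "(\<lambda>j. \<Sum>x\<in>S. c x * y x j) \<in> syz I m n A"
proof -
  interpret X: prime_ideal_set "coefs_in I :: 'p mpol set" by (rule coefs_in_prime)
  have *: "(\<Sum>j<n. A i j * (\<Sum>x\<in>S. c x * y x j)) = (\<Sum>x\<in>S. c x * (\<Sum>j<n. A i j * y x j))" for i
    by (simp add: sum_distrib_left algebra_simps) (rule sum.swap)
  have **: "(\<Sum>j<n. A i j * y x j) \<in> coefs_in I" if "i < m" "x \<in> S" for i x
    using assms that by (auto simp: syz_def)
  show ?thesis unfolding syz_def mem_Collect_eq
  proof (intro allI impI)
    fix i assume "i < m"
    then show "(\<Sum>j<n. A i j * (\<Sum>x\<in>S. c x * y x j)) \<in> coefs_in I"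
      unfolding * by (intro X.sum X.mult **)
  qed
qed

lemma (in prime_ideal_set) syz_smult: "y \<in> syz I m n A \<Longrightarrow> (\<lambda>j. c * y j) \<in> syz I m n A"
  using syz_lincomb[of "{()}" "\<lambda>_. y" m n A "\<lambda>_. c"] by simp

lemma (in prime_ideal_set) syz_diff:
  assumes "y \<in> syz I m n A" "z \<in> syz I m n A"
  shows "(\<lambda>j. y j - z j) \<in> syz I m n A"
  using syz_lincomb[of UNIV "\<lambda>b. if b then y else z" m n A "\<lambda>b. if b then 1 else -1"] assms
  by (simp add: UNIV_bool)

lemma (in prime_ideal_set) syz_congruent:
  assumes "y \<in> syz I m n A" "\<And>j. j < n \<Longrightarrow> z j - y j \<in> coefs_in I"
  shows "z \<in> syz I m n A"
proof -
  interpret X: prime_ideal_set "coefs_in I :: 'p mpol set" by (rule coefs_in_prime)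
  have "(\<Sum>j<n. A i j * z j) = (\<Sum>j<n. A i j * y j) + (\<Sum>j<n. A i j * (z j - y j))" for i
    by (simp add: sum.distrib [symmetric] algebra_simps)
  moreover have "(\<Sum>j<n. A i j * (z j - y j)) \<in> coefs_in I" for i
    using assms(2) by (intro X.sum X.mult) auto
  ultimately show ?thesis using assms(1) unfolding syz_def by (auto intro: X.add)
qed

locale local_pair = I: prime_ideal_set I + M: prime_ideal_set M
  for I M :: "'p::comm_ring_1 set" +
  assumes I_le_M: "I \<subseteq> M"
begin

sublocale IX: prime_ideal_set "coefs_in I :: 'p mpol set" by (rule I.coefs_in_prime)

end

section \<open>Division by the pivot and truncation in the last variable\<close>

lemma mon_0_mult: "mon (0::nat multiset) (a * b :: 'p::comm_ring_1) = mon 0 a * mon 0 b"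
  by (simp add: mult_single)

lemma mon_0_power: "mon (0::nat multiset) (a ^ k :: 'p::comm_ring_1) = mon 0 a ^ k"
  by (induction k) (auto simp: mon_0_mult)

lemma xcoef_free_times:
  fixes g h :: "'p::comm_ring_1 mpol"
  assumes "vars_below v h"
  shows "xcoef v l (h * g) = h * xcoef v l g"
proof -
  have "xcoef v l (h * g) = (\<Sum>k\<le>l. if k = 0 then h * xcoef v (l - k) g else 0)"
    unfolding xcoef_times by (intro sum.cong) (auto simp: xcoef_vars_below[OF assms])
  then show ?thesis by simp
qed

lemma xcoef_bounded: "\<exists>B. \<forall>k\<ge>B. xcoef v k f = 0"
proof -
  let ?B = "Suc (Max (size ` Poly_Mapping.keys f))"
  have "deg_le (Max (size ` Poly_Mapping.keys f)) f"
    by (auto simp: deg_le_def in_keys_iff intro!: Max_ge)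
  then show ?thesis by (intro exI[of _ ?B]) (auto intro: xcoef_deg_le)
qed

text \<open>The cofactor of the \<open>\<delta>\<close>-th power has degree 0 by homogeneity. Being
  monic up to a unit is thus a condition on a single constant.\<close>

lemma xcoef_lead:
  fixes \<Delta> :: "'p::comm_ring_1 mpol"
  assumes "homogeneous (int \<delta>) \<Delta>"
  shows "xcoef v \<delta> \<Delta> = mon 0 (coef \<Delta> (replicate_mset \<delta> v))"
proof (rule poly_mapping_eqI)
  fix m
  have "size m = 0" if "coef \<Delta> (m + replicate_mset \<delta> v) \<noteq> 0"
    using assms that unfolding homogeneous_def by fastforce
  then show "coef (xcoef v \<delta> \<Delta>) m = coef (mon 0 (coef \<Delta> (replicate_mset \<delta> v))) m"
    by (cases "m = {#}") (auto simp: coef_xcoef lookup_single when_def)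
qed

lemma homogeneous_deg_le: "homogeneous (int \<delta>) f \<Longrightarrow> deg_le \<delta> f"
  by (auto simp: homogeneous_def deg_le_def)

text \<open>The leading coefficient \<open>e\<close> is not invertible in the ring, so each
  cancellation of the top power of the variable costs a factor \<open>e\<close>. These factors are
  outside \<open>M\<close> in the application and are removed by \<open>gen_div\<close>.\<close>

lemma pseudo_division:
  fixes f \<Delta> :: "'p::comm_ring_1 mpol"
  assumes \<Delta>: "homogeneous (int \<delta>) \<Delta>" "vars_below (Suc v) \<Delta>" and f: "vars_below (Suc v) f"
    and e: "e = coef \<Delta> (replicate_mset \<delta> v)"
  shows "\<exists>q K. vars_below (Suc v) q \<and> (\<forall>k\<ge>\<delta>. xcoef v k (mon 0 (e ^ K) * f - q * \<Delta>) = 0)"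
proof -
  obtain B where "\<forall>k\<ge>B. xcoef v k f = 0" using xcoef_bounded by blast
  then show ?thesis using f
  proof (induction B arbitrary: f)
    case 0
    then show ?case by (intro exI[of _ 0]) simp
  next
    case (Suc k)
    show ?case
    proof (cases "k < \<delta>")
      case True
      then show ?thesis using Suc.prems by (intro exI[of _ 0]) simp
    next
      case False
      define h where "h = xcoef v k f"
      define f' where "f' = mon 0 e * f - h * mon {#v#} 1 ^ (k - \<delta>) * \<Delta>"
      have h: "vars_below v h" using Suc.prems(2) by (simp add: h_def vars_below_xcoef)
      have h': "vars_below (Suc v) h" using Suc.prems(2) by (simp add: h_def vars_below_xcoef')
      have X: "vars_below (Suc v) (mon {#v#} (1::'p) ^ (k - \<delta>))"
        by (intro vars_below_power vars_below_mon) simp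
      have "xcoef v l f' = 0" if "l \<ge> k" for l
      proof -
        have "xcoef v l (h * mon {#v#} 1 ^ (k - \<delta>) * \<Delta>) = xcoef v l (h * (\<Delta> * mon {#v#} 1 ^ (k - \<delta>)))"
          by (simp only: ac_simps)
        also have "\<dots> = h * xcoef v (l - (k - \<delta>)) \<Delta>"
          using that by (simp add: xcoef_free_times[OF h] xcoef_times_power)
        also have "\<dots> = mon 0 e * xcoef v l f"
        proof (cases "l = k")
          case True
          with False have "l - (k - \<delta>) = \<delta>" by simp
          then show ?thesis using \<Delta>(1) by (simp add: xcoef_lead e h_def True mult.commute)
        next
          case l: False
          with that False have "l - (k - \<delta>) > \<delta>" by simp
          then have "xcoef v (l - (k - \<delta>)) \<Delta> = 0"
            by (rule xcoef_deg_le[OF homogeneous_deg_le[OF \<Delta>(1)]])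
          moreover have "xcoef v l f = 0" using Suc.prems(1) l that by simp
          ultimately show ?thesis by simp
        qed
        finally show ?thesis
          unfolding f'_def xcoef_diff by (simp add: xcoef_free_times vars_below_mon)
      qed
      moreover have "vars_below (Suc v) f'"
        unfolding f'_def by (intro vars_below_diff vars_below_times vars_below_mon Suc.prems h' \<Delta> X) simp
      ultimately obtain q K where q: "vars_below (Suc v) q"
        "\<forall>k\<ge>\<delta>. xcoef v k (mon 0 (e ^ K) * f' - q * \<Delta>) = 0"
        using Suc.IH by blast
      let ?q = "mon 0 (e ^ K) * (h * mon {#v#} 1 ^ (k - \<delta>)) + q"
      have "mon 0 (e ^ Suc K) * f - ?q * \<Delta> = mon 0 (e ^ K) * f' - q * \<Delta>"
        by (simp add: f'_def mon_0_mult algebra_simps)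
      then have "\<forall>k\<ge>\<delta>. xcoef v k (mon 0 (e ^ Suc K) * f - ?q * \<Delta>) = 0" using q(2) by simp
      moreover have "vars_below (Suc v) ?q"
        by (intro vars_below_add vars_below_times vars_below_mon q(1) h' X) simp
      ultimately show ?thesis by blast
    qed
  qed
qed

lemma sum_lessThan_add: "(\<Sum>q<a + b. g q) = (\<Sum>q<a. g q) + (\<Sum>k<b. g (a + k) :: 'b::comm_monoid_add)"
  for a b :: nat
  by (induction b) (auto simp: add.assoc)

lemma sum_div_mod:
  "(\<Sum>q<n * D. f (q div D) (q mod D)) = (\<Sum>j<n. \<Sum>k<D. f j k :: 'b::comm_monoid_add)" for n D :: nat
proof (induction n)
  case (Suc n)
  have "(\<Sum>q<Suc n * D. f (q div D) (q mod D)) = (\<Sum>q<n * D + D. f (q div D) (q mod D))"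
    by (simp add: add.commute)
  also have "\<dots> = (\<Sum>q<n * D. f (q div D) (q mod D))
      + (\<Sum>k<D. f ((n * D + k) div D) ((n * D + k) mod D))"
    by (rule sum_lessThan_add)
  also have "(\<Sum>k<D. f ((n * D + k) div D) ((n * D + k) mod D)) = (\<Sum>k<D. f n k)"
    by (intro sum.cong) auto
  finally show ?case using Suc by simp
qed simp

text \<open>\<open>V j\<close>, for \<open>j \<notin> J\<close>, are the Cramer solutions with common pivot \<open>\<Delta>\<close>, and the last clause says
  that every solution is a linear combination of them after multiplication by \<open>\<Delta>\<close>.\<close>

definition cramer_data :: "'p::comm_ring_1 set \<Rightarrow> nat \<Rightarrow> nat \<Rightarrow> (nat \<Rightarrow> nat \<Rightarrow> 'p mpol) \<Rightarrow> nat \<Rightarrow> nat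
    \<Rightarrow> nat \<Rightarrow> nat set \<Rightarrow> 'p mpol \<Rightarrow> (nat \<Rightarrow> nat \<Rightarrow> 'p mpol) \<Rightarrow> bool"
  where "cramer_data I m n A v D \<delta> J \<Delta> V \<longleftrightarrow>
    J \<subseteq> {..<n} \<and> \<delta> \<le> D \<and> homogeneous (int \<delta>) \<Delta> \<and> vars_below v \<Delta> \<and>
    (\<forall>j\<in>{..<n} - J. V j \<in> syz I m n A \<and> V j j = \<Delta> \<and> (\<forall>l\<in>{..<n} - J. l \<noteq> j \<longrightarrow> V j l = 0) \<and>
       (\<forall>l<n. deg_le D (V j l) \<and> vars_below v (V j l))) \<and>
    (\<forall>y\<in>syz I m n A. \<forall>l<n. \<Delta> * y l - (\<Sum>j\<in>{..<n} - J. y j * V j l) \<in> coefs_in I)"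

text \<open>Row \<open>p = i * L + l\<close> stands for the coefficient of the \<open>l\<close>-th power of the variable \<open>v\<close> in the
  \<open>i\<close>-th equation, and column \<open>q = j * D + k\<close> for the coefficient of its \<open>k\<close>-th power in the
  \<open>j\<close>-th unknown.\<close>

definition expanded_matrix :: "nat \<Rightarrow> nat \<Rightarrow> nat \<Rightarrow> (nat \<Rightarrow> nat \<Rightarrow> 'p::comm_ring_1 mpol) \<Rightarrow> nat \<Rightarrow> nat \<Rightarrow> 'p mpol"
  where "expanded_matrix v D L A p q =
    (if q mod D \<le> p mod L then xcoef v (p mod L - q mod D) (A (p div L) (q div D)) else 0)"

context local_pair
begin

lemma mon_0_notin: "e \<notin> I \<Longrightarrow> mon 0 e \<notin> (coefs_in I :: 'p mpol set)"
  by (auto simp: coefs_in_def lookup_single when_def intro!: exI[of _ 0])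

text \<open>Reassembling a vector of coefficients into a polynomial vector is linear and sends
  solutions of the expanded system to solutions of the original one. It raises the degree by at most
  \<open>D - 1\<close>, the largest power that is attached.\<close>

lemma gen_expanded:
  fixes A :: "nat \<Rightarrow> nat \<Rightarrow> 'p mpol"
  assumes A: "\<And>i j. i < m \<Longrightarrow> j < n \<Longrightarrow> deg_le d (A i j)"
    and z: "z \<in> gen I M (m * (D + d)) (n * D) (expanded_matrix v D (D + d) A) b'"
    and b: "D + b' \<le> b"
  shows "(\<lambda>j. \<Sum>k<D. z (j * D + k) * mon {#v#} 1 ^ k) \<in> gen I M m n A b"
  using z
proof (induction rule: gen.induct)
  case (gen_syz z)
  let ?X = "mon {#v#} (1::'p)"
  let ?L = "D + d"
  let ?A = "expanded_matrix v D ?L A"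
  let ?c = "\<lambda>i j l k. if k \<le> l then xcoef v (l - k) (A i j) else 0"
  show ?case
  proof (rule gen.gen_syz)
    fix j assume "j < n"
    show "deg_le b (\<Sum>k<D. z (j * D + k) * ?X ^ k)"
    proof (rule deg_le_sum)
      fix k assume k: "k \<in> {..<D}"
      have "j * D + k < Suc j * D" using k by simp
      also have "\<dots> \<le> n * D" using \<open>j < n\<close> by (intro mult_right_mono) auto
      finally have "deg_le b' (z (j * D + k))" using gen_syz.hyps(2) by simp
      moreover have "deg_le k (?X ^ k)" by (simp add: power_var deg_le_mon_iff)
      ultimately have "deg_le (b' + k) (z (j * D + k) * ?X ^ k)" by (rule deg_le_times)
      then show "deg_le b (z (j * D + k) * ?X ^ k)" by (rule deg_le_mono) (use k b in auto)
    qed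
  next
    have "(\<Sum>j<n. A i j * (\<Sum>k<D. z (j * D + k) * ?X ^ k)) \<in> coefs_in I" if i: "i < m" for i
    proof -
      \<comment> \<open>The product has degree at most \<open>d + (D - 1)\<close> in the variable
        \<open>v\<close>, so the \<open>D + d\<close> rows reserved for each equation hold all its
        coefficients.\<close>
      have AX: "A i j * ?X ^ k = (\<Sum>l<?L. ?c i j l k * ?X ^ l)" if "j < n" "k < D" for j k
      proof -
        have "A i j * ?X ^ k = (\<Sum>l<?L. xcoef v l (A i j * ?X ^ k) * ?X ^ l)"
          using xcoef_deg_le[OF A[OF i \<open>j < n\<close>]] \<open>k < D\<close>
          by (intro xcoef_expand) (simp add: xcoef_times_power)
        also have "\<dots> = (\<Sum>l<?L. ?c i j l k * ?X ^ l)"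
          by (intro sum.cong) (auto simp: xcoef_times_power)
        finally show ?thesis .
      qed
      have "(\<Sum>j<n. A i j * (\<Sum>k<D. z (j * D + k) * ?X ^ k))
          = (\<Sum>j<n. \<Sum>k<D. (A i j * ?X ^ k) * z (j * D + k))"
        by (simp add: sum_distrib_left ac_simps)
      also have "\<dots> = (\<Sum>j<n. \<Sum>k<D. \<Sum>l<?L. ?X ^ l * (?c i j l k * z (j * D + k)))"
        by (intro sum.cong refl) (simp add: AX sum_distrib_left sum_distrib_right ac_simps)
      also have "\<dots> = (\<Sum>j<n. \<Sum>l<?L. \<Sum>k<D. ?X ^ l * (?c i j l k * z (j * D + k)))"
        by (rule sum.cong[OF refl], rule sum.swap)
      also have "\<dots> = (\<Sum>l<?L. \<Sum>j<n. \<Sum>k<D. ?X ^ l * (?c i j l k * z (j * D + k)))"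
        by (rule sum.swap)
      also have "\<dots> = (\<Sum>l<?L. ?X ^ l * (\<Sum>j<n. \<Sum>k<D. ?c i j l k * z (j * D + k)))"
        by (simp only: sum_distrib_left)
      also have "\<dots> = (\<Sum>l<?L. ?X ^ l * (\<Sum>q<n * D. ?A (i * ?L + l) q * z q))"
      proof (rule sum.cong[OF refl])
        fix l assume l: "l \<in> {..<?L}"
        have "(i * L + l) div L = i \<and> (i * L + l) mod L = l" if "l < L" for L :: nat
          using that by simp
        with l have "(i * ?L + l) div ?L = i" "(i * ?L + l) mod ?L = l" by blast+
        then have "(\<Sum>q<n * D. ?A (i * ?L + l) q * z q)
            = (\<Sum>q<n * D. ?c i (q div D) l (q mod D) * z ((q div D) * D + q mod D))"
          by (intro sum.cong) (auto simp: expanded_matrix_def)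
        also have "\<dots> = (\<Sum>j<n. \<Sum>k<D. ?c i j l k * z (j * D + k))" by (rule sum_div_mod)
        finally show "?X ^ l * (\<Sum>j<n. \<Sum>k<D. ?c i j l k * z (j * D + k))
            = ?X ^ l * (\<Sum>q<n * D. ?A (i * ?L + l) q * z q)" by (simp only:)
      qed
      also have "\<dots> \<in> coefs_in I"
      proof (rule IX.sum, rule IX.mult)
        fix l assume l: "l \<in> {..<?L}"
        have "i * ?L + l < Suc i * ?L" using l by simp
        also have "\<dots> \<le> m * ?L" using i by (intro mult_right_mono) auto
        finally show "(\<Sum>q<n * D. ?A (i * ?L + l) q * z q) \<in> coefs_in I"
          using gen_syz.hyps(1) by (simp add: syz_def)
      qed
      finally show ?thesis .
    qed
    then show "(\<lambda>j. \<Sum>k<D. z (j * D + k) * ?X ^ k) \<in> syz I m n A" by (simp add: syz_def)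
  qed
next
  case (gen_null z)
  show ?case
  proof (intro gen.gen_null IX.sum IX.mult2 gen_null)
    fix j k assume "j < n" "k \<in> {..<D}"
    then have "j * D + k < Suc j * D" by simp
    also have "\<dots> \<le> n * D" using \<open>j < n\<close> by (intro mult_right_mono) auto
    finally show "j * D + k < n * D" .
  qed
next
  case (gen_add y z)
  have "(\<lambda>j. (\<Sum>k<D. y (j * D + k) * mon {#v#} 1 ^ k) + (\<Sum>k<D. z (j * D + k) * mon {#v#} 1 ^ k))
      \<in> gen I M m n A b"
    by (rule gen.gen_add[OF gen_add.IH])
  then show ?case by (simp add: sum.distrib distrib_right)
next
  case (gen_smult y c)
  have "(\<lambda>j. c * (\<Sum>k<D. y (j * D + k) * mon {#v#} 1 ^ k)) \<in> gen I M m n A b"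
    by (rule gen.gen_smult[OF gen_smult.IH])
  then show ?case by (simp add: sum_distrib_left mult.assoc)
next
  case (gen_div s y)
  have "(\<lambda>j. mon 0 s * (\<Sum>k<D. y (j * D + k) * mon {#v#} 1 ^ k)) \<in> gen I M m n A b"
    using gen_div.IH by (simp add: sum_distrib_left mult.assoc)
  then show ?case by (rule gen.gen_div[OF gen_div.hyps(1)])
qed

text \<open>Modulo \<open>I\<close> the vector \<open>y\<close> agrees with its truncation below
  degree \<open>D\<close>, whose coefficients solve the expanded system. The induction hypothesis is
  assumed for this one vector only, which keeps conditions on its variables out of the
  statement.\<close>

lemma gen_of_truncation:
  fixes A :: "nat \<Rightarrow> nat \<Rightarrow> 'p mpol"
  assumes A: "\<And>i j. i < m \<Longrightarrow> j < n \<Longrightarrow> deg_le d (A i j)"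
    and y: "y \<in> syz I m n A"
    and high: "\<And>j k. j < n \<Longrightarrow> k \<ge> D \<Longrightarrow> xcoef v k (y j) \<in> coefs_in I"
    and IH: "(\<lambda>q. xcoef v (q mod D) (y (q div D)))
        \<in> syz I (m * (D + d)) (n * D) (expanded_matrix v D (D + d) A) \<Longrightarrow>
      (\<lambda>q. xcoef v (q mod D) (y (q div D)))
        \<in> gen I M (m * (D + d)) (n * D) (expanded_matrix v D (D + d) A) b'"
    and b: "D + b' \<le> b"
  shows "y \<in> gen I M m n A b"
proof -
  let ?X = "mon {#v#} (1::'p)"
  let ?L = "D + d"
  define t where "t = (\<lambda>j. \<Sum>k<D. xcoef v k (y j) * ?X ^ k)"
  have xt: "xcoef v k (t j) = (if k < D then xcoef v k (y j) else 0)" for j k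
  proof -
    have "xcoef v k (t j) = (\<Sum>i<D. if i = k then xcoef v i (y j) else 0)"
      unfolding t_def xcoef_sum xcoef_times_power xcoef_xcoef by (intro sum.cong) auto
    then show ?thesis by (simp add: sum.delta)
  qed
  have ty: "y j - t j \<in> coefs_in I" if "j < n" for j
    by (rule coefs_in_xcoefI[of v]) (use high[OF that] in \<open>auto simp: xcoef_diff xt\<close>)
  have "t j - y j \<in> coefs_in I" if "j < n" for j
    using IX.uminus[OF ty[OF that]] by simp
  then have t: "t \<in> syz I m n A" by (rule I.syz_congruent[OF y])
  let ?y = "\<lambda>q. xcoef v (q mod D) (y (q div D))"
  have "?y \<in> syz I (m * ?L) (n * D) (expanded_matrix v D ?L A)"
    unfolding syz_def mem_Collect_eq
  proof (intro allI impI)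
    fix p assume p: "p < m * ?L"
    define i l where "i = p div ?L" and "l = p mod ?L"
    have i: "i < m" using p by (simp add: i_def less_mult_imp_div_less)
    have 1: "xcoef v l (A i j * t j)
        = (\<Sum>k<D. (if k \<le> l then xcoef v (l - k) (A i j) else 0) * xcoef v k (y j))" for j
    proof -
      have "xcoef v l (A i j * t j) = (\<Sum>a\<le>l. xcoef v (l - a) (A i j) * (if a < D then xcoef v a (y j) else 0))"
        unfolding mult.commute[of "A i j"] xcoef_times xt by (simp add: mult.commute)
      also have "\<dots> = (\<Sum>a\<in>{..l} \<inter> {..<D}. xcoef v (l - a) (A i j) * xcoef v a (y j))"
        by (intro sum.mono_neutral_cong_right) auto
      also have "\<dots> = (\<Sum>k<D. (if k \<le> l then xcoef v (l - k) (A i j) else 0) * xcoef v k (y j))"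
        by (intro sum.mono_neutral_cong_left) auto
      finally show ?thesis .
    qed
    have "(\<Sum>q<n * D. expanded_matrix v D ?L A p q * ?y q)
        = (\<Sum>q<n * D. (if q mod D \<le> l then xcoef v (l - q mod D) (A i (q div D)) else 0)
            * xcoef v (q mod D) (y (q div D)))"
      unfolding expanded_matrix_def i_def l_def by (rule refl)
    also have "\<dots> = (\<Sum>j<n. \<Sum>k<D. (if k \<le> l then xcoef v (l - k) (A i j) else 0) * xcoef v k (y j))"
      by (rule sum_div_mod)
    also have "\<dots> = xcoef v l (\<Sum>j<n. A i j * t j)" by (simp add: xcoef_sum 1)
    also have "\<dots> \<in> coefs_in I" using t i by (intro coefs_in_xcoef) (auto simp: syz_def)
    finally show "(\<Sum>q<n * D. expanded_matrix v D ?L A p q * ?y q) \<in> coefs_in I" .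
  qed
  then have "?y \<in> gen I M (m * ?L) (n * D) (expanded_matrix v D ?L A) b'" by (rule IH)
  from gen_expanded[OF A this b]
  have g: "(\<lambda>j. \<Sum>k<D. ?y (j * D + k) * ?X ^ k) \<in> gen I M m n A b" by blast
  have "(\<Sum>k<D. ?y (j * D + k) * ?X ^ k) = t j" for j
    unfolding t_def by (intro sum.cong) auto
  with g have "t \<in> gen I M m n A b" by simp
  then show ?thesis using ty by (rule gen_congruent)
qed

text \<open>Outside \<open>J\<close> the solution \<open>V j\<close> has only the entry
  \<open>\<Delta>\<close> at \<open>j\<close>, so subtracting multiples of these solutions brings
  the entries of \<open>y\<close> outside \<open>J\<close> below degree \<open>\<delta>\<close> in
  the variable \<open>v\<close>. The entries in \<open>J\<close> then come for free:
  \<open>\<Delta> * y1 l\<close> is congruent to a combination of the \<open>V j l\<close> of degree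
  less than \<open>\<delta> + D\<close>, and \<open>\<Delta>\<close> has degree
  \<open>\<delta>\<close> with leading coefficient \<open>e\<close>.\<close>

lemma gen_monic:
  fixes A :: "nat \<Rightarrow> nat \<Rightarrow> 'p mpol"
  assumes cd: "cramer_data I m n A (Suc v) D \<delta> J \<Delta> V"
    and e: "coef \<Delta> (replicate_mset \<delta> v) \<notin> M"
    and A: "\<And>i j. i < m \<Longrightarrow> j < n \<Longrightarrow> deg_le d (A i j)"
    and y: "y \<in> syz I m n A" "\<And>j. j < n \<Longrightarrow> vars_below (Suc v) (y j)"
    and IH: "\<And>y'. y' \<in> syz I (m * (D + d)) (n * D) (expanded_matrix v D (D + d) A) \<Longrightarrow>
      (\<And>q. q < n * D \<Longrightarrow> vars_below v (y' q)) \<Longrightarrow>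
      y' \<in> gen I M (m * (D + d)) (n * D) (expanded_matrix v D (D + d) A) b'"
    and b: "D + b' \<le> b"
  shows "y \<in> gen I M m n A b"
proof -
  define e where "e = coef \<Delta> (replicate_mset \<delta> v)"
  let ?C = "{..<n} - J"
  have \<Delta>: "homogeneous (int \<delta>) \<Delta>" "vars_below (Suc v) \<Delta>" and \<delta>: "\<delta> \<le> D"
    and V: "\<And>j. j \<in> ?C \<Longrightarrow> V j \<in> syz I m n A" "\<And>j. j \<in> ?C \<Longrightarrow> V j j = \<Delta>"
      "\<And>j l. j \<in> ?C \<Longrightarrow> l \<in> ?C \<Longrightarrow> l \<noteq> j \<Longrightarrow> V j l = 0"
      "\<And>j l. j \<in> ?C \<Longrightarrow> l < n \<Longrightarrow> deg_le D (V j l)"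
      "\<And>j l. j \<in> ?C \<Longrightarrow> l < n \<Longrightarrow> vars_below (Suc v) (V j l)"
    and cram: "\<And>y l. y \<in> syz I m n A \<Longrightarrow> l < n \<Longrightarrow> \<Delta> * y l - (\<Sum>j\<in>?C. y j * V j l) \<in> coefs_in I"
    using cd unfolding cramer_data_def by auto
  have \<Delta>high: "xcoef v k \<Delta> = 0" if "k > \<delta>" for k
    by (rule xcoef_deg_le[OF homogeneous_deg_le[OF \<Delta>(1)] that])
  have "\<exists>q K. vars_below (Suc v) q \<and> (\<forall>k\<ge>\<delta>. xcoef v k (mon 0 (e ^ K) * y j - q * \<Delta>) = 0)" if "j \<in> ?C" for j
    using pseudo_division[OF \<Delta> y(2) e_def] that by blast
  then obtain q K where qK: "\<And>j. j \<in> ?C \<Longrightarrow> vars_below (Suc v) (q j)"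
    "\<And>j k. j \<in> ?C \<Longrightarrow> k \<ge> \<delta> \<Longrightarrow> xcoef v k (mon 0 (e ^ K j) * y j - q j * \<Delta>) = 0"
    by metis
  \<comment> \<open>One power of \<open>e\<close> has to serve all columns; the quotient of column
    \<open>j\<close> is multiplied by the missing power \<open>e ^ (N - K j)\<close>.\<close>
  define N where "N = (\<Sum>j\<in>?C. K j)"
  have KN: "K j \<le> N" if "j \<in> ?C" for j
    unfolding N_def using that by (intro member_le_sum) auto
  define s where "s = e ^ N"
  define Q where "Q = (\<lambda>j. mon 0 (e ^ (N - K j)) * q j)"
  define y1 where "y1 = (\<lambda>l. mon 0 s * y l - (\<Sum>j\<in>?C. Q j * V j l))"
  have sM: "s \<notin> M" unfolding s_def using assms(2) by (simp add: M.power_notin e_def)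
  have y1syz: "y1 \<in> syz I m n A"
    unfolding y1_def by (intro I.syz_diff I.syz_smult I.syz_lincomb y V)
  have low: "xcoef v k (y1 j) = 0" if j: "j \<in> ?C" and k: "k \<ge> \<delta>" for j k
  proof -
    have "(\<Sum>l\<in>?C. Q l * V l j) = (\<Sum>l\<in>?C. if l = j then Q l * \<Delta> else 0)"
      using j by (intro sum.cong) (auto simp: V)
    also have "\<dots> = Q j * \<Delta>" using j by (simp add: sum.delta)
    finally have "y1 j = mon 0 s * y j - Q j * \<Delta>" by (simp add: y1_def)
    also have "\<dots> = mon 0 (e ^ (N - K j)) * (mon 0 (e ^ K j) * y j - q j * \<Delta>)"
      using KN[OF j] by (simp add: s_def Q_def algebra_simps flip: mon_0_mult power_add)
    finally show ?thesis using qK(2)[OF j k] by (simp add: xcoef_free_times vars_below_mon)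
  qed
  have y1vars: "vars_below (Suc v) (y1 l)" if "l < n" for l
    unfolding y1_def Q_def using that
    by (intro vars_below_diff vars_below_times vars_below_sum vars_below_mon y V qK) auto
  have high: "xcoef v k (y1 l) \<in> coefs_in I" if l: "l < n" and k: "k \<ge> D" for l k
  proof (cases "l \<in> J")
    case False
    then show ?thesis using low[of l k] k \<delta> l by simp
  next
    case True
    obtain B where B: "\<And>k. k \<ge> B \<Longrightarrow> xcoef v k (y1 l) = 0" using xcoef_bounded by blast
    show ?thesis using k
    proof (induction "B - k" arbitrary: k rule: less_induct)
      case (less k)
      have IHk: "xcoef v i (y1 l) \<in> coefs_in I" if "i > k" for i
      proof (cases "i \<ge> B")
        case True
        then show ?thesis using B by simp
      next
        case False
        with that less show ?thesis by (intro less.hyps) auto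
      qed
      \<comment> \<open>Descending induction on \<open>k\<close>. In the coefficient of index
        \<open>k + \<delta>\<close>, the summands with \<open>i < \<delta>\<close> contain higher
        coefficients of \<open>y1 l\<close>, already known to lie in \<open>I\<close>, and those
        with \<open>i > \<delta>\<close> vanish. What remains is \<open>e\<close> times the wanted
        coefficient.\<close>
      have eq: "xcoef v (k + \<delta>) (\<Delta> * y1 l)
          = (\<Sum>i\<in>{..k + \<delta>} - {\<delta>}. xcoef v i \<Delta> * xcoef v (k + \<delta> - i) (y1 l)) + mon 0 e * xcoef v k (y1 l)"
        unfolding xcoef_times using xcoef_lead[OF \<Delta>(1), of v]
        by (subst sum.remove[of _ \<delta>]) (auto simp: e_def)
      have rest: "(\<Sum>i\<in>{..k + \<delta>} - {\<delta>}. xcoef v i \<Delta> * xcoef v (k + \<delta> - i) (y1 l)) \<in> coefs_in I"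
      proof (rule IX.sum)
        fix i assume i: "i \<in> {..k + \<delta>} - {\<delta>}"
        show "xcoef v i \<Delta> * xcoef v (k + \<delta> - i) (y1 l) \<in> coefs_in I"
        proof (cases "i < \<delta>")
          case True
          then show ?thesis by (intro IX.mult IHk) auto
        next
          case False
          with i have "i > \<delta>" by auto
          then show ?thesis by (simp add: \<Delta>high)
        qed
      qed
      have "xcoef v (k + \<delta>) (\<Delta> * y1 l) \<in> coefs_in I"
      proof -
        \<comment> \<open>The factor \<open>y1 j\<close> has degree below \<open>\<delta>\<close>
          and \<open>V j l\<close> has degree at most \<open>D \<le> k\<close>, so the power
          \<open>k + \<delta>\<close> is out of reach.\<close>
        have "xcoef v (k + \<delta>) (y1 j * V j l) = 0" if j: "j \<in> ?C" for j
          unfolding xcoef_times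
        proof (intro sum.neutral ballI)
          fix i assume "i \<in> {..k + \<delta>}"
          show "xcoef v i (y1 j) * xcoef v (k + \<delta> - i) (V j l) = 0"
          proof (cases "i \<ge> \<delta>")
            case True
            then show ?thesis using low[OF j] by simp
          next
            case False
            then show ?thesis using xcoef_deg_le[OF V(4)[OF j l], of "k + \<delta> - i"] less.prems by simp
          qed
        qed
        then have "xcoef v (k + \<delta>) (\<Delta> * y1 l - (\<Sum>j\<in>?C. y1 j * V j l)) = xcoef v (k + \<delta>) (\<Delta> * y1 l)"
          by (simp add: xcoef_diff xcoef_sum)
        moreover have "xcoef v (k + \<delta>) (\<Delta> * y1 l - (\<Sum>j\<in>?C. y1 j * V j l)) \<in> coefs_in I"
          by (intro coefs_in_xcoef cram[OF y1syz l]) simp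
        ultimately show ?thesis by simp
      qed
      from IX.diff[OF this rest] have "mon 0 e * xcoef v k (y1 l) \<in> coefs_in I"
        unfolding eq by simp
      moreover have "mon 0 e \<notin> (coefs_in I :: 'p mpol set)"
        using assms(2) I_le_M by (intro mon_0_notin) (auto simp: e_def)
      ultimately show ?case using IX.prime by blast
    qed
  qed
  have y1gen: "y1 \<in> gen I M m n A b"
  proof (rule gen_of_truncation[OF A y1syz high IH b])
    show "vars_below v (xcoef v (q mod D) (y1 (q div D)))" if "q < n * D" for q
      using that by (intro vars_below_xcoef y1vars) (simp add: less_mult_imp_div_less)
  qed auto
  have "(\<lambda>l. \<Sum>j\<in>?C. Q j * V j l) \<in> gen I M m n A b"
  proof (intro gen_sum gen_smult gen_syz V deg_le_mono[OF V(4)])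
    show "D \<le> b" using b by simp
  qed auto
  from gen_add[OF y1gen this] have "(\<lambda>l. mon 0 s * y l) \<in> gen I M m n A b"
    by (simp add: y1_def)
  then show ?thesis by (rule gen_div[OF sM])
qed

end

section \<open>Minors of minimal content\<close>

text \<open>Rows and columns are selected by arbitrary functions. Repetitions merely give
  determinant 0, so a row can be replaced or a column appended without checking that it is
  new.\<close>

definition minor :: "(nat \<Rightarrow> nat \<Rightarrow> 'r::comm_ring_1) \<Rightarrow> nat \<Rightarrow> (nat \<Rightarrow> nat) \<Rightarrow> (nat \<Rightarrow> nat) \<Rightarrow> 'r"
  where "minor A r f g = det (mat r r (\<lambda>(a, b). A (f a) (g b)))"

lemma minor_0 [simp]: "minor A 0 f g = 1"
  by (simp add: minor_def)

lemma minor_cong: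
  "(\<And>a. a < r \<Longrightarrow> f a = f' a) \<Longrightarrow> (\<And>a. a < r \<Longrightarrow> g a = g' a) \<Longrightarrow> minor A r f g = minor A r f' g'"
  unfolding minor_def by (intro arg_cong[of _ _ det] eq_matI) auto

lemma minor_rows_inj:
  assumes "minor A r f g \<noteq> 0"
  shows "inj_on f {..<r}"
proof (rule inj_onI, rule ccontr)
  fix a b assume *: "a \<in> {..<r}" "b \<in> {..<r}" "f a = f b" "a \<noteq> b"
  have "minor A r f g = 0" unfolding minor_def
    by (rule det_identical_rows[of _ r a b]) (use * in \<open>auto intro!: eq_vecI\<close>)
  with assms show False by simp
qed

lemma minor_cols_inj:
  assumes "minor A r f g \<noteq> 0"
  shows "inj_on g {..<r}"
proof (rule inj_onI, rule ccontr)
  fix a b assume *: "a \<in> {..<r}" "b \<in> {..<r}" "g a = g b" "a \<noteq> b"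
  have "minor A r f g = 0" unfolding minor_def
    by (rule det_identical_columns[of _ r a b]) (use * in \<open>auto intro!: eq_vecI\<close>)
  with assms show False by simp
qed

text \<open>The increasing enumeration of the natural numbers other than \<open>a\<close>; it
  describes deletion of column \<open>a\<close>.\<close>

definition skip :: "nat \<Rightarrow> nat \<Rightarrow> nat"
  where "skip a b = (if b < a then b else Suc b)"

text \<open>The cofactors on the right do not depend on the last row. This is what makes them a solution of all
  equations as soon as the minors of order \<open>Suc r\<close> vanish.\<close>

lemma minor_expand_last:
  "minor A (Suc r) f g = (\<Sum>a\<le>r. A (f r) (g a) * ((-1) ^ (r + a) * minor A r f (g \<circ> skip a)))"
proof -
  let ?B = "mat (Suc r) (Suc r) (\<lambda>(a, b). A (f a) (g b))"
  have "minor A (Suc r) f g = (\<Sum>a<Suc r. ?B $$ (r, a) * cofactor ?B r a)"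
    unfolding minor_def by (rule laplace_expansion_row) auto
  also have "\<dots> = (\<Sum>a<Suc r. A (f r) (g a) * ((-1) ^ (r + a) * minor A r f (g \<circ> skip a)))"
  proof (intro sum.cong refl)
    fix a assume a: "a \<in> {..<Suc r}"
    have "mat_delete ?B r a = mat r r (\<lambda>(c, b). A (f c) ((g \<circ> skip a) b))"
      unfolding mat_delete_def by (rule eq_matI) (use a in \<open>auto simp: skip_def\<close>)
    then show "?B $$ (r, a) * cofactor ?B r a = A (f r) (g a) * ((-1) ^ (r + a) * minor A r f (g \<circ> skip a))"
      using a by (simp add: cofactor_def minor_def)
  qed
  finally show ?thesis by (simp add: lessThan_Suc_atMost)
qed

text \<open>\<open>c\<close> is the adjugate matrix. It recovers a vector, up to the factor given by
  the minor, from its values under the selected equations.\<close>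

lemma minor_adjugate:
  "\<exists>c. \<forall>a<r. \<forall>x. (\<Sum>e<r. c a e * (\<Sum>b<r. A (f e) (g b) * x b)) = minor A r f g * x a"
proof -
  let ?B = "mat r r (\<lambda>(a, b). A (f a) (g b))"
  have B: "?B \<in> carrier_mat r r" by simp
  show ?thesis
  proof (rule exI[of _ "\<lambda>a e. adj_mat ?B $$ (a, e)"], intro allI impI)
    fix a x assume a: "a < r"
    have eq: "(\<Sum>e<r. adj_mat ?B $$ (a, e) * ?B $$ (e, b)) = (if a = b then minor A r f g else 0)"
      if b: "b < r" for b
    proof -
      have "(adj_mat ?B * ?B) $$ (a, b) = (\<Sum>e<r. adj_mat ?B $$ (a, e) * ?B $$ (e, b))"
        using a b adj_mat(1)[OF B] by (simp add: scalar_prod_def lessThan_atLeast0)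
      then show ?thesis using a b adj_mat(3)[OF B] by (cases "a = b") (auto simp: minor_def)
    qed
    have "(\<Sum>e<r. adj_mat ?B $$ (a, e) * (\<Sum>b<r. A (f e) (g b) * x b))
        = (\<Sum>e<r. \<Sum>b<r. adj_mat ?B $$ (a, e) * ?B $$ (e, b) * x b)"
      by (simp add: sum_distrib_left mult.assoc)
    also have "\<dots> = (\<Sum>b<r. (\<Sum>e<r. adj_mat ?B $$ (a, e) * ?B $$ (e, b)) * x b)"
      unfolding sum_distrib_right by (rule sum.swap)
    also have "\<dots> = (\<Sum>b<r. if b = a then minor A r f g * x b else 0)"
      by (intro sum.cong refl) (auto simp: eq simp del: index_mat)
    also have "\<dots> = minor A r f g * x a" using a by simp
    finally show "(\<Sum>e<r. adj_mat ?B $$ (a, e) * (\<Sum>b<r. A (f e) (g b) * x b)) = minor A r f g * x a" .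
  qed
qed

lemma minor_Leibniz:
  "minor A r f g = (\<Sum>p\<in>{p. p permutes {0..<r}}. signof p * (\<Prod>a\<in>{0..<r}. A (f a) (g (p a))))"
proof -
  have "minor A r f g = (\<Sum>p\<in>{p. p permutes {0..<r}}. signof p *
      (\<Prod>a\<in>{0..<r}. mat r r (\<lambda>(a, b). A (f a) (g b)) $$ (a, p a)))"
    unfolding minor_def by (rule det_def') auto
  also have "\<dots> = (\<Sum>p\<in>{p. p permutes {0..<r}}. signof p * (\<Prod>a\<in>{0..<r}. A (f a) (g (p a))))"
  proof (intro sum.cong refl arg_cong2[of _ _ _ _ "(*)"] prod.cong)
    fix p a assume "p \<in> {p. p permutes {0..<r}}" "a \<in> {0..<r}"
    then have "p a < r" using permutes_in_image by fastforce
    with \<open>a \<in> {0..<r}\<close> show "mat r r (\<lambda>(a, b). A (f a) (g b)) $$ (a, p a) = A (f a) (g (p a))" by simp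
  qed
  finally show ?thesis .
qed

text \<open>A permutation only rearranges the weights \<open>w (g a)\<close>, so all terms of the
  Leibniz formula have the same total weight. Hence a minor is homogeneous even though the entries
  of the matrix have different degrees.\<close>

lemma minor_preserves:
  fixes A :: "nat \<Rightarrow> nat \<Rightarrow> 'p::comm_ring_1 mpol"
  assumes A: "\<And>i j. i < m \<Longrightarrow> j < n \<Longrightarrow> homogeneous (w j - u i) (A i j)"
      "\<And>i j. i < m \<Longrightarrow> j < n \<Longrightarrow> deg_le d (A i j)"
      "\<And>i j. i < m \<Longrightarrow> j < n \<Longrightarrow> vars_below v (A i j)"
    and f: "\<And>a. a < r \<Longrightarrow> f a < m" and g: "\<And>a. a < r \<Longrightarrow> g a < n"
  shows "homogeneous ((\<Sum>a<r. w (g a)) - (\<Sum>a<r. u (f a))) (minor A r f g)"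
    and "deg_le (r * d) (minor A r f g)"
    and "vars_below v (minor A r f g)"
proof -
  have sgn: "P (signof p * h)" if "P h" "P (- h)" for P and p and h :: "'p mpol"
    using that by (cases p rule: sign_cases) auto
  have perm: "p a < r" if "p permutes {0..<r}" "a \<in> {0..<r}" for p a
    using permutes_in_image[OF that(1), of a] that(2) by simp
  show "homogeneous ((\<Sum>a<r. w (g a)) - (\<Sum>a<r. u (f a))) (minor A r f g)"
    unfolding minor_Leibniz
  proof (intro homogeneous_sum)
    fix p assume "p \<in> {p. p permutes {0..<r}}"
    then have p: "p permutes {0..<r}" by simp
    have 1: "homogeneous (\<Sum>a\<in>{0..<r}. w (g (p a)) - u (f a)) (\<Prod>a\<in>{0..<r}. A (f a) (g (p a)))"
      using perm[OF p] by (intro homogeneous_prod A f g) auto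
    have 2: "(\<Sum>a\<in>{0..<r}. w (g (p a))) = (\<Sum>a\<in>{0..<r}. w (g a))"
      using sum.permute[OF p, of "\<lambda>a. w (g a)"] by (simp add: o_def)
    have "homogeneous ((\<Sum>a<r. w (g a)) - (\<Sum>a<r. u (f a))) (\<Prod>a\<in>{0..<r}. A (f a) (g (p a)))"
      using 1 unfolding sum_subtractf 2 unfolding lessThan_atLeast0 .
    then show "homogeneous ((\<Sum>a<r. w (g a)) - (\<Sum>a<r. u (f a)))
        (signof p * (\<Prod>a\<in>{0..<r}. A (f a) (g (p a))))"
      by (intro sgn[where P = "homogeneous _"]) simp_all
  qed
  show "deg_le (r * d) (minor A r f g)" unfolding minor_Leibniz
  proof (intro deg_le_sum)
    fix p assume "p \<in> {p. p permutes {0..<r}}"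
    then have p: "p permutes {0..<r}" by simp
    have "deg_le (\<Sum>a\<in>{0..<r}. d) (\<Prod>a\<in>{0..<r}. A (f a) (g (p a)))"
      using perm[OF p] by (intro deg_le_prod A f g) auto
    then have "deg_le (r * d) (\<Prod>a\<in>{0..<r}. A (f a) (g (p a)))" by simp
    then show "deg_le (r * d) (signof p * (\<Prod>a\<in>{0..<r}. A (f a) (g (p a))))"
      by (intro sgn[where P = "deg_le _"]) simp_all
  qed
  show "vars_below v (minor A r f g)" unfolding minor_Leibniz
  proof (intro vars_below_sum)
    fix p assume "p \<in> {p. p permutes {0..<r}}"
    then have p: "p permutes {0..<r}" by simp
    have "vars_below v (\<Prod>a\<in>{0..<r}. A (f a) (g (p a)))"
      using perm[OF p] by (intro vars_below_prod A f g) auto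
    then show "vars_below v (signof p * (\<Prod>a\<in>{0..<r}. A (f a) (g (p a))))"
      by (intro sgn[where P = "vars_below _"]) simp_all
  qed
qed

section \<open>Cramer solutions with a primitive pivot\<close>

locale chain_pair = local_pair I M for I M :: "'p::comm_ring_1 set" +
  assumes chain: "\<exists>s c. s \<notin> M \<and> (s * a - c * b \<in> I \<or> s * b - c * a \<in> I)"

text \<open>The residue field enters only through its consequence that a polynomial in one variable
  which is nonzero modulo \<open>M\<close> has a value that is nonzero modulo
  \<open>M\<close>.\<close>

locale valuation_pair = chain_pair I M for I M :: "'p::comm_ring_1 set" +
  assumes infinite_residue: "k \<le> d \<Longrightarrow> x k \<notin> M \<Longrightarrow> \<exists>t. (\<Sum>i\<le>d. x i * t ^ i) \<notin> M"

text \<open>A minimum for divisibility, with one factor \<open>s\<close> common to all quotients. A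
  new element is compared with the previous minimum only, and transitivity does the rest.\<close>

lemma (in chain_pair) chain_finite:
  assumes "finite F" "F \<noteq> {}"
  shows "\<exists>b\<in>F. \<exists>s. s \<notin> M \<and> (\<forall>a\<in>F. \<exists>c. s * a - c * b \<in> I)"
  using assms
proof (induction F rule: finite_ne_induct)
  case (singleton a)
  have "1 * a - 1 * a \<in> I" by simp
  with M.one show ?case by blast
next
  case (insert x F)
  then obtain b s where b: "b \<in> F" "s \<notin> M" "\<And>a. a \<in> F \<Longrightarrow> \<exists>c. s * a - c * b \<in> I" by blast
  obtain s' c' where s': "s' \<notin> M" "s' * x - c' * b \<in> I \<or> s' * b - c' * x \<in> I" using chain by blast
  have ss: "s * s' \<notin> M" using b(2) s'(1) M.prime by blast
  from s'(2) show ?case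
  proof
    assume x: "s' * x - c' * b \<in> I"
    have "\<exists>c. s * s' * a - c * b \<in> I" if a: "a \<in> insert x F" for a
    proof (cases "a = x")
      case True
      have "s * s' * x - (s * c') * b = s * (s' * x - c' * b)" by (simp add: algebra_simps)
      then show ?thesis using I.mult[OF x, of s] True by metis
    next
      case False
      with a b(3) obtain c where c: "s * a - c * b \<in> I" by blast
      have "s * s' * a - (s' * c) * b = s' * (s * a - c * b)" by (simp add: algebra_simps)
      then show ?thesis using I.mult[OF c, of s'] by metis
    qed
    with b(1) ss show ?thesis by blast
  next
    assume x: "s' * b - c' * x \<in> I"
    have "\<exists>c. s * s' * a - c * x \<in> I" if a: "a \<in> insert x F" for a
    proof (cases "a = x")
      case True
      have "s * s' * x - (s * s') * x \<in> I" by simp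
      with True show ?thesis by blast
    next
      case False
      with a b(3) obtain c where c: "s * a - c * b \<in> I" by blast
      have "s * s' * a - (c * c') * x = s' * (s * a - c * b) + c * (s' * b - c' * x)"
        by (simp add: algebra_simps)
      then show ?thesis using I.add[OF I.mult[OF c, of s'] I.mult[OF x, of c]] by metis
    qed
    with ss show ?thesis by blast
  qed
qed

text \<open>\<open>r\<close> is the rank modulo \<open>I\<close>. The empty minor 1 shows that the
  maximum exists, and \<open>r \<le> m\<close> because a nonzero minor has distinct rows.\<close>

lemma (in valuation_pair) rank_exists:
  obtains r f g where "r \<le> m" "\<And>a. a < r \<Longrightarrow> f a < m" "\<And>a. a < r \<Longrightarrow> g a < n"
    "minor A r f g \<notin> (coefs_in I :: 'p mpol set)"
    "\<And>f g. (\<And>a. a \<le> r \<Longrightarrow> f a < m) \<Longrightarrow> (\<And>a. a \<le> r \<Longrightarrow> g a < n) \<Longrightarrow> minor A (Suc r) f g \<in> coefs_in I"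
proof -
  define P where "P r \<longleftrightarrow> (\<exists>f g. (\<forall>a<r. f a < m) \<and> (\<forall>a<r. g a < n) \<and> minor A r f g \<notin> coefs_in I)" for r
  have P0: "P 0" using IX.one by (auto simp: P_def)
  have Pm: "r \<le> m" if "P r" for r
  proof -
    from that obtain f g where fg: "\<forall>a<r. f a < m" "minor A r f g \<notin> coefs_in I" by (auto simp: P_def)
    then have "minor A r f g \<noteq> 0" using IX.zero by metis
    then have "inj_on f {..<r}" by (rule minor_rows_inj)
    then have "card {..<r} \<le> card {..<m}" by (rule card_inj_on_le) (use fg in auto)
    then show ?thesis by simp
  qed
  define r where "r = (GREATEST r. P r)"
  have Pr: "P r" unfolding r_def using P0 Pm by (rule GreatestI_nat)
  have "\<not> P (Suc r)"
  proof
    assume "P (Suc r)"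
    then have "Suc r \<le> r" unfolding r_def using Pm by (intro Greatest_le_nat)
    then show False by simp
  qed
  then have max: "minor A (Suc r) f g \<in> coefs_in I"
    if "\<And>a. a \<le> r \<Longrightarrow> f a < m" "\<And>a. a \<le> r \<Longrightarrow> g a < n" for f g
    using that unfolding P_def by (auto simp: less_Suc_eq_le)
  from Pr obtain f g where "\<forall>a<r. f a < m" "\<forall>a<r. g a < n" "minor A r f g \<notin> coefs_in I"
    unfolding P_def by blast
  with that[of r f g] Pm[OF Pr] max show ?thesis by blast
qed

lemma sum_at_injective:
  assumes "inj_on g S" "finite S" "g ` S \<subseteq> T" "finite T"
  shows "(\<Sum>l\<in>T. h l * (\<Sum>a\<in>S. if g a = l then x a else 0)) = (\<Sum>a\<in>S. h (g a) * (x a :: 'r::comm_ring_1))"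
proof -
  have "(\<Sum>l\<in>T. h l * (\<Sum>a\<in>S. if g a = l then x a else 0)) = (\<Sum>l\<in>T. \<Sum>a\<in>S. if g a = l then h l * x a else 0)"
    unfolding sum_distrib_left by (intro sum.cong refl) auto
  also have "\<dots> = (\<Sum>a\<in>S. \<Sum>l\<in>T. if g a = l then h l * x a else 0)" by (rule sum.swap)
  also have "\<dots> = (\<Sum>a\<in>S. h (g a) * x a)"
    by (intro sum.cong refl) (use assms in \<open>auto simp: sum.delta'\<close>)
  finally show ?thesis .
qed

context valuation_pair
begin

text \<open>Cramer's rule with the minors of order \<open>r\<close> replaced by their quotients by
  the common content \<open>b\<close>. Congruences for the quotients follow from those for the
  minors, since \<open>b\<close> is not in the prime ideal \<open>I\<close> and can be
  cancelled.\<close>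

lemma cramer_exists:
  fixes A :: "nat \<Rightarrow> nat \<Rightarrow> 'p mpol"
  assumes A: "\<And>i j. i < m \<Longrightarrow> j < n \<Longrightarrow> homogeneous (w j - u i) (A i j)"
      "\<And>i j. i < m \<Longrightarrow> j < n \<Longrightarrow> deg_le d (A i j)"
      "\<And>i j. i < m \<Longrightarrow> j < n \<Longrightarrow> vars_below v (A i j)"
  shows "\<exists>\<delta> J \<Delta> V k. cramer_data I m n A v (m * d) \<delta> J \<Delta> V \<and> coef \<Delta> k \<notin> M"
proof -
  obtain r f g where r: "r \<le> m" and f: "\<And>a. a < r \<Longrightarrow> f a < m" and g: "\<And>a. a < r \<Longrightarrow> g a < n"
    and nz: "minor A r f g \<notin> coefs_in I"
    and max: "\<And>f g. (\<And>a. a \<le> r \<Longrightarrow> f a < m) \<Longrightarrow> (\<And>a. a \<le> r \<Longrightarrow> g a < n) \<Longrightarrow>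
      minor A (Suc r) f g \<in> coefs_in I"
    using rank_exists[of m n A] by blast
  let ?S = "(\<lambda>(f, g). minor A r f g) ` (({..<r} \<rightarrow>\<^sub>E {..<m}) \<times> ({..<r} \<rightarrow>\<^sub>E {..<n}))"
  have S: "minor A r f g \<in> ?S" if "\<And>a. a < r \<Longrightarrow> f a < m" "\<And>a. a < r \<Longrightarrow> g a < n" for f g
  proof -
    have eq: "minor A r f g = minor A r (restrict f {..<r}) (restrict g {..<r})" by (rule minor_cong) auto
    have "(restrict f {..<r}, restrict g {..<r}) \<in> ({..<r} \<rightarrow>\<^sub>E {..<m}) \<times> ({..<r} \<rightarrow>\<^sub>E {..<n})"
      using that by (auto simp: PiE_iff)
    then show ?thesis unfolding eq by (rule rev_image_eqI) simp
  qed
  have Sp: "homogeneous ((\<Sum>a<r. w (g a)) - (\<Sum>a<r. u (f a))) (minor A r f g)"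
      "deg_le (m * d) (minor A r f g)" "vars_below v (minor A r f g)"
    if "\<And>a. a < r \<Longrightarrow> f a < m" "\<And>a. a < r \<Longrightarrow> g a < n" for f g
  proof -
    show "homogeneous ((\<Sum>a<r. w (g a)) - (\<Sum>a<r. u (f a))) (minor A r f g)" "vars_below v (minor A r f g)"
      by (rule minor_preserves[OF A that]; assumption)+
    have "deg_le (r * d) (minor A r f g)" by (rule minor_preserves[OF A that])
    then show "deg_le (m * d) (minor A r f g)" by (rule deg_le_mono) (use r in auto)
  qed
  \<comment> \<open>All nonzero coefficients of all minors of order \<open>r\<close>; a minimum of
    this set for divisibility is the common content.\<close>
  define F where "F = (\<Union>p\<in>?S. coef p ` Poly_Mapping.keys p)"
  have F: "coef p k \<in> F" if "p \<in> ?S" "coef p k \<noteq> 0" for p k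
    unfolding F_def by (rule UN_I[OF that(1)]) (use that(2) in \<open>simp add: in_keys_iff\<close>)
  obtain k1 where k1: "coef (minor A r f g) k1 \<notin> I" using nz by (auto simp: coefs_in_def)
  then have "coef (minor A r f g) k1 \<noteq> 0" using I.zero by metis
  then have k1F: "coef (minor A r f g) k1 \<in> F" by (intro F S f g)
  have "finite F" unfolding F_def by (intro finite_UN_I finite_imageI finite_cartesian_product finite_PiE) auto
  then obtain b s where bF: "b \<in> F" and s: "s \<notin> M" and bs: "\<And>a. a \<in> F \<Longrightarrow> \<exists>c. s * a - c * b \<in> I"
    using chain_finite[of F] k1F by blast
  have sI: "s \<notin> I" using s I_le_M by blast
  have bI: "b \<notin> I"
  proof
    assume b: "b \<in> I"
    obtain c where "s * coef (minor A r f g) k1 - c * b \<in> I" using bs[OF k1F] by blast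
    from I.add[OF this I.mult[OF b, of c]] have "s * coef (minor A r f g) k1 \<in> I" by simp
    from I.prime[OF this] sI k1 show False by simp
  qed
  obtain f0 g0 k0 where f0: "\<And>a. a < r \<Longrightarrow> f0 a < m" and g0: "\<And>a. a < r \<Longrightarrow> g0 a < n"
    and b: "b = coef (minor A r f0 g0) k0"
  proof -
    from bF obtain p where p: "p \<in> ?S" "b \<in> coef p ` Poly_Mapping.keys p" unfolding F_def by (elim UN_E)
    from p(1) obtain h where h: "p = (case h of (f, g) \<Rightarrow> minor A r f g)"
      "h \<in> ({..<r} \<rightarrow>\<^sub>E {..<m}) \<times> ({..<r} \<rightarrow>\<^sub>E {..<n})" by (elim imageE)
    from p(2) obtain k0 where "b = coef p k0" by (elim imageE)
    with h that[of "fst h" "snd h" k0] show ?thesis by (simp add: case_prod_beta mem_Times_iff PiE_iff)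
  qed
  \<comment> \<open>\<open>\<gamma> a\<close> represents \<open>s * a / b\<close>. The value 0 at 0
    keeps \<open>\<rho>\<close> from creating monomials, so degree, homogeneity and variables of the
    minors survive.\<close>
  have "\<exists>c. (a = 0 \<longrightarrow> c = 0) \<and> (a \<in> F \<or> a = 0 \<longrightarrow> s * a - c * b \<in> I)" for a
    using bs[of a] by (cases "a = 0") auto
  then obtain \<gamma> where \<gamma>_all: "\<And>a. (a = 0 \<longrightarrow> \<gamma> a = 0) \<and> (a \<in> F \<or> a = 0 \<longrightarrow> s * a - \<gamma> a * b \<in> I)"
    by metis
  have \<gamma>0: "\<gamma> 0 = 0" using \<gamma>_all[of 0] by simp
  have \<gamma>: "s * a - \<gamma> a * b \<in> I" if "a \<in> F \<or> a = 0" for a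
    using \<gamma>_all[of a] that by blast
  define \<rho> :: "'p mpol \<Rightarrow> 'p mpol" where "\<rho> = map_coefs \<gamma>"
  have \<rho>: "mon 0 s * p - mon 0 b * \<rho> p \<in> coefs_in I" if "p \<in> ?S" for p
    using \<gamma> F[OF that] by (auto simp: coefs_in_def \<rho>_def coef_map_coefs \<gamma>0 lookup_minus mult.commute[of b])
  define p0 where "p0 = minor A r f0 g0"
  define \<Delta> where "\<Delta> = \<rho> p0"
  have bI': "mon 0 b \<notin> (coefs_in I :: 'p mpol set)" using bI by (rule mon_0_notin)
  have sI': "mon 0 s \<notin> (coefs_in I :: 'p mpol set)" using sI by (rule mon_0_notin)
  have p0I: "p0 \<notin> coefs_in I" using b bI by (auto simp: coefs_in_def p0_def)
  have p0\<Delta>: "mon 0 s * p0 - mon 0 b * \<Delta> \<in> coefs_in I"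
    unfolding \<Delta>_def p0_def by (intro \<rho> S f0 g0)
  \<comment> \<open>At the monomial where the minimal coefficient \<open>b\<close> occurs, the
    quotient is \<open>\<gamma> b\<close>. Cancelling \<open>b\<close> shows that it is congruent to
    \<open>s\<close>, hence outside \<open>M\<close>.\<close>
  have \<Delta>k0: "coef \<Delta> k0 \<notin> M"
  proof
    have "s * b - \<gamma> b * b \<in> I" using \<gamma>[of b] bF by simp
    then have "(s - \<gamma> b) * b \<in> I" by (simp only: left_diff_distrib)
    then have "s - \<gamma> b \<in> M" using I.prime[of "s - \<gamma> b" b] bI I_le_M by auto
    moreover assume "coef \<Delta> k0 \<in> M"
    then have "\<gamma> b \<in> M" by (simp add: \<Delta>_def \<rho>_def coef_map_coefs \<gamma>0 p0_def b)
    ultimately show False using s M.add_cancel[of s "\<gamma> b"] by simp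
  qed
  then have "coef \<Delta> k0 \<noteq> 0" using M.zero by metis
  define \<delta> where "\<delta> = size k0"
  have \<rho>p: "homogeneous e p \<Longrightarrow> homogeneous e (\<rho> p)" "deg_le (m * d) p \<Longrightarrow> deg_le (m * d) (\<rho> p)"
    "vars_below v p \<Longrightarrow> vars_below v (\<rho> p)" for e p
    unfolding \<rho>_def by (intro map_coefs_preserves \<gamma>0; assumption)+
  have h\<Delta>: "homogeneous ((\<Sum>a<r. w (g0 a)) - (\<Sum>a<r. u (f0 a))) \<Delta>"
    and d\<Delta>: "deg_le (m * d) \<Delta>" and v\<Delta>: "vars_below v \<Delta>"
    unfolding \<Delta>_def p0_def by (intro \<rho>p Sp f0 g0; assumption)+
  \<comment> \<open>The difference of weights is a degree that occurs, that of \<open>k0\<close>; in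
    particular it is not negative.\<close>
  have \<delta>: "(\<Sum>a<r. w (g0 a)) - (\<Sum>a<r. u (f0 a)) = int \<delta>"
    using h\<Delta> \<open>coef \<Delta> k0 \<noteq> 0\<close> by (simp add: homogeneous_def \<delta>_def)
  have \<delta>le: "\<delta> \<le> m * d" using d\<Delta> \<open>coef \<Delta> k0 \<noteq> 0\<close> by (simp add: deg_le_def \<delta>_def)
  have "p0 \<noteq> 0" using p0I IX.zero by metis
  then have inj: "inj_on g0 {..<r}" unfolding p0_def by (rule minor_cols_inj)
  define J where "J = g0 ` {..<r}"
  have J: "J \<subseteq> {..<n}" using g0 by (auto simp: J_def)
  let ?C = "{..<n} - J"
  \<comment> \<open>The free column \<open>j\<close> is placed last, behind the pivot columns.
    Deleting it leaves the pivot minor with sign \<open>(-1) ^ (r + r)\<close>, so the entry of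
    \<open>V j\<close> at \<open>j\<close> is \<open>\<Delta>\<close> itself.\<close>
  define G where "G = (\<lambda>j. g0(r := j))"
  define W where "W = (\<lambda>j a. (-1) ^ (r + a) * \<rho> (minor A r f0 (G j \<circ> skip a)))"
  define V where "V = (\<lambda>j l. \<Sum>a\<le>r. if G j a = l then W j a else 0)"
  have Gn: "G j a < n" if "j \<in> ?C" "a \<le> r" for j a
    using that g0 by (cases "a = r") (auto simp: G_def)
  have GS: "(G j \<circ> skip a) c < n" if "j \<in> ?C" "a \<le> r" "c < r" for j a c
    using that by (simp only: o_def, intro Gn) (auto simp: skip_def)
  have Ginj: "inj_on (G j) {..r}" if "j \<in> ?C" for j
    using that inj by (auto simp: inj_on_def G_def J_def)
  have Wr: "W j r = \<Delta>" for j
  proof -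
    have "minor A r f0 (G j \<circ> skip r) = p0"
      unfolding p0_def by (rule minor_cong) (auto simp: skip_def G_def)
    then show ?thesis by (simp add: W_def \<Delta>_def)
  qed
  have V1: "V j j = \<Delta>" if j: "j \<in> ?C" for j
  proof -
    have "V j j = (\<Sum>a\<le>r. if a = r then W j a else 0)"
      unfolding V_def by (intro sum.cong refl) (use j in \<open>auto simp: G_def J_def\<close>)
    then show ?thesis by (simp add: Wr)
  qed
  have V2: "V j l = 0" if "j \<in> ?C" "l \<in> ?C" "l \<noteq> j" for j l
    unfolding V_def by (intro sum.neutral) (use that in \<open>auto simp: G_def J_def\<close>)
  have sgnP: "P ((-1) ^ e * h)" if "P h" "P (- h)" for P and e and h :: "'p mpol"
    using that by (cases "even e") auto
  have V3: "deg_le (m * d) (V j l)" and V4: "vars_below v (V j l)" if "j \<in> ?C" for j l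
  proof -
    have "deg_le (m * d) (W j a)" "vars_below v (W j a)" if a: "a \<le> r" for a
    proof -
      have "deg_le (m * d) (\<rho> (minor A r f0 (G j \<circ> skip a)))" "vars_below v (\<rho> (minor A r f0 (G j \<circ> skip a)))"
        by (intro \<rho>p Sp f0 GS \<open>j \<in> ?C\<close> a; assumption)+
      then show "deg_le (m * d) (W j a)" "vars_below v (W j a)"
        unfolding W_def by (intro sgnP[where P = "deg_le _"] sgnP[where P = "vars_below _"]; simp)+
    qed
    then show "deg_le (m * d) (V j l)" "vars_below v (V j l)"
      unfolding V_def by (auto intro!: deg_le_sum vars_below_sum)
  qed
  have V5: "V j \<in> syz I m n A" if j: "j \<in> ?C" for j
    unfolding syz_def mem_Collect_eq
  proof (intro allI impI)
    fix i assume i: "i < m"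
    have eq: "(\<Sum>l<n. A i l * V j l) = (\<Sum>a\<le>r. A i (G j a) * W j a)"
      unfolding V_def by (rule sum_at_injective) (use Ginj[OF j] Gn[OF j] in auto)
    let ?t = "\<lambda>a. (-1) ^ (r + a) * A i (G j a)"
    \<comment> \<open>Appending the row \<open>i\<close> turns equation \<open>i\<close> into a
      minor of order \<open>Suc r\<close>. Since \<open>max\<close> does not require distinct rows,
      this covers the pivot rows too.\<close>
    have "minor A (Suc r) (f0(r := i)) (G j) \<in> coefs_in I"
      by (rule max) (use f0 i Gn[OF j] in auto)
    also have "minor A (Suc r) (f0(r := i)) (G j) = (\<Sum>a\<le>r. ?t a * minor A r f0 (G j \<circ> skip a))"
    proof -
      have "minor A r (f0(r := i)) h = minor A r f0 h" for h by (rule minor_cong) auto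
      then show ?thesis unfolding minor_expand_last by (simp add: ac_simps)
    qed
    finally have 1: "mon 0 s * (\<Sum>a\<le>r. ?t a * minor A r f0 (G j \<circ> skip a)) \<in> coefs_in I"
      by (rule IX.mult)
    have "(\<Sum>a\<le>r. ?t a * (mon 0 s * minor A r f0 (G j \<circ> skip a) - mon 0 b * \<rho> (minor A r f0 (G j \<circ> skip a)))) \<in> coefs_in I"
      by (intro IX.sum IX.mult \<rho> S f0 GS j) auto
    also have "(\<Sum>a\<le>r. ?t a * (mon 0 s * minor A r f0 (G j \<circ> skip a) - mon 0 b * \<rho> (minor A r f0 (G j \<circ> skip a))))
        = mon 0 s * (\<Sum>a\<le>r. ?t a * minor A r f0 (G j \<circ> skip a)) - mon 0 b * (\<Sum>a\<le>r. A i (G j a) * W j a)"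
      unfolding W_def sum_distrib_left sum_subtractf[symmetric] by (intro sum.cong refl) (simp add: algebra_simps)
    finally have "mon 0 b * (\<Sum>a\<le>r. A i (G j a) * W j a) \<in> coefs_in I"
      using IX.add_cancel 1 by simp
    from IX.prime[OF this] show "(\<Sum>l<n. A i l * V j l) \<in> coefs_in I"
      unfolding eq using bI' by simp
  qed
  have V6: "\<Delta> * y l - (\<Sum>j\<in>?C. y j * V j l) \<in> coefs_in I" if y: "y \<in> syz I m n A" and l: "l < n" for y l
  proof -
    \<comment> \<open>The defect \<open>x\<close> is a solution that vanishes outside
      \<open>J\<close>, so the pivot rows form a square system for it. The adjugate gives
      \<open>p0 * x l \<in> coefs_in I\<close>, and \<open>p0\<close> is cancelled.\<close>
    define x where "x = (\<lambda>l. \<Delta> * y l - (\<Sum>j\<in>?C. y j * V j l))"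
    have x: "x \<in> syz I m n A" unfolding x_def by (intro I.syz_diff I.syz_smult I.syz_lincomb y V5)
    have xC: "x l = 0" if l: "l \<in> ?C" for l
    proof -
      have "(\<Sum>j\<in>?C. y j * V j l) = (\<Sum>j\<in>?C. if j = l then y j * \<Delta> else 0)"
        by (intro sum.cong refl) (use l V1 V2 in auto)
      also have "\<dots> = y l * \<Delta>" using l by simp
      finally show ?thesis by (simp add: x_def mult.commute)
    qed
    have "x l \<in> coefs_in I"
    proof (cases "l \<in> J")
      case False
      with l xC show ?thesis by simp
    next
      case True
      then obtain a where a: "a < r" "l = g0 a" by (auto simp: J_def)
      obtain c where c: "\<And>x. (\<Sum>e<r. c a e * (\<Sum>b<r. A (f0 e) (g0 b) * x b)) = p0 * x a"
        using minor_adjugate[of r A f0 g0] a(1) unfolding p0_def by blast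
      have "(\<Sum>b<r. A (f0 e) (g0 b) * x (g0 b)) \<in> coefs_in I" if "e < r" for e
      proof -
        have "(\<Sum>b<r. A (f0 e) (g0 b) * x (g0 b)) = (\<Sum>l\<in>J. A (f0 e) l * x l)"
          unfolding J_def by (simp add: sum.reindex[OF inj])
        also have "\<dots> = (\<Sum>l<n. A (f0 e) l * x l)"
          by (rule sum.mono_neutral_left) (use J xC in auto)
        also have "\<dots> \<in> coefs_in I" using x f0[OF that] by (simp add: syz_def)
        finally show ?thesis .
      qed
      then have "(\<Sum>e<r. c a e * (\<Sum>b<r. A (f0 e) (g0 b) * x (g0 b))) \<in> coefs_in I"
        by (rule IX.sum[OF IX.mult]) simp
      then have "p0 * x l \<in> coefs_in I" using c[of "\<lambda>b. x (g0 b)"] a(2) by simp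
      from IX.prime[OF this] p0I show ?thesis by simp
    qed
    then show ?thesis by (simp add: x_def)
  qed
  have "cramer_data I m n A v (m * d) \<delta> J \<Delta> V"
    unfolding cramer_data_def using J \<delta>le h\<Delta> \<delta> v\<Delta> V1 V2 V3 V4 V5 V6 by auto
  with \<Delta>k0 show ?thesis by blast
qed

end

section \<open>Homogeneous systems\<close>

text \<open>Substitution is a ring homomorphism fixing constants, and polynomials of degree at most
  1 do not raise the degree. Both changes of coordinates and setting variables to 1 are
  instances.\<close>

lemma gen_psubst:
  assumes I: "prime_ideal_set I" and \<sigma>: "\<And>x. deg_le 1 (\<sigma> x)"
    and z: "z \<in> gen I M m n A b"
  shows "(\<lambda>j. psubst \<sigma> (z j)) \<in> gen I M m n (\<lambda>i j. psubst \<sigma> (A i j)) b"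
  using z
proof (induction rule: gen.induct)
  case (gen_syz z)
  then show ?case
    by (intro gen.gen_syz deg_le_psubst \<sigma>)
      (auto simp: syz_def psubst_sum[symmetric] psubst_times[symmetric] intro!: coefs_in_psubst[OF I])
next
  case (gen_null z)
  then show ?case by (intro gen.gen_null coefs_in_psubst[OF I])
next
  case (gen_add y z)
  then show ?case using gen.gen_add by (fastforce simp: psubst_add)
next
  case (gen_smult y c)
  then show ?case using gen.gen_smult by (fastforce simp: psubst_times)
next
  case (gen_div s y)
  show ?case by (rule gen.gen_div[OF gen_div.hyps(1)]) (use gen_div.IH in \<open>simp add: psubst_times\<close>)
qed

lemma syz_psubst:
  assumes "prime_ideal_set I" "z \<in> syz I m n A"
  shows "(\<lambda>j. psubst \<sigma> (z j)) \<in> syz I m n (\<lambda>i j. psubst \<sigma> (A i j))"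
  using assms(2)
  by (auto simp: syz_def psubst_sum[symmetric] psubst_times[symmetric] intro!: coefs_in_psubst[OF assms(1)])

text \<open>The summand \<open>m * d\<close> bounds the degree of the Cramer solutions and is also
  the number of coefficients kept per unknown. The argument \<open>d\<close> stays, as the new
  matrix entries are coefficients of old ones.\<close>

fun syz_bound :: "nat \<Rightarrow> nat \<Rightarrow> nat \<Rightarrow> nat" where
  "syz_bound 0 m d = 0"
| "syz_bound (Suc v) m d = m * d + syz_bound v (m * (m * d + d)) d"

context valuation_pair
begin

text \<open>The last variable is specialized first. For a fixed monomial \<open>k'\<close> in the
  others, the coefficients at \<open>k'\<close> of the powers of that variable form a polynomial in
  one variable which is nonzero modulo \<open>M\<close>, and any good value for it keeps the
  coefficient at \<open>k'\<close> outside \<open>M\<close>.\<close>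

lemma eval_notin:
  assumes "vars_below v f" "coef f k \<notin> M"
  shows "\<exists>\<tau>. coef (psubst (\<lambda>x. mon 0 (\<tau> x)) f) 0 \<notin> M"
  using assms
proof (induction v arbitrary: f k)
  case 0
  have k0: "l = {#}" if "coef f l \<noteq> 0" for l
    using 0(1) that by (auto simp: vars_below_def)
  have "psubst \<sigma> f = f" for \<sigma>
    using psubst_cong[of f \<sigma> "\<lambda>x. mon {#x#} 1"] k0 by (fastforce simp: psubst_vars)
  moreover have "k = 0" using 0(2) k0[of k] M.zero by metis
  ultimately show ?case using 0(2) by auto
next
  case (Suc v)
  obtain B where B: "\<And>c. c \<ge> B \<Longrightarrow> xcoef v c f = 0" using xcoef_bounded by blast
  define c where "c = count k v"
  define k' where "k' = filter_mset (\<lambda>x. x \<noteq> v) k"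
  have cB: "c < B"
  proof (rule ccontr)
    assume "\<not> c < B"
    then have "coef f k = 0" unfolding coef_via_xcoef[of f k v] using B[of c] by (simp add: c_def)
    with Suc.prems(2) show False by simp
  qed
  have "coef (xcoef v c f) k' \<notin> M"
    using Suc.prems(2) unfolding coef_via_xcoef[of f k v] by (simp add: c_def k'_def)
  with infinite_residue[of c B "\<lambda>i. coef (xcoef v i f) k'"] cB
  obtain t where t: "(\<Sum>i\<le>B. coef (xcoef v i f) k' * t ^ i) \<notin> M" by auto
  define g where "g = (\<Sum>i\<le>B. xcoef v i f * mon 0 t ^ i)"
  have "vars_below v g" unfolding g_def
    by (intro vars_below_sum vars_below_times vars_below_xcoef Suc.prems vars_below_power vars_below_mon) simp
  moreover have "coef g k' = (\<Sum>i\<le>B. coef (xcoef v i f) k' * t ^ i)"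
    unfolding g_def lookup_sum by (intro sum.cong) (auto simp: mult.commute[of "xcoef _ _ _"] mult.commute[of "coef _ _"] simp flip: mon_0_power)
  ultimately obtain \<tau> where \<tau>: "coef (psubst (\<lambda>x. mon 0 (\<tau> x)) g) 0 \<notin> M"
    using Suc.IH[of g k'] t by auto
  let ?\<tau> = "\<tau>(v := t)"
  have x: "psubst (\<lambda>x. mon 0 (if x = v then t else \<tau> x)) (xcoef v i f) = psubst (\<lambda>x. mon 0 (\<tau> x)) (xcoef v i f)" for i
    by (rule psubst_cong) (auto simp: coef_xcoef)
  have pow: "psubst \<sigma> (h ^ i) = psubst \<sigma> h ^ i" for \<sigma> i and h :: "'p mpol"
    by (induction i) (auto simp: psubst_times)
  have f: "f = (\<Sum>i<Suc B. xcoef v i f * mon {#v#} 1 ^ i)" by (rule xcoef_expand) (use B in auto)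
  have "psubst (\<lambda>x. mon 0 (?\<tau> x)) f
      = (\<Sum>i\<le>B. psubst (\<lambda>x. mon 0 (\<tau> x)) (xcoef v i f) * mon 0 t ^ i)"
    by (subst f) (simp add: psubst_sum psubst_times pow x psubst_mono lessThan_Suc_atMost del: lessThan_Suc sum.lessThan_Suc)
  also have "\<dots> = psubst (\<lambda>x. mon 0 (\<tau> x)) g"
    by (simp add: g_def psubst_sum psubst_times pow)
  finally show ?case using \<tau> by metis
qed

text \<open>The shear adding \<open>\<tau> x\<close> times the last variable to every other variable
  \<open>x\<close> turns the coefficient of the \<open>\<delta>\<close>-th power of the last
  variable into the value of \<open>\<Delta>\<close> at \<open>\<tau>\<close> with last coordinate
  1. So a point where this value lies outside \<open>M\<close> is enough.\<close>

lemma coordinate_change: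
  assumes \<Delta>: "homogeneous (int \<delta>) \<Delta>" "vars_below (Suc v) \<Delta>" "coef \<Delta> k \<notin> M"
  shows "\<exists>\<sigma> \<sigma>'. (\<forall>f. psubst \<sigma> (psubst \<sigma>' f) = f) \<and> (\<forall>f. psubst \<sigma>' (psubst \<sigma> f) = f) \<and>
    (\<forall>x. homogeneous 1 (\<sigma> x) \<and> homogeneous 1 (\<sigma>' x)) \<and>
    (\<forall>x<Suc v. vars_below (Suc v) (\<sigma> x)) \<and>
    coef (psubst \<sigma> \<Delta>) (replicate_mset \<delta> v) \<notin> M"
proof -
  let ?X = "\<lambda>x. mon {#x#} (1::'p)"
  \<comment> \<open>\<open>\<Delta>\<close> with the last variable set to 1. By homogeneity no two
    monomials merge, so the coefficient outside \<open>M\<close> survives at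
    \<open>k'\<close>.\<close>
  define f where "f = (\<Sum>c\<le>\<delta>. xcoef v c \<Delta>)"
  define k' where "k' = filter_mset (\<lambda>x. x \<noteq> v) k"
  have "coef \<Delta> k \<noteq> 0" using \<Delta>(3) M.zero by metis
  then have sk: "size k = \<delta>" using \<Delta>(1) by (simp add: homogeneous_def)
  have kk: "k = k' + replicate_mset (count k v) v" by (simp add: k'_def mset_split_var)
  have ck: "count k v = \<delta> - size k'" "size k' \<le> \<delta>"
    using sk arg_cong[OF kk, of size] by auto
  have "coef f k' = (\<Sum>c\<le>\<delta>. if c = count k v then coef \<Delta> k else 0)"
    unfolding f_def lookup_sum
  proof (intro sum.cong refl)
    fix c
    show "coef (xcoef v c \<Delta>) k' = (if c = count k v then coef \<Delta> k else 0)"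
    proof (cases "c = count k v")
      case True
      then show ?thesis using coef_via_xcoef[of \<Delta> k v] by (simp add: k'_def)
    next
      case False
      have "coef (xcoef v c \<Delta>) k' = 0"
      proof (rule ccontr)
        assume "\<not> ?thesis"
        then have "int (size k') = int \<delta> - int c"
          using homogeneous_xcoef[OF \<Delta>(1), of c v] unfolding homogeneous_def by blast
        with ck False show False by simp
      qed
      with False show ?thesis by simp
    qed
  qed
  also have "\<dots> = coef \<Delta> k" using ck by simp
  finally have fk: "coef f k' \<notin> M" using \<Delta>(3) by simp
  have "vars_below v f" unfolding f_def by (intro vars_below_sum vars_below_xcoef \<Delta>)
  then obtain \<tau> where \<tau>: "coef (psubst (\<lambda>x. mon 0 (\<tau> x)) f) 0 \<notin> M" using eval_notin fk by blast
  define S where "S = (\<lambda>(c::'p) x. if x = v then ?X v else ?X x + mon 0 (c * \<tau> x) * ?X v)"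
  have SS: "psubst (S a) (psubst (S b) h) = h" if "a + b = 0" for a b h
  proof -
    have "psubst (S a) (S b x) = ?X x" for x
    proof (cases "x = v")
      case True
      then show ?thesis by (simp add: S_def psubst_mono)
    next
      case False
      have "psubst (S a) (S b x) = ?X x + (mon 0 (a * \<tau> x) + mon 0 (b * \<tau> x)) * ?X v"
        using False by (simp add: S_def psubst_add psubst_times psubst_mono algebra_simps)
      also have "mon 0 (a * \<tau> x) + mon 0 (b * \<tau> x) = (0 :: 'p mpol)"
        using that by (simp flip: single_add distrib_right)
      finally show ?thesis by simp
    qed
    then show ?thesis by (simp add: psubst_subst psubst_vars)
  qed
  have hS: "homogeneous 1 (S c x)" for c x
  proof -
    have "homogeneous (0 + 1) (mon 0 (c * \<tau> x) * ?X v)"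
      by (intro homogeneous_times homogeneous_mon) simp_all
    then show ?thesis unfolding S_def by (simp add: homogeneous_add homogeneous_mon)
  qed
  have vS: "vars_below (Suc v) (S c x)" if "x < Suc v" for c x
    unfolding S_def using that by (auto intro!: vars_below_add vars_below_times vars_below_mon)
  \<comment> \<open>Evaluation at the point (0, ..., 0, 1), which reads off the leading coefficient
    of a form of degree \<open>\<delta>\<close>.\<close>
  define \<epsilon> where "\<epsilon> = (\<lambda>x. if x = v then 1 else (0 :: 'p mpol))"
  have lead: "psubst \<epsilon> F = mon 0 (coef F (replicate_mset \<delta> v))" if F: "homogeneous (int \<delta>) F" for F
  proof -
    have "(\<Prod>x\<in>#k. \<epsilon> x) = (if k = replicate_mset \<delta> v then 1 else 0)" if "k \<in> Poly_Mapping.keys F" for k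
    proof -
      have "size k = \<delta>" using F that by (auto simp: homogeneous_def in_keys_iff)
      moreover have "(\<Prod>x\<in>#k. \<epsilon> x) = (if set_mset k \<subseteq> {v} then 1 else 0)"
        by (induction k) (auto simp: \<epsilon>_def)
      moreover have "set_mset k \<subseteq> {v} \<longleftrightarrow> k = replicate_mset (size k) v"
        by (metis set_mset_replicate_mset_subset set_mset_subset_singletonD subset_singleton_iff)
      ultimately show ?thesis by simp
    qed
    then have "psubst \<epsilon> F = (\<Sum>k\<in>Poly_Mapping.keys F. if k = replicate_mset \<delta> v then mon 0 (coef F k) else 0)"
      unfolding psubst_def by (intro sum.cong) auto
    also have "\<dots> = mon 0 (coef F (replicate_mset \<delta> v))" by (auto simp: in_keys_iff)
    finally show ?thesis .
  qed
  have pow: "psubst \<sigma> (h ^ i) = psubst \<sigma> h ^ i" for \<sigma> i and h :: "'p mpol"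
    by (induction i) (auto simp: psubst_times)
  have "psubst \<epsilon> (psubst (S 1) \<Delta>) = psubst (\<lambda>x. if x = v then 1 else mon 0 (\<tau> x)) \<Delta>"
    unfolding psubst_subst
    by (intro arg_cong[of _ _ "\<lambda>s. psubst s \<Delta>"] ext) (auto simp: S_def \<epsilon>_def psubst_add psubst_times psubst_mono)
  also have "\<dots> = psubst (\<lambda>x. if x = v then 1 else mon 0 (\<tau> x)) (\<Sum>c<Suc \<delta>. xcoef v c \<Delta> * ?X v ^ c)"
    using xcoef_deg_le[OF homogeneous_deg_le[OF \<Delta>(1)]]
    by (subst xcoef_expand[of "Suc \<delta>" v \<Delta>]) auto
  also have "\<dots> = (\<Sum>c<Suc \<delta>. psubst (\<lambda>x. if x = v then 1 else mon 0 (\<tau> x)) (xcoef v c \<Delta>))"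
    by (simp add: psubst_sum psubst_times pow psubst_mono del: sum.lessThan_Suc)
  also have "\<dots> = (\<Sum>c<Suc \<delta>. psubst (\<lambda>x. mon 0 (\<tau> x)) (xcoef v c \<Delta>))"
    by (intro sum.cong refl psubst_cong) (auto simp: coef_xcoef split: if_splits)
  also have "\<dots> = psubst (\<lambda>x. mon 0 (\<tau> x)) f"
    by (simp add: f_def psubst_sum lessThan_Suc_atMost)
  finally have "coef (psubst \<epsilon> (psubst (S 1) \<Delta>)) 0 \<notin> M" using \<tau> by simp
  then have "coef (psubst (S 1) \<Delta>) (replicate_mset \<delta> v) \<notin> M"
    by (simp add: lead homogeneous_psubst[OF \<Delta>(1) hS])
  with SS hS vS show ?thesis
    by (intro exI[of _ "S 1"] exI[of _ "S (-1)"]) auto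
qed

text \<open>The inverse substitution is needed for the last clause of \<open>cramer_data\<close>: a
  solution of the new system is pulled back before the old clause applies.\<close>

lemma cramer_data_psubst:
  assumes cd: "cramer_data I m n A v D \<delta> J \<Delta> V"
    and inv: "\<And>f. psubst \<sigma> (psubst \<sigma>' f) = f" "\<And>f. psubst \<sigma>' (psubst \<sigma> f) = f"
    and \<sigma>: "\<And>x. homogeneous 1 (\<sigma> x)" "\<And>x. x < v \<Longrightarrow> vars_below v (\<sigma> x)"
  shows "cramer_data I m n (\<lambda>i j. psubst \<sigma> (A i j)) v D \<delta> J (psubst \<sigma> \<Delta>) (\<lambda>j l. psubst \<sigma> (V j l))"
proof -
  have d: "deg_le 1 (\<sigma> x)" for x using \<sigma>(1)[of x] by (auto simp: homogeneous_def deg_le_def)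
  have "psubst \<sigma> \<Delta> * y l - (\<Sum>j\<in>{..<n} - J. y j * psubst \<sigma> (V j l)) \<in> coefs_in I"
    if y: "y \<in> syz I m n (\<lambda>i j. psubst \<sigma> (A i j))" and l: "l < n" for y l
  proof -
    have "(\<lambda>j. psubst \<sigma>' (y j)) \<in> syz I m n A"
      using syz_psubst[OF I.prime_ideal_set_axioms y, of \<sigma>'] by (simp add: inv)
    moreover from cd have "\<forall>y\<in>syz I m n A. \<forall>l<n. \<Delta> * y l - (\<Sum>j\<in>{..<n} - J. y j * V j l) \<in> coefs_in I"
      unfolding cramer_data_def by (elim conjE)
    ultimately have "\<forall>l<n. \<Delta> * psubst \<sigma>' (y l) - (\<Sum>j\<in>{..<n} - J. psubst \<sigma>' (y j) * V j l) \<in> coefs_in I"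
      by (rule bspec[rotated])
    then have "\<Delta> * psubst \<sigma>' (y l) - (\<Sum>j\<in>{..<n} - J. psubst \<sigma>' (y j) * V j l) \<in> coefs_in I"
      using l by (elim allE impE)
    from coefs_in_psubst[OF I.prime_ideal_set_axioms this, of \<sigma>]
    show ?thesis by (simp add: psubst_diff psubst_sum psubst_times inv)
  qed
  then show ?thesis
    using cd unfolding cramer_data_def
    by (auto intro!: homogeneous_psubst \<sigma> vars_below_psubst[of v] deg_le_psubst d
        syz_psubst[OF I.prime_ideal_set_axioms])
qed

text \<open>The weights \<open>w\<close> and \<open>u\<close> are forced by the induction: after expanding in powers of the last
  variable, the entries of the matrix are homogeneous of different degrees.\<close>

theorem homogeneous_syzygies:
  fixes A :: "nat \<Rightarrow> nat \<Rightarrow> 'p mpol"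
  assumes "\<And>i j. i < m \<Longrightarrow> j < n \<Longrightarrow> homogeneous (w j - u i) (A i j)"
      "\<And>i j. i < m \<Longrightarrow> j < n \<Longrightarrow> deg_le d (A i j)"
      "\<And>i j. i < m \<Longrightarrow> j < n \<Longrightarrow> vars_below v (A i j)"
    and "y \<in> syz I m n A" "\<And>j. j < n \<Longrightarrow> vars_below v (y j)"
  shows "y \<in> gen I M m n A (syz_bound v m d)"
  using assms
proof (induction v arbitrary: m n A w u y)
  case 0
  then show ?case by (intro gen_syz) (auto simp: deg_le_def vars_below_def)
next
  case (Suc v)
  let ?D = "m * d"
  let ?m = "m * (?D + d)"
  have "\<exists>\<delta> J \<Delta> V k. cramer_data I m n A (Suc v) ?D \<delta> J \<Delta> V \<and> coef \<Delta> k \<notin> M"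
    by (rule cramer_exists) (use Suc.prems in auto)
  then obtain \<delta> J \<Delta> V k where cd: "cramer_data I m n A (Suc v) ?D \<delta> J \<Delta> V" and k: "coef \<Delta> k \<notin> M"
    by (elim exE conjE)
  then have \<Delta>: "homogeneous (int \<delta>) \<Delta>" "vars_below (Suc v) \<Delta>" by (auto simp: cramer_data_def)
  obtain \<sigma> \<sigma>' where inv: "\<And>f. psubst \<sigma> (psubst \<sigma>' f) = f" "\<And>f. psubst \<sigma>' (psubst \<sigma> f) = f"
    and \<sigma>: "\<And>x. homogeneous 1 (\<sigma> x)" "\<And>x. homogeneous 1 (\<sigma>' x)" "\<And>x. x < Suc v \<Longrightarrow> vars_below (Suc v) (\<sigma> x)"
    and unit: "coef (psubst \<sigma> \<Delta>) (replicate_mset \<delta> v) \<notin> M"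
    using coordinate_change[OF \<Delta> k] by blast
  have d: "deg_le 1 (\<sigma> x)" "deg_le 1 (\<sigma>' x)" for x
    using \<sigma>(1,2)[of x] by (auto simp: homogeneous_def deg_le_def)
  let ?A = "\<lambda>i j. psubst \<sigma> (A i j)"
  let ?B = "expanded_matrix v ?D (?D + d) ?A"
  have B: "y' \<in> gen I M ?m (n * ?D) ?B (syz_bound v ?m d)"
    if "y' \<in> syz I ?m (n * ?D) ?B" "\<And>q. q < n * ?D \<Longrightarrow> vars_below v (y' q)" for y'
  \<comment> \<open>Taking the coefficient of the power \<open>l - k\<close> lowers the degree by
    \<open>l - k\<close>. This is absorbed by adding \<open>k\<close> to the weight of the column
    and \<open>l\<close> to that of the row.\<close>
  proof (rule Suc.IH[of ?m "n * ?D" "\<lambda>q. w (q div ?D) + int (q mod ?D)" "\<lambda>p. u (p div (?D + d)) + int (p mod (?D + d))"])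
    fix p q assume "p < ?m" "q < n * ?D"
    then have pq: "p div (?D + d) < m" "q div ?D < n" by (simp_all add: less_mult_imp_div_less)
    have "homogeneous (w (q div ?D) - u (p div (?D + d)) - int (p mod (?D + d) - q mod ?D))
        (xcoef v (p mod (?D + d) - q mod ?D) (?A (p div (?D + d)) (q div ?D)))"
      by (intro homogeneous_xcoef homogeneous_psubst Suc.prems pq \<sigma>)
    then show "homogeneous (w (q div ?D) + int (q mod ?D) - (u (p div (?D + d)) + int (p mod (?D + d)))) (?B p q)"
      by (auto simp: expanded_matrix_def of_nat_diff algebra_simps)
    show "deg_le d (?B p q)"
      by (auto simp: expanded_matrix_def intro!: deg_le_xcoef deg_le_psubst Suc.prems pq d)
    show "vars_below v (?B p q)"
      by (auto simp: expanded_matrix_def intro!: vars_below_xcoef vars_below_psubst[of "Suc v"] Suc.prems pq \<sigma>)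
  qed (use that in auto)
  have "(\<lambda>j. psubst \<sigma> (y j)) \<in> gen I M m n ?A (syz_bound (Suc v) m d)"
  proof (rule gen_monic[OF cramer_data_psubst[OF cd inv \<sigma>(1,3)] unit _ _ _ B])
    show "deg_le d (psubst \<sigma> (A i j))" if "i < m" "j < n" for i j
      using that by (intro deg_le_psubst Suc.prems d)
    show "(\<lambda>j. psubst \<sigma> (y j)) \<in> syz I m n ?A"
      by (rule syz_psubst[OF I.prime_ideal_set_axioms Suc.prems(4)])
    show "vars_below (Suc v) (psubst \<sigma> (y j))" if "j < n" for j
      using that by (intro vars_below_psubst[of "Suc v"] Suc.prems \<sigma>)
  qed auto
  from gen_psubst[where \<sigma> = \<sigma>', OF I.prime_ideal_set_axioms d(2) this] show ?case by (simp add: inv)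
qed

end

section \<open>Adjoining an indeterminate\<close>

text \<open>The analogue of \<open>coefs_in\<close> for polynomials in the single indeterminate T,
  which serve as coefficients of multivariate polynomials.\<close>

definition coeffs_in :: "'p::zero set \<Rightarrow> 'p poly set"
  where "coeffs_in I = {p. \<forall>i. poly.coeff p i \<in> I}"

lemma coeffs_in_prime:
  assumes "prime_ideal_set I"
  shows "prime_ideal_set (coeffs_in I)"
proof -
  interpret prime_ideal_set I by fact
  show ?thesis
  proof
    show "0 \<in> coeffs_in I" by (simp add: coeffs_in_def)
    show "a + b \<in> coeffs_in I" if "a \<in> coeffs_in I" "b \<in> coeffs_in I" for a b
      using that by (auto simp: coeffs_in_def intro: add)
    show "c * a \<in> coeffs_in I" if "a \<in> coeffs_in I" for a c
      using that by (auto simp: coeffs_in_def coeff_mult intro!: sum mult)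
    have "poly.coeff 1 0 \<notin> I" using one by simp
    then show "1 \<notin> coeffs_in I" unfolding coeffs_in_def by blast
    show "p \<in> coeffs_in I \<or> q \<in> coeffs_in I" if pq: "p * q \<in> coeffs_in I" for p q
    proof (rule ccontr)
      assume n: "\<not> ?thesis"
      have max: "\<exists>a. poly.coeff h a \<notin> I \<and> (\<forall>k>a. poly.coeff h k \<in> I)"
        if h: "h \<notin> coeffs_in I" for h
      proof -
        from h obtain i where i: "poly.coeff h i \<notin> I" by (auto simp: coeffs_in_def)
        have b: "k \<le> Polynomial.degree h" if "poly.coeff h k \<notin> I" for k
          using that zero by (intro le_degree) metis
        let ?a = "GREATEST k. poly.coeff h k \<notin> I"
        have "poly.coeff h ?a \<notin> I" using i b by (rule GreatestI_nat)
        moreover have "poly.coeff h k \<in> I" if "k > ?a" for k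
          using Greatest_le_nat[of "\<lambda>k. poly.coeff h k \<notin> I" k, OF _ b] that by (meson leD)
        ultimately show ?thesis by blast
      qed
      obtain a where a: "poly.coeff p a \<notin> I" "\<forall>k>a. poly.coeff p k \<in> I" using max n by blast
      obtain b where b: "poly.coeff q b \<notin> I" "\<forall>k>b. poly.coeff q k \<in> I" using max n by blast
      let ?t = "\<lambda>i. poly.coeff p i * poly.coeff q (a + b - i)"
      have rest: "(\<Sum>i\<in>{..a + b} - {a}. ?t i) \<in> I"
      proof (rule sum)
        fix i assume i: "i \<in> {..a + b} - {a}"
        show "?t i \<in> I"
        proof (cases "i > a")
          case True
          then show ?thesis using a(2) by (simp add: mult2)
        next
          case False
          with i have "a + b - i > b" by auto
          then show ?thesis using b(2) by (simp add: mult)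
        qed
      qed
      have "poly.coeff (p * q) (a + b) = ?t a + (\<Sum>i\<in>{..a + b} - {a}. ?t i)"
        unfolding coeff_mult by (subst sum.remove[of _ a]) auto
      then have "poly.coeff p a * poly.coeff q b
          = poly.coeff (p * q) (a + b) - (\<Sum>i\<in>{..a + b} - {a}. ?t i)" by simp
      moreover have "poly.coeff (p * q) (a + b) \<in> I" using pq by (simp add: coeffs_in_def)
      ultimately have "poly.coeff p a * poly.coeff q b \<in> I" using diff rest by simp
      from prime[OF this] a(1) b(1) show False by simp
    qed
  qed
qed

context chain_pair
begin

text \<open>The Gauss extension of a valuation. With \<open>\<beta>\<close> minimal among all
  coefficients of \<open>a\<close> and \<open>b\<close>, both are \<open>\<beta>\<close> times a
  polynomial \<open>?R\<close> up to the factor \<open>s\<close>, and the one in which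
  \<open>\<beta>\<close> occurs has \<open>?R\<close> outside \<open>M[T]\<close>. Cross-multiplying
  shows that it divides the other.\<close>

lemma poly_chain:
  fixes a b :: "'p poly"
  shows "\<exists>s c. s \<notin> coeffs_in M \<and> (s * a - c * b \<in> coeffs_in I \<or> s * b - c * a \<in> coeffs_in I)"
proof -
  interpret PI: prime_ideal_set "coeffs_in I" by (rule coeffs_in_prime[OF I.prime_ideal_set_axioms])
  interpret PM: prime_ideal_set "coeffs_in M" by (rule coeffs_in_prime[OF M.prime_ideal_set_axioms])
  let ?F = "\<lambda>p::'p poly. poly.coeff p ` {..Polynomial.degree p}"
  have F: "poly.coeff p i \<in> insert 0 (?F p)" for p i
    by (cases "i \<le> Polynomial.degree p") (auto simp: coeff_eq_0)
  have "\<exists>\<beta>\<in>?F a \<union> ?F b. \<exists>s. s \<notin> M \<and> (\<forall>x\<in>?F a \<union> ?F b. \<exists>c. s * x - c * \<beta> \<in> I)"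
    by (rule chain_finite) auto
  then obtain \<beta> s where \<beta>: "\<beta> \<in> ?F a \<union> ?F b" and s: "s \<notin> M"
    and "\<forall>x\<in>?F a \<union> ?F b. \<exists>c. s * x - c * \<beta> \<in> I"
    by (elim bexE exE conjE)
  then have bs: "\<exists>c. s * x - c * \<beta> \<in> I" if "x \<in> ?F a \<union> ?F b" for x
    using that by blast
  have "\<exists>c. (x = 0 \<longrightarrow> c = 0) \<and> (x \<in> ?F a \<union> ?F b \<or> x = 0 \<longrightarrow> s * x - c * \<beta> \<in> I)" for x
    using bs[of x] by (cases "x = 0") auto
  then obtain \<gamma> where \<gamma>_all: "\<And>x. (x = 0 \<longrightarrow> \<gamma> x = 0) \<and> (x \<in> ?F a \<union> ?F b \<or> x = 0 \<longrightarrow> s * x - \<gamma> x * \<beta> \<in> I)"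
    by metis
  have \<gamma>0: "\<gamma> 0 = 0" using \<gamma>_all[of 0] by simp
  have \<gamma>: "s * x - \<gamma> x * \<beta> \<in> I" if "x \<in> insert 0 (?F a) \<union> insert 0 (?F b)" for x
    using \<gamma>_all[of x] that by blast
  have sM: "[:s:] \<notin> coeffs_in M"
    using s by (auto simp: coeffs_in_def intro!: exI[of _ 0])
  show ?thesis
  \<comment> \<open>If the minimum is zero modulo \<open>I\<close>, so are all coefficients, and
    \<open>a\<close> is trivially a multiple of \<open>b\<close>.\<close>
  proof (cases "\<beta> \<in> I")
    case True
    have "poly.coeff a i \<in> I" for i
    proof -
      have "s * poly.coeff a i - \<gamma> (poly.coeff a i) * \<beta> \<in> I" using \<gamma> F[of a i] by blast
      then have "s * poly.coeff a i \<in> I" using I.add_cancel I.mult[OF True] by simp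
      from I.prime[OF this] s I_le_M show ?thesis by auto
    qed
    then have "1 * a - 0 * b \<in> coeffs_in I" by (simp add: coeffs_in_def)
    with PM.one show ?thesis by blast
  next
    case False
    let ?R = "\<lambda>p. map_poly \<gamma> p"
    have R: "[:s:] * p - [:\<beta>:] * ?R p \<in> coeffs_in I" if "p = a \<or> p = b" for p
      unfolding coeffs_in_def
    proof (intro CollectI allI)
      fix i
      have "s * poly.coeff p i - \<gamma> (poly.coeff p i) * \<beta> \<in> I" using \<gamma> F[of p i] that by blast
      then show "poly.coeff ([:s:] * p - [:\<beta>:] * ?R p) i \<in> I"
        by (simp add: coeff_map_poly \<gamma>0 mult.commute)
    qed
    have \<gamma>\<beta>: "\<gamma> \<beta> \<notin> M"
    proof
      assume "\<gamma> \<beta> \<in> M"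
      have "s * \<beta> - \<gamma> \<beta> * \<beta> \<in> I" using \<gamma> \<beta> by blast
      then have "(s - \<gamma> \<beta>) * \<beta> \<in> I" by (simp only: left_diff_distrib)
      from I.prime[OF this] False I_le_M have "s - \<gamma> \<beta> \<in> M" by auto
      with \<open>\<gamma> \<beta> \<in> M\<close> s show False using M.add_cancel by blast
    qed
    have RM: "?R p \<notin> coeffs_in M" if p: "\<beta> \<in> ?F p" for p
    proof -
      from p obtain i where "\<beta> = poly.coeff p i" by blast
      with \<gamma>\<beta> have "poly.coeff (?R p) i \<notin> M" by (simp add: coeff_map_poly \<gamma>0)
      then show ?thesis by (auto simp: coeffs_in_def)
    qed
    have main: "[:s:] * ?R p * q - [:s:] * ?R q * p \<in> coeffs_in I"
      if "p = a \<or> p = b" "q = a \<or> q = b" for p q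
    proof -
      have "[:s:] * ?R p * q - [:s:] * ?R q * p
          = ?R p * ([:s:] * q - [:\<beta>:] * ?R q) - ?R q * ([:s:] * p - [:\<beta>:] * ?R p)"
        by (simp only: algebra_simps)
      then show ?thesis using R that by (simp only: PI.diff PI.mult)
    qed
    have nM: "[:s:] * ?R p \<notin> coeffs_in M" if "\<beta> \<in> ?F p" for p
      using PM.prime[of "[:s:]" "?R p"] sM RM[OF that] by blast
    from \<beta> show ?thesis
    proof
      assume "\<beta> \<in> ?F a"
      from nM[OF this] main[of a b] show ?thesis by blast
    next
      assume "\<beta> \<in> ?F b"
      from nM[OF this] main[of b a] show ?thesis by blast
    qed
  qed
qed

text \<open>A power of \<open>T\<close> exceeding all degrees keeps the coefficients of the summands apart.\<close>

lemma poly_infinite_residue: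
  fixes x :: "nat \<Rightarrow> 'p poly"
  assumes "k \<le> d" "x k \<notin> coeffs_in M"
  shows "\<exists>t. (\<Sum>i\<le>d. x i * t ^ i) \<notin> coeffs_in M"
proof -
  obtain j where j: "poly.coeff (x k) j \<notin> M" using assms(2) by (auto simp: coeffs_in_def)
  define K where "K = Suc (\<Sum>i\<le>d. Polynomial.degree (x i))"
  have K: "Polynomial.degree (x i) < K" if "i \<le> d" for i
  proof -
    have "Polynomial.degree (x i) \<le> (\<Sum>i\<le>d. Polynomial.degree (x i))"
      using that by (intro member_le_sum) auto
    then show ?thesis by (simp add: K_def)
  qed
  have "poly.coeff (x k) j \<noteq> 0" using j M.zero by metis
  then have jK: "j < K" using K[OF assms(1)] le_degree by (meson le_less_trans)
  let ?t = "Polynomial.monom (1::'p) K"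
  have "poly.coeff (x i * ?t ^ i) (K * k + j) = (if i = k then poly.coeff (x k) j else 0)"
    if i: "i \<le> d" for i
  proof -
    have c: "poly.coeff (x i * ?t ^ i) (K * k + j)
        = (if K * i \<le> K * k + j then poly.coeff (x i) (K * k + j - K * i) else 0)"
      by (simp add: monom_power mult.commute[of "x i"] coeff_monom_mult)
    consider "i = k" | "i < k" | "i > k" by linarith
    then show ?thesis
    proof cases
      case 1
      with c show ?thesis by simp
    next
      case 2
      then have "K * Suc i \<le> K * k" by (intro mult_left_mono) auto
      then have "K \<le> K * k + j - K * i" by simp
      then have "poly.coeff (x i) (K * k + j - K * i) = 0" using K[OF i] by (intro coeff_eq_0) simp
      with 2 c show ?thesis by simp
    next
      case 3
      then have "K * Suc k \<le> K * i" by (intro mult_left_mono) auto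
      with jK have "\<not> K * i \<le> K * k + j" by simp
      with 3 c show ?thesis by simp
    qed
  qed
  then have "poly.coeff (\<Sum>i\<le>d. x i * ?t ^ i) (K * k + j) = (\<Sum>i\<le>d. if i = k then poly.coeff (x k) j else 0)"
    unfolding coeff_sum by (intro sum.cong) auto
  also have "\<dots> = poly.coeff (x k) j" using assms(1) by simp
  finally have "poly.coeff (\<Sum>i\<le>d. x i * ?t ^ i) (K * k + j) \<notin> M" using j by simp
  then have "(\<Sum>i\<le>d. x i * ?t ^ i) \<notin> coeffs_in M" unfolding coeffs_in_def by blast
  then show ?thesis by blast
qed

lemma poly_valuation_pair: "valuation_pair (coeffs_in I) (coeffs_in M)"
proof -
  interpret PI: prime_ideal_set "coeffs_in I" by (rule coeffs_in_prime[OF I.prime_ideal_set_axioms])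
  interpret PM: prime_ideal_set "coeffs_in M" by (rule coeffs_in_prime[OF M.prime_ideal_set_axioms])
  show ?thesis
    by standard (use I_le_M poly_chain poly_infinite_residue in \<open>auto simp: coeffs_in_def\<close>)
qed

end

subsection \<open>Descent from \<open>P[T]\<close> to \<open>P\<close>\<close>

definition embedT :: "'p::comm_ring_1 mpol \<Rightarrow> 'p poly mpol"
  where "embedT = map_coefs (\<lambda>a. [:a:])"

definition coefT :: "nat \<Rightarrow> 'p::comm_ring_1 poly mpol \<Rightarrow> 'p mpol"
  where "coefT i = map_coefs (\<lambda>p. poly.coeff p i)"

lemma coef_embedT: "coef (embedT f) k = [:coef f k:]"
  by (simp add: embedT_def coef_map_coefs)

lemma coef_coefT: "coef (coefT i f) k = poly.coeff (coef f k) i"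
  by (simp add: coefT_def coef_map_coefs)

lemma coefT_times: "coefT i (f * g) = (\<Sum>a\<le>i. coefT a f * coefT (i - a) g)"
proof (rule poly_mapping_eqI)
  fix m
  have "coef (coefT i (f * g)) m
      = (\<Sum>k\<in>{k. k \<subseteq># m}. \<Sum>a\<le>i. poly.coeff (coef f k) a * poly.coeff (coef g (m - k)) (i - a))"
    by (simp add: coef_coefT coef_times coeff_sum coeff_mult)
  also have "\<dots> = (\<Sum>a\<le>i. \<Sum>k\<in>{k. k \<subseteq># m}. poly.coeff (coef f k) a * poly.coeff (coef g (m - k)) (i - a))"
    by (rule sum.swap)
  also have "\<dots> = coef (\<Sum>a\<le>i. coefT a f * coefT (i - a) g) m"
    by (simp add: coef_coefT coef_times lookup_sum)
  finally show "coef (coefT i (f * g)) m = coef (\<Sum>a\<le>i. coefT a f * coefT (i - a) g) m" .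
qed

lemma coefT_embedT: "coefT i (embedT f) = (if i = 0 then f else 0)"
  by (rule poly_mapping_eqI) (simp add: coef_coefT coef_embedT coeff_pCons split: nat.split)

lemma coefT_embedT_times: "coefT i (embedT f * g) = f * coefT i g"
proof -
  have "coefT i (embedT f * g) = (\<Sum>a\<le>i. if a = 0 then f * coefT (i - a) g else 0)"
    unfolding coefT_times coefT_embedT by (intro sum.cong) auto
  then show ?thesis by simp
qed

lemma coefT_add: "coefT i (f + g) = coefT i f + coefT i g"
  by (rule poly_mapping_eqI) (simp add: coef_coefT lookup_add)

lemma coefT_sum: "coefT i (\<Sum>x\<in>S. f x) = (\<Sum>x\<in>S. coefT i (f x))"
  by (rule poly_mapping_eqI) (simp add: coef_coefT lookup_sum coeff_sum)

lemma coefT_const_times_embedT: "coefT i (mon 0 s * embedT f) = mon 0 (poly.coeff s i) * f"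
  by (rule poly_mapping_eqI) (simp add: coef_coefT coef_embedT)

lemma embedT_times: "embedT (f * g) = embedT f * embedT g"
proof (rule poly_mapping_eqI)
  fix m
  have "[:\<Sum>x\<in>S. h x:] = (\<Sum>x\<in>S. [:h x:])" for S and h :: "nat multiset \<Rightarrow> 'a"
    by (rule poly_eqI) (simp add: coeff_sum coeff_pCons split: nat.split)
  then show "coef (embedT (f * g)) m = coef (embedT f * embedT g) m"
    by (simp add: coef_embedT coef_times mult.commute)
qed

lemma embedT_sum: "embedT (\<Sum>x\<in>S. f x) = (\<Sum>x\<in>S. embedT (f x))"
proof -
  have "embedT (f + g) = embedT f + embedT g" for f g :: "'a mpol"
    by (rule poly_mapping_eqI) (simp add: coef_embedT lookup_add)
  moreover have "embedT 0 = (0 :: 'a poly mpol)"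
    by (rule poly_mapping_eqI) (simp add: coef_embedT)
  ultimately show ?thesis by (induction S rule: infinite_finite_induct) auto
qed

lemma embedT_coefs_in: "f \<in> coefs_in I \<Longrightarrow> 0 \<in> I \<Longrightarrow> embedT f \<in> coefs_in (coeffs_in I)"
  by (auto simp: coefs_in_def coef_embedT coeffs_in_def coeff_pCons split: nat.split)

lemma coefT_coefs_in: "f \<in> coefs_in (coeffs_in I) \<Longrightarrow> coefT i f \<in> coefs_in I"
  by (auto simp: coefs_in_def coef_coefT coeffs_in_def)

context chain_pair
begin

text \<open>The matrix is free of T, so the T-coefficients of a solution are solutions of no larger
  degree. Division by some \<open>s\<close> outside \<open>M[T]\<close> has no counterpart for
  single coefficients; the statement therefore carries a multiplier, which absorbs it.\<close>

lemma gen_descent: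
  assumes "z \<in> gen (coeffs_in I) (coeffs_in M) m n (\<lambda>i j. embedT (A i j)) b"
  shows "\<exists>s. s \<notin> coeffs_in M \<and> (\<forall>i. (\<lambda>j. coefT i (mon 0 s * z j)) \<in> gen I M m n A b)"
  using assms
proof (induction rule: gen.induct)
  interpret PM: prime_ideal_set "coeffs_in M" by (rule coeffs_in_prime[OF M.prime_ideal_set_axioms])
  {
    case (gen_syz z)
    have "(\<lambda>j. coefT i (mon 0 1 * z j)) \<in> gen I M m n A b" for i
    proof (rule gen.gen_syz)
      have "(\<Sum>j<n. A k j * coefT i (z j)) \<in> coefs_in I" if "k < m" for k
      proof -
        have "coefT i (\<Sum>j<n. embedT (A k j) * z j) \<in> coefs_in I"
          by (rule coefT_coefs_in) (use gen_syz.hyps(1) that in \<open>simp add: syz_def\<close>)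
        then show ?thesis by (simp add: coefT_sum coefT_embedT_times)
      qed
      then show "(\<lambda>j. coefT i (mon 0 1 * z j)) \<in> syz I m n A" by (simp add: syz_def)
      show "deg_le b (coefT i (mon 0 1 * z j))" if "j < n" for j
        using gen_syz.hyps(2)[OF that] by (simp add: coefT_def map_coefs_preserves)
    qed
    with PM.one show ?case by blast
  next
    case (gen_null z)
    have "(\<lambda>j. coefT i (mon 0 1 * z j)) \<in> gen I M m n A b" for i
      by (rule gen.gen_null) (use gen_null in \<open>simp add: coefT_coefs_in\<close>)
    with PM.one show ?case by blast
  next
    case (gen_add y z)
    then obtain s t where s: "s \<notin> coeffs_in M" "\<And>i. (\<lambda>j. coefT i (mon 0 s * y j)) \<in> gen I M m n A b"
      and t: "t \<notin> coeffs_in M" "\<And>i. (\<lambda>j. coefT i (mon 0 t * z j)) \<in> gen I M m n A b" by blast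
    \<comment> \<open>Both summands are brought to the common multiplier \<open>s * t\<close>. A
      T-coefficient of a product is a combination of T-coefficients of its second factor, so
      \<open>gen\<close> contains it.\<close>
    have "(\<lambda>j. coefT i (mon 0 (s * t) * (y j + z j))) \<in> gen I M m n A b" for i
    proof -
      have "coefT i (mon 0 (s * t) * (y j + z j))
          = (\<Sum>a\<le>i. coefT a (mon 0 t) * coefT (i - a) (mon 0 s * y j))
          + (\<Sum>a\<le>i. coefT a (mon 0 s) * coefT (i - a) (mon 0 t * z j))" for j
        unfolding coefT_times[symmetric] coefT_add[symmetric] by (simp add: mon_0_mult algebra_simps)
      then show ?thesis by (simp add: gen.gen_add gen_sum gen_smult s t)
    qed
    moreover have "s * t \<notin> coeffs_in M" using PM.prime[of s t] s t by blast
    ultimately show ?case by blast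
  next
    case (gen_smult y c)
    then obtain s where s: "s \<notin> coeffs_in M" "\<And>i. (\<lambda>j. coefT i (mon 0 s * y j)) \<in> gen I M m n A b"
      by blast
    have "(\<lambda>j. coefT i (mon 0 s * (c * y j))) \<in> gen I M m n A b" for i
    proof -
      have "coefT i (mon 0 s * (c * y j)) = (\<Sum>a\<le>i. coefT a c * coefT (i - a) (mon 0 s * y j))" for j
        unfolding coefT_times[symmetric] by (simp add: ac_simps)
      then show ?thesis by (simp add: gen_sum gen.gen_smult s)
    qed
    with s show ?case by blast
  next
    case (gen_div s y)
    then obtain t where t: "t \<notin> coeffs_in M" "\<And>i. (\<lambda>j. coefT i (mon 0 t * (mon 0 s * y j))) \<in> gen I M m n A b"
      by blast
    have "t * s \<notin> coeffs_in M" using PM.prime[of t s] t gen_div.hyps(1) by blast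
    moreover have "mon 0 (t * s) * y j = mon 0 t * (mon 0 s * y j)" for j
      by (simp add: mon_0_mult mult.assoc)
    ultimately show ?case using t by auto
  }
qed

theorem homogeneous_syzygies_chain:
  fixes A :: "nat \<Rightarrow> nat \<Rightarrow> 'p mpol"
  assumes A: "\<And>i j. i < m \<Longrightarrow> j < n \<Longrightarrow> homogeneous (w j - u i) (A i j)"
      "\<And>i j. i < m \<Longrightarrow> j < n \<Longrightarrow> deg_le d (A i j)"
      "\<And>i j. i < m \<Longrightarrow> j < n \<Longrightarrow> vars_below v (A i j)"
    and y: "y \<in> syz I m n A" "\<And>j. j < n \<Longrightarrow> vars_below v (y j)"
  shows "y \<in> gen I M m n A (syz_bound v m d)"
proof -
  interpret P: valuation_pair "coeffs_in I" "coeffs_in M" by (rule poly_valuation_pair)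
  have e: "homogeneous k f \<Longrightarrow> homogeneous k (embedT f)" "deg_le d f \<Longrightarrow> deg_le d (embedT f)"
    "vars_below v f \<Longrightarrow> vars_below v (embedT f)" for k f
    unfolding embedT_def by (simp_all add: map_coefs_preserves)
  have "(\<lambda>j. embedT (y j)) \<in> syz (coeffs_in I) m n (\<lambda>i j. embedT (A i j))"
    using y(1) by (auto simp: syz_def embedT_times[symmetric] embedT_sum[symmetric] intro: embedT_coefs_in)
  then have "(\<lambda>j. embedT (y j)) \<in> gen (coeffs_in I) (coeffs_in M) m n (\<lambda>i j. embedT (A i j)) (syz_bound v m d)"
    by (intro P.homogeneous_syzygies[where w = w and u = u] e A y)
  from gen_descent[OF this] obtain s where s: "s \<notin> coeffs_in M"
    "\<And>i. (\<lambda>j. mon 0 (poly.coeff s i) * y j) \<in> gen I M m n A (syz_bound v m d)"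
    by (auto simp: coefT_const_times_embedT)
  \<comment> \<open>As \<open>y\<close> is free of T, the T-coefficients of \<open>s\<close> times
    \<open>y\<close> are multiples of \<open>y\<close> by the coefficients of \<open>s\<close>, and
    one of these is outside \<open>M\<close>.\<close>
  from s(1) obtain i where "poly.coeff s i \<notin> M" by (auto simp: coeffs_in_def)
  from gen_div[OF this s(2)] show ?thesis .
qed

end

section \<open>Homogenization and the numerical bound\<close>

lemma gen_mono:
  assumes "z \<in> gen I M m n A b" "b \<le> b'"
  shows "z \<in> gen I M m n A b'"
  using assms(1)
proof (induction rule: gen.induct)
  case (gen_syz z)
  then show ?case using assms(2) by (intro gen.gen_syz) (auto intro: deg_le_mono)
qed (auto intro: gen.intros)

lemma gen_matrix_cong:
  assumes "\<And>i j. i < m \<Longrightarrow> j < n \<Longrightarrow> A i j = B i j"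
  shows "gen I M m n A b = gen I M m n B b"
proof -
  have "z \<in> gen I M m n B b" if "z \<in> gen I M m n A b" "\<And>i j. i < m \<Longrightarrow> j < n \<Longrightarrow> A i j = B i j" for A B z
    using that(1)
  proof (induction rule: gen.induct)
    case (gen_syz z)
    then show ?case using that(2) by (intro gen.gen_syz) (auto simp: syz_def)
  qed (auto intro: gen.intros)
  from this[of _ A B] this[of _ B A] assms show ?thesis by auto
qed

text \<open>The new variable has index \<open>N\<close>. The target degree \<open>d\<close> may be
  any bound, so that all entries of a matrix or vector can be brought to one degree.\<close>

definition homogenize :: "nat \<Rightarrow> nat \<Rightarrow> 'p::comm_ring_1 mpol \<Rightarrow> 'p mpol"
  where "homogenize N d f =
    (\<Sum>k\<in>Poly_Mapping.keys f. mon (k + replicate_mset (d - size k) N) (coef f k))"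

text \<open>All variables with index at least \<open>N\<close> become 1, not only the homogenizing
  one; this makes it a retraction onto the polynomials in the first \<open>N\<close>
  variables.\<close>

definition dehomogenize :: "nat \<Rightarrow> 'p::comm_ring_1 mpol \<Rightarrow> 'p mpol"
  where "dehomogenize N = psubst (\<lambda>x. if x < N then mon {#x#} 1 else 1)"

lemma homogenize_homogeneous: "deg_le d f \<Longrightarrow> homogeneous (int d) (homogenize N d f)"
  unfolding homogenize_def
  by (intro homogeneous_sum homogeneous_mon) (auto simp: deg_le_def in_keys_iff)

lemma homogenize_vars_below: "vars_below N f \<Longrightarrow> vars_below (Suc N) (homogenize N d f)"
  unfolding homogenize_def
proof (intro vars_below_sum vars_below_mon)
  fix k assume "vars_below N f" "k \<in> Poly_Mapping.keys f"
  then have "set_mset k \<subseteq> {..<N}" by (simp add: vars_below_def in_keys_iff)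
  then show "set_mset (k + replicate_mset (d - size k) N) \<subseteq> {..<Suc N}"
    by (auto simp: less_Suc_eq split: if_splits)
qed

lemma dehomogenize_eq:
  "dehomogenize N f = (\<Sum>k\<in>Poly_Mapping.keys f. mon (filter_mset (\<lambda>x. x < N) k) (coef f k))"
proof -
  have "(\<Prod>x\<in>#k. if x < N then mon {#x#} 1 else 1) = mon (filter_mset (\<lambda>x. x < N) k) (1::'a)" for k
    by (induction k) (auto simp: mult_single)
  then show ?thesis unfolding dehomogenize_def psubst_def by (simp add: mult_single)
qed

lemma dehomogenize_id: "vars_below N f \<Longrightarrow> dehomogenize N f = f"
  unfolding dehomogenize_def
  by (subst psubst_cong[where \<rho> = "\<lambda>x. mon {#x#} 1"]) (auto simp: vars_below_def psubst_vars)

lemma dehomogenize_homogenize: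
  assumes "vars_below N f"
  shows "dehomogenize N (homogenize N d f) = f"
proof -
  have "dehomogenize N (mon (k + replicate_mset (d - size k) N) (coef f k)) = mon k (coef f k)"
    if k: "k \<in> Poly_Mapping.keys f" for k
  proof -
    have "set_mset k \<subseteq> {..<N}" using assms k by (auto simp: vars_below_def in_keys_iff)
    then have 1: "filter_mset (\<lambda>x. x < N) k = k" by (auto simp: filter_mset_eq_conv)
    have 2: "filter_mset (\<lambda>x. x < N) (replicate_mset l N) = {#}" for l by (induction l) auto
    show ?thesis using k by (simp add: dehomogenize_eq 1 2)
  qed
  then have "dehomogenize N (homogenize N d f) = (\<Sum>k\<in>Poly_Mapping.keys f. mon k (coef f k))"
    unfolding homogenize_def dehomogenize_def psubst_sum by (simp add: dehomogenize_def)
  then show ?thesis using poly_mapping_sum_mons[of f] by simp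
qed

lemma dehomogenize_vars_below: "vars_below N (dehomogenize N f)"
  unfolding dehomogenize_eq by (intro vars_below_sum vars_below_mon) auto

lemma dehomogenize_deg_le: "deg_le d f \<Longrightarrow> deg_le d (dehomogenize N f)"
  unfolding dehomogenize_def by (rule deg_le_psubst) (auto simp: deg_le_mon_iff)

text \<open>In a form the exponent of the variable \<open>N\<close> is determined by the other
  exponents. Distinct monomials therefore stay distinct and the coefficients reappear
  unchanged.\<close>

lemma dehomogenize_coefs_in:
  assumes "homogeneous d F" "vars_below (Suc N) F" "dehomogenize N F \<in> coefs_in I" "0 \<in> I"
  shows "F \<in> coefs_in I"
  unfolding coefs_in_def
proof (intro CollectI allI)
  fix k0
  show "coef F k0 \<in> I"
  proof (cases "coef F k0 = 0")
    case False
    let ?f = "filter_mset (\<lambda>x. x < N)"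
    have split: "k = ?f k + replicate_mset (size k - size (?f k)) N" if "coef F k \<noteq> 0" for k
    proof -
      have k: "set_mset k \<subseteq> {..<Suc N}" using assms(2) that by (auto simp: vars_below_def)
      let ?g = "filter_mset (\<lambda>x. \<not> x < N) k"
      have "set_mset ?g \<subseteq> {N}" using k by auto
      then have "?g = replicate_mset (size ?g) N" by (metis set_mset_subset_singletonD)
      moreover have "k = ?f k + ?g" by simp
      moreover from this have "size k = size (?f k) + size ?g" by (metis size_union)
      ultimately show ?thesis by (metis add_diff_cancel_left')
    qed
    have inj: "k = k0" if "coef F k \<noteq> 0" "?f k = ?f k0" for k
    proof -
      have "int (size k) = d" "int (size k0) = d" using assms(1) that(1) False by (auto simp: homogeneous_def)
      then have "size k = size k0" by simp
      with split[OF that(1)] split[OF False] that(2) show ?thesis by metis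
    qed
    have "coef (dehomogenize N F) (?f k0) = (\<Sum>k\<in>Poly_Mapping.keys F. if k = k0 then coef F k else 0)"
      unfolding dehomogenize_eq lookup_sum
      by (intro sum.cong) (auto simp: lookup_single when_def in_keys_iff dest: inj)
    also have "\<dots> = coef F k0" using False by (simp add: in_keys_iff)
    finally have "coef (dehomogenize N F) (?f k0) = coef F k0" .
    moreover have "coef (dehomogenize N F) (?f k0) \<in> I" using assms(3) by (simp add: coefs_in_def)
    ultimately show ?thesis by simp
  qed (simp add: assms(4))
qed

theorem (in chain_pair) syzygies_bounded:
  fixes A :: "nat \<Rightarrow> nat \<Rightarrow> 'p mpol"
  assumes A: "\<And>i j. i < m \<Longrightarrow> j < n \<Longrightarrow> deg_le d (A i j)"
      "\<And>i j. i < m \<Longrightarrow> j < n \<Longrightarrow> vars_below N (A i j)"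
    and y: "y \<in> syz I m n A" "\<And>j. j < n \<Longrightarrow> vars_below N (y j)"
  shows "y \<in> gen I M m n A (syz_bound (Suc N) m d)"
proof -
  \<comment> \<open>Any common degree bound for the solution does; it does not enter the bound for
    the generators.\<close>
  define e where "e = (\<Sum>j<n. Max (insert 0 (size ` Poly_Mapping.keys (y j))))"
  have e: "deg_le e (y j)" if "j < n" for j
    unfolding deg_le_def
  proof (intro allI impI)
    fix k assume "coef (y j) k \<noteq> 0"
    then have "size k \<le> Max (insert 0 (size ` Poly_Mapping.keys (y j)))"
      by (intro Max_ge) (auto simp: in_keys_iff)
    also have "\<dots> \<le> e" unfolding e_def using that by (intro member_le_sum) auto
    finally show "size k \<le> e" .
  qed
  let ?A = "\<lambda>i j. homogenize N d (A i j)"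
  let ?y = "\<lambda>j. homogenize N e (y j)"
  have dt: "dehomogenize N (f * g) = dehomogenize N f * dehomogenize N g" for f g :: "'p mpol"
    by (simp add: dehomogenize_def psubst_times)
  have ds: "dehomogenize N (\<Sum>j<n. h j) = (\<Sum>j<n. dehomogenize N (h j))" for h :: "nat \<Rightarrow> 'p mpol"
    by (simp add: dehomogenize_def psubst_sum)
  have "?y \<in> syz I m n ?A"
    unfolding syz_def mem_Collect_eq
  proof (intro allI impI)
    fix i assume i: "i < m"
    show "(\<Sum>j<n. ?A i j * ?y j) \<in> coefs_in I"
    proof (rule dehomogenize_coefs_in[where N = N])
      show "homogeneous (int d + int e) (\<Sum>j<n. ?A i j * ?y j)"
        by (intro homogeneous_sum homogeneous_times homogenize_homogeneous A e i) auto
      show "vars_below (Suc N) (\<Sum>j<n. ?A i j * ?y j)"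
        by (intro vars_below_sum vars_below_times homogenize_vars_below A y i) auto
      have "dehomogenize N (\<Sum>j<n. ?A i j * ?y j) = (\<Sum>j<n. A i j * y j)"
        unfolding ds dt by (intro sum.cong refl) (simp add: dehomogenize_homogenize A y i)
      then show "dehomogenize N (\<Sum>j<n. ?A i j * ?y j) \<in> coefs_in I"
        using y(1) i by (simp add: syz_def)
    qed simp
  qed
  moreover have "homogeneous (int d - 0) (?A i j)" "deg_le d (?A i j)" "vars_below (Suc N) (?A i j)"
    if "i < m" "j < n" for i j
    using homogenize_homogeneous[OF A(1)[OF that]] homogenize_vars_below[OF A(2)[OF that], of d]
    by (simp_all add: homogeneous_deg_le)
  ultimately have "?y \<in> gen I M m n ?A (syz_bound (Suc N) m d)"
    by (intro homogeneous_syzygies_chain[where w = "\<lambda>_. int d" and u = "\<lambda>_. 0"])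
      (assumption | intro homogenize_vars_below y)+
  from gen_psubst[where \<sigma> = "\<lambda>x. if x < N then mon {#x#} 1 else 1", OF I.prime_ideal_set_axioms _ this]
  have "(\<lambda>j. dehomogenize N (?y j)) \<in> gen I M m n (\<lambda>i j. dehomogenize N (?A i j)) (syz_bound (Suc N) m d)"
    by (auto simp: dehomogenize_def deg_le_mon_iff)
  moreover have "gen I M m n (\<lambda>i j. dehomogenize N (?A i j)) b = gen I M m n A b" for b
  proof (rule gen_matrix_cong)
    show "dehomogenize N (?A i j) = A i j" if "i < m" "j < n" for i j
      using that by (simp add: dehomogenize_homogenize A)
  qed
  ultimately have "(\<lambda>j. dehomogenize N (?y j)) \<in> gen I M m n A (syz_bound (Suc N) m d)" by simp
  then show ?thesis
    by (rule gen_congruent) (simp add: dehomogenize_homogenize y coefs_in_def)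
qed

text \<open>Summing the powers is necessary: \<open>syz_bound (Suc v) m d \<le> (2 * m * d) ^ 2 ^ v\<close> by itself is not
  preserved by the recursion when \<open>m = 1\<close>.\<close>

lemma syz_bound_sum: "2 * syz_bound v m d \<le> (\<Sum>k<v. (2 * m * d) ^ 2 ^ k)"
proof (induction v arbitrary: m)
  case (Suc v)
  let ?m = "m * (m * d + d)"
  have "2 * ?m * d \<le> (2 * m * d)\<^sup>2"
  proof (cases m)
    case (Suc l)
    have "m * d * d \<le> m * m * d * d" by (simp add: Suc)
    then show ?thesis by (simp add: power2_eq_square algebra_simps)
  qed simp
  then have "(2 * ?m * d) ^ 2 ^ k \<le> (2 * m * d) ^ 2 ^ Suc k" for k
    using power_mono[of "2 * ?m * d" "(2 * m * d)\<^sup>2" "2 ^ k"] by (simp add: power_mult)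
  then have "2 * syz_bound v ?m d \<le> (\<Sum>k<v. (2 * m * d) ^ 2 ^ Suc k)"
    using Suc.IH[of ?m] by (meson order_trans sum_mono)
  then show ?case by (simp add: sum.lessThan_Suc_shift del: sum.lessThan_Suc)
qed simp

text \<open>For a base \<open>a \<ge> 2\<close>, each term of the sum of the
  \<open>a ^ 2 ^ k\<close> is at least twice the term before it, so the sum is at most twice its
  last term. This factor 2 is the one on the left of \<open>syz_bound_sum\<close>.\<close>

lemma syz_bound_le:
  assumes "N > 0"
  shows "syz_bound (Suc N) m d \<le> (2 * m * d) ^ (2 * ((N + 1) ^ N - 1))"
proof (cases "2 * m * d = 0")
  case True
  then have "(\<Sum>k<Suc N. (2 * m * d) ^ 2 ^ k) = 0" by (intro sum.neutral) simp
  with syz_bound_sum[of "Suc N" m d] show ?thesis by (simp del: sum.lessThan_Suc syz_bound.simps)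
next
  case False
  define a where "a = 2 * m * d"
  have a: "a \<ge> 2" using False by (simp add: a_def)
  have "(\<Sum>k<Suc v. a ^ 2 ^ k) \<le> 2 * a ^ 2 ^ v" for v
  proof (induction v)
    case (Suc v)
    have "2 * a ^ 2 ^ v \<le> a ^ 2 ^ v * a ^ 2 ^ v"
      using a self_le_power[of a "2 ^ v"] by (intro mult_right_mono) auto
    also have "\<dots> = a ^ 2 ^ Suc v" by (simp add: power_add[symmetric] mult_2)
    finally show ?case using Suc by simp
  qed simp
  from this[of N] syz_bound_sum[of "Suc N" m d] have "syz_bound (Suc N) m d \<le> a ^ 2 ^ N"
    by (simp add: a_def del: sum.lessThan_Suc syz_bound.simps)
  also have "\<dots> \<le> a ^ (2 * ((N + 1) ^ N - 1))"
  proof (rule power_increasing)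
    have 1: "(2::nat) ^ N \<le> (N + 1) ^ N" using assms by (intro power_mono) auto
    have 2: "(2::nat) ^ 1 \<le> 2 ^ N" using assms by (intro power_increasing) auto
    from 1 2 show "(2::nat) ^ N \<le> 2 * ((N + 1) ^ N - 1)" by simp
  qed (use a in simp)
  finally show ?thesis by (simp add: a_def)
qed

text \<open>For \<open>N = 0\<close> the exponent is 0 and the bound is 1, which
  \<open>syz_bound (Suc 0) m d = m * d\<close> may exceed. That case needs no elimination, as the
  solution itself is constant.\<close>

lemma (in chain_pair) syzygies_bounded':
  fixes A :: "nat \<Rightarrow> nat \<Rightarrow> 'p mpol"
  assumes A: "\<And>i j. i < m \<Longrightarrow> j < n \<Longrightarrow> deg_le d (A i j)"
      "\<And>i j. i < m \<Longrightarrow> j < n \<Longrightarrow> vars_below N (A i j)"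
    and y: "y \<in> syz I m n A" "\<And>j. j < n \<Longrightarrow> vars_below N (y j)"
  shows "y \<in> gen I M m n A ((2 * m * d) ^ (2 * ((N + 1) ^ N - 1)))"
proof (cases "N = 0")
  case True
  show ?thesis
  proof (rule gen_syz[OF y(1)])
    fix j assume "j < n"
    then have "k = {#}" if "coef (y j) k \<noteq> 0" for k
      using y(2)[of j] True that by (auto simp: vars_below_def)
    then show "deg_le ((2 * m * d) ^ (2 * ((N + 1) ^ N - 1))) (y j)"
      by (metis deg_le_def size_empty le0)
  qed
next
  case False
  then show ?thesis using syzygies_bounded[OF assms] syz_bound_le by (blast intro: gen_mono)
qed

section \<open>Localization at a maximal ideal\<close>

type_synonym 'a free_ring = "'a multiset \<Rightarrow>\<^sub>0 int"

context cring
begin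

text \<open>Generators outside of the carrier are sent to \<open>\<zero>\<close>.\<close>

definition eval_mset :: "'a multiset \<Rightarrow> 'a"
  where "eval_mset k = (\<Otimes>x\<in>set_mset k. (if x \<in> carrier R then x else \<zero>) [^] count k x)"

definition eval_free :: "'a free_ring \<Rightarrow> 'a"
  where "eval_free p = (\<Oplus>k\<in>Poly_Mapping.keys p. add_pow R (coef p k) (eval_mset k))"

lemma int_add_pow_0: "add_pow R (0::int) x = \<zero>"
  by (simp add: add_pow_def int_pow_def nat_pow_def)

lemma int_add_pow_add:
  "x \<in> carrier R \<Longrightarrow> add_pow R (a + b :: int) x = add_pow R a x \<oplus> add_pow R b x"
  by (rule add.int_pow_mult)

lemma int_add_pow_times:
  assumes "x \<in> carrier R" "y \<in> carrier R"
  shows "add_pow R (a * b :: int) (x \<otimes> y) = add_pow R a x \<otimes> add_pow R b y"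
proof -
  have "add_pow R a x \<otimes> add_pow R b y = add_pow R b (add_pow R a (x \<otimes> y))"
    using assms by (simp add: add_pow_ldistr_int add_pow_rdistr_int)
  also have "\<dots> = add_pow R (a * b) (x \<otimes> y)"
    using assms by (intro add.int_pow_pow) simp
  finally show ?thesis by simp
qed

lemma eval_mset_closed [simp]: "eval_mset k \<in> carrier R"
  unfolding eval_mset_def by (rule finprod_closed) auto

lemma eval_mset_superset:
  assumes "finite S" "set_mset k \<subseteq> S"
  shows "eval_mset k = (\<Otimes>x\<in>S. (if x \<in> carrier R then x else \<zero>) [^] count k x)"
  unfolding eval_mset_def
  by (rule finprod_mono_neutral_cong_left) (use assms in \<open>auto simp: not_in_iff\<close>)

lemma eval_mset_add: "eval_mset (k + l) = eval_mset k \<otimes> eval_mset l"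
proof -
  let ?S = "set_mset k \<union> set_mset l" and ?v = "\<lambda>x. if x \<in> carrier R then x else \<zero>"
  have "eval_mset (k + l) = (\<Otimes>x\<in>?S. ?v x [^] count (k + l) x)"
    by (rule eval_mset_superset) auto
  also have "\<dots> = (\<Otimes>x\<in>?S. ?v x [^] count k x \<otimes> ?v x [^] count l x)"
    by (rule finprod_cong') (auto simp: nat_pow_mult)
  also have "\<dots> = (\<Otimes>x\<in>?S. ?v x [^] count k x) \<otimes> (\<Otimes>x\<in>?S. ?v x [^] count l x)"
    by (rule finprod_multf) auto
  also have "\<dots> = eval_mset k \<otimes> eval_mset l"
    using eval_mset_superset[of ?S k] eval_mset_superset[of ?S l] by simp
  finally show ?thesis .
qed

lemma eval_mset_single: "x \<in> carrier R \<Longrightarrow> eval_mset {#x#} = x"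
  by (simp add: eval_mset_def)

lemma eval_free_closed [simp]: "eval_free p \<in> carrier R"
  unfolding eval_free_def by (rule finsum_closed) auto

lemma eval_free_superset:
  assumes "finite S" "Poly_Mapping.keys p \<subseteq> S"
  shows "eval_free p = (\<Oplus>k\<in>S. add_pow R (coef p k) (eval_mset k))"
  unfolding eval_free_def
  by (rule add.finprod_mono_neutral_cong_left) (use assms in \<open>auto simp: in_keys_iff int_add_pow_0\<close>)

lemma eval_free_add: "eval_free (p + q) = eval_free p \<oplus> eval_free q"
proof -
  let ?S = "Poly_Mapping.keys p \<union> Poly_Mapping.keys q"
  have "eval_free (p + q) = (\<Oplus>k\<in>?S. add_pow R (coef (p + q) k) (eval_mset k))"
    by (rule eval_free_superset) (use keys_add[of p q] in auto)
  also have "\<dots> = (\<Oplus>k\<in>?S. add_pow R (coef p k) (eval_mset k) \<oplus> add_pow R (coef q k) (eval_mset k))"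
    by (rule add.finprod_cong') (auto simp: lookup_add int_add_pow_add)
  also have "\<dots> = (\<Oplus>k\<in>?S. add_pow R (coef p k) (eval_mset k)) \<oplus> (\<Oplus>k\<in>?S. add_pow R (coef q k) (eval_mset k))"
    by (rule finsum_addf) auto
  also have "\<dots> = eval_free p \<oplus> eval_free q"
    using eval_free_superset[of ?S p] eval_free_superset[of ?S q] by simp
  finally show ?thesis .
qed

lemma eval_free_0 [simp]: "eval_free 0 = \<zero>"
  by (simp add: eval_free_def)

lemma eval_free_mon: "eval_free (mon k a) = add_pow R a (eval_mset k)"
  using eval_free_superset[of "{k}" "mon k a"] by simp

lemma eval_free_1 [simp]: "eval_free 1 = \<one>"
  using eval_free_mon[of "{#}" 1] by (simp add: eval_mset_def)

lemma eval_free_uminus: "eval_free (- p) = \<ominus> eval_free p"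
  using eval_free_add[of "-p" p] minus_equality[of "eval_free (- p)" "eval_free p"] by simp

lemma eval_free_times: "eval_free (p * q) = eval_free p \<otimes> eval_free q"
proof (induction p rule: poly_mapping_additive_induct)
  case (mon k a)
  show ?case
  proof (induction q rule: poly_mapping_additive_induct)
    case (mon l b)
    show ?case by (simp add: mult_single eval_free_mon eval_mset_add int_add_pow_times)
  next
    case (add f g)
    then show ?case by (simp add: distrib_left eval_free_add r_distr)
  qed
next
  case (add f g)
  then show ?case by (simp add: distrib_right eval_free_add l_distr)
qed

lemma eval_free_surj: "a \<in> carrier R \<Longrightarrow> \<exists>p. eval_free p = a"
  using eval_free_mon[of "{#a#}" 1] by (auto simp: eval_mset_single)

lemma eval_free_sum: "eval_free (\<Sum>x\<in>A. f x) = (\<Oplus>x\<in>A. eval_free (f x))"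
  by (induction A rule: infinite_finite_induct) (auto simp: eval_free_add)

definition primeM :: "'a set \<Rightarrow> 'a free_ring set"
  where "primeM M = {p. eval_free p \<in> M}"

text \<open>The kernel of the map to the localization: \<open>p\<close> becomes 0 there when some
  element outside \<open>M\<close> annihilates its value in \<open>R\<close>.\<close>

definition primeI :: "'a set \<Rightarrow> 'a free_ring set"
  where "primeI M = {p. \<exists>u. u \<notin> primeM M \<and> eval_free (u * p) = \<zero>}"

lemma primeM_prime:
  assumes "maximalideal M R"
  shows "prime_ideal_set (primeM M)"
proof -
  interpret primeideal M R by (rule maximalideal_prime[OF assms])
  have "\<one> \<notin> M" using one_imp_carrier I_notcarr by blast
  then show ?thesis
    by unfold_locales
      (auto simp: primeM_def eval_free_add eval_free_times intro: I_l_closed dest!: I_prime[rotated 2])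
qed

text \<open>These properties hold at every maximal ideal. Primality of \<open>primeI M\<close> is
  not among them; it expresses that the localization is a domain.\<close>

lemma primeI_basic:
  assumes M: "maximalideal M R"
  shows "0 \<in> primeI M"
    and "a \<in> primeI M \<Longrightarrow> b \<in> primeI M \<Longrightarrow> a + b \<in> primeI M"
    and "a \<in> primeI M \<Longrightarrow> c * a \<in> primeI M"
    and "s \<notin> primeM M \<Longrightarrow> s * a \<in> primeI M \<Longrightarrow> a \<in> primeI M"
    and "primeI M \<subseteq> primeM M"
proof -
  interpret P: prime_ideal_set "primeM M" by (rule primeM_prime[OF M])
  show "0 \<in> primeI M" using P.one by (auto simp: primeI_def)
  show "a + b \<in> primeI M" if ab: "a \<in> primeI M" "b \<in> primeI M"
  proof -
    from ab obtain u v where u: "u \<notin> primeM M" "eval_free (u * a) = \<zero>"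
      and v: "v \<notin> primeM M" "eval_free (v * b) = \<zero>" by (auto simp: primeI_def)
    have "u * v \<notin> primeM M" using P.prime[of u v] u v by blast
    moreover have "eval_free (u * v * (a + b)) = eval_free (v * (u * a) + u * (v * b))"
      by (simp add: algebra_simps)
    then have "eval_free (u * v * (a + b)) = \<zero>"
      unfolding eval_free_add eval_free_times[of v "u * a"] eval_free_times[of u "v * b"] u v by simp
    ultimately show ?thesis by (auto simp: primeI_def)
  qed
  show "c * a \<in> primeI M" if a: "a \<in> primeI M"
  proof -
    from a obtain u where u: "u \<notin> primeM M" "eval_free (u * a) = \<zero>" by (auto simp: primeI_def)
    have "eval_free (u * (c * a)) = eval_free (c * (u * a))" by (simp add: ac_simps)
    also have "\<dots> = \<zero>" unfolding eval_free_times[of c "u * a"] u by simp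
    finally show ?thesis using u(1) by (auto simp: primeI_def)
  qed
  show "a \<in> primeI M" if s: "s \<notin> primeM M" "s * a \<in> primeI M"
  proof -
    from s obtain u where u: "u \<notin> primeM M" "eval_free (u * (s * a)) = \<zero>" by (auto simp: primeI_def)
    have "u * s \<notin> primeM M" using P.prime[of u s] u s by blast
    with u(2) show ?thesis by (auto simp: primeI_def mult.assoc)
  qed
  show "primeI M \<subseteq> primeM M"
  proof
    fix p assume "p \<in> primeI M"
    then obtain u where u: "u \<notin> primeM M" "eval_free (u * p) = \<zero>" by (auto simp: primeI_def)
    have "u * p \<in> primeM M" using u(2) P.zero by (simp add: primeM_def)
    from P.prime[OF this] u(1) show "p \<in> primeM M" by blast
  qed
qed

end

section \<open>Fractions computed in the free ring\<close>

locale maximal_localization = cring R for R (structure) +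
  fixes M
  assumes M: "maximalideal M R"
begin

sublocale PM: prime_ideal_set "primeM M" by (rule primeM_prime[OF M])

abbreviation "S \<equiv> carrier R - M"
abbreviation "L \<equiv> localization_at R M"

text \<open>Numerators and denominators are written in the free ring. Equations between fractions
  then become memberships in \<open>primeI M\<close>, accessible to the simplifier's ring
  normalization.\<close>

definition frac :: "'a free_ring \<Rightarrow> 'a free_ring \<Rightarrow> ('a \<times> 'a) set"
  where "frac p s = fraction_rel R S `` {(eval_free p, eval_free s)}"

lemma I_uminus: "a \<in> primeI M \<Longrightarrow> - a \<in> primeI M"
  using primeI_basic(3)[OF M, of a "-1"] by simp

lemma fraction_rel_iff:
  "((eval_free p, eval_free s), (eval_free q, eval_free t)) \<in> fraction_rel R S \<longleftrightarrow>
    s \<notin> primeM M \<and> t \<notin> primeM M \<and> p * t - q * s \<in> primeI M"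
proof -
  have ev: "eval_free (u * (p * t - q * s))
      = eval_free u \<otimes> (eval_free p \<otimes> eval_free t \<ominus> eval_free q \<otimes> eval_free s)" for u
    using eval_free_add[of "p * t" "- (q * s)"]
    by (simp add: eval_free_times eval_free_uminus minus_eq)
  have "(\<exists>u\<in>S. u \<otimes> (eval_free p \<otimes> eval_free t \<ominus> eval_free q \<otimes> eval_free s) = \<zero>)
      \<longleftrightarrow> p * t - q * s \<in> primeI M"
  proof
    assume "\<exists>u\<in>S. u \<otimes> (eval_free p \<otimes> eval_free t \<ominus> eval_free q \<otimes> eval_free s) = \<zero>"
    then obtain u where u: "u \<in> S" "u \<otimes> (eval_free p \<otimes> eval_free t \<ominus> eval_free q \<otimes> eval_free s) = \<zero>" by blast
    obtain v where "eval_free v = u" using eval_free_surj u(1) by blast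
    with u ev[of v] show "p * t - q * s \<in> primeI M" by (auto simp: primeI_def primeM_def)
  next
    assume "p * t - q * s \<in> primeI M"
    then obtain u where "u \<notin> primeM M" "eval_free (u * (p * t - q * s)) = \<zero>" by (auto simp: primeI_def)
    then show "\<exists>u\<in>S. u \<otimes> (eval_free p \<otimes> eval_free t \<ominus> eval_free q \<otimes> eval_free s) = \<zero>"
      unfolding ev by (intro bexI[of _ "eval_free u"]) (auto simp: primeM_def)
  qed
  then show ?thesis unfolding fraction_rel_def by (auto simp: primeM_def)
qed

lemma lift_pair:
  assumes "x \<in> carrier R \<times> S"
  obtains p s where "x = (eval_free p, eval_free s)" "s \<notin> primeM M"
proof -
  obtain a b where x: "x = (a, b)" "a \<in> carrier R" "b \<in> S" using assms by auto
  obtain p where p: "eval_free p = a" using eval_free_surj x by blast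
  obtain s where s: "eval_free s = b" using eval_free_surj x by blast
  show ?thesis by (rule that[of p s]) (use x p s in \<open>auto simp: primeM_def\<close>)
qed

lemma fraction_rel_sub: "fraction_rel R S \<subseteq> (carrier R \<times> S) \<times> (carrier R \<times> S)"
  by (auto simp: fraction_rel_def)

lemma lift_rel:
  assumes "(x, y) \<in> fraction_rel R S"
  obtains p s q t where "x = (eval_free p, eval_free s)" "y = (eval_free q, eval_free t)"
    "s \<notin> primeM M" "t \<notin> primeM M" "p * t - q * s \<in> primeI M"
proof -
  have "x \<in> carrier R \<times> S" "y \<in> carrier R \<times> S" using assms fraction_rel_sub by auto
  obtain p s where x: "x = (eval_free p, eval_free s)" using lift_pair[OF \<open>x \<in> _\<close>] .
  obtain q t where y: "y = (eval_free q, eval_free t)" using lift_pair[OF \<open>y \<in> _\<close>] .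
  show ?thesis by (rule that[OF x y]) (use assms[unfolded x y fraction_rel_iff] in simp_all)
qed

lemma notin_mult: "s \<notin> primeM M \<Longrightarrow> t \<notin> primeM M \<Longrightarrow> s * t \<notin> primeM M"
  using PM.prime[of s t] by blast

lemma equiv_fraction_rel: "equiv (carrier R \<times> S) (fraction_rel R S)"
proof (rule equivI)
  show "fraction_rel R S \<subseteq> (carrier R \<times> S) \<times> (carrier R \<times> S)" by (rule fraction_rel_sub)
  show "refl_on (carrier R \<times> S) (fraction_rel R S)"
  proof (rule refl_onI)
    fix x assume "x \<in> carrier R \<times> S"
    then show "(x, x) \<in> fraction_rel R S"
      by (elim lift_pair) (simp add: fraction_rel_iff primeI_basic(1)[OF M])
  qed
  show "sym (fraction_rel R S)"
  proof (rule symI)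
    fix x y assume "(x, y) \<in> fraction_rel R S"
    then obtain p s q t where x: "x = (eval_free p, eval_free s)" and y: "y = (eval_free q, eval_free t)"
      and s: "s \<notin> primeM M" "t \<notin> primeM M" and r: "p * t - q * s \<in> primeI M" by (rule lift_rel)
    show "(y, x) \<in> fraction_rel R S"
      using s I_uminus[OF r] unfolding x y fraction_rel_iff by simp
  qed
  show "trans (fraction_rel R S)"
  proof (rule transI)
    fix x y z assume "(x, y) \<in> fraction_rel R S" and yz: "(y, z) \<in> fraction_rel R S"
    then obtain p s q t where x: "x = (eval_free p, eval_free s)" and y: "y = (eval_free q, eval_free t)"
      and s: "s \<notin> primeM M" "t \<notin> primeM M" and 1: "p * t - q * s \<in> primeI M" by (elim lift_rel)
    have "z \<in> carrier R \<times> S" using yz fraction_rel_sub by auto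
    then obtain r w where z: "z = (eval_free r, eval_free w)" by (rule lift_pair)
    have 2: "q * w - r * t \<in> primeI M" and w: "w \<notin> primeM M"
      using yz unfolding y z fraction_rel_iff by auto
    have "w * (p * t - q * s) + s * (q * w - r * t) \<in> primeI M"
      by (intro primeI_basic(2,3)[OF M] 1 2)
    also have "w * (p * t - q * s) + s * (q * w - r * t) = t * (p * w - r * s)"
      by (simp add: algebra_simps)
    finally have "p * w - r * s \<in> primeI M" by (rule primeI_basic(4)[OF M s(2)])
    with s w show "(x, z) \<in> fraction_rel R S" unfolding x z fraction_rel_iff by simp
  qed
qed

lemma frac_eq_iff:
  assumes "s \<notin> primeM M" "t \<notin> primeM M"
  shows "frac p s = frac q t \<longleftrightarrow> p * t - q * s \<in> primeI M"
  unfolding frac_def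
  by (subst eq_equiv_class_iff[OF equiv_fraction_rel]) (use assms in \<open>auto simp: fraction_rel_iff primeM_def\<close>)

text \<open>The operations of \<open>localization\<close> are unions over all representatives.
  Independence of the representatives allows them to be computed on a single pair.\<close>

lemma congruent_op:
  assumes "\<And>p s q t. f (eval_free p, eval_free s) (eval_free q, eval_free t) = frac (g p s q t) (s * t)"
    and "\<And>p s p' s' q t q' t'. p * s' - p' * s \<in> primeI M \<Longrightarrow> q * t' - q' * t \<in> primeI M \<Longrightarrow>
      g p s q t * (s' * t') - g p' s' q' t' * (s * t) \<in> primeI M"
  shows "congruent2 (fraction_rel R S) (fraction_rel R S) f"
proof (rule congruent2I')
  fix x x' y y' assume "(x, x') \<in> fraction_rel R S" and yy: "(y, y') \<in> fraction_rel R S"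
  then obtain p s p' s' where x: "x = (eval_free p, eval_free s)" "x' = (eval_free p', eval_free s')"
    and s: "s \<notin> primeM M" "s' \<notin> primeM M" and 1: "p * s' - p' * s \<in> primeI M" by (elim lift_rel)
  from yy obtain q t q' t' where y: "y = (eval_free q, eval_free t)" "y' = (eval_free q', eval_free t')"
    and t: "t \<notin> primeM M" "t' \<notin> primeM M" and 2: "q * t' - q' * t \<in> primeI M" by (rule lift_rel)
  have "s * t \<notin> primeM M" "s' * t' \<notin> primeM M"
    using notin_mult[OF s(1) t(1)] notin_mult[OF s(2) t(2)] .
  then show "f x y = f x' y'"
    unfolding x y assms(1) using assms(2)[OF 1 2] by (simp add: frac_eq_iff)
qed

lemma mult_frac:
  assumes "s \<notin> primeM M" "t \<notin> primeM M"
  shows "frac p s \<otimes>\<^bsub>L\<^esub> frac q t = frac (p * q) (s * t)"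
proof -
  let ?f = "\<lambda>x y. fraction_rel R S `` {(fst x \<otimes> fst y, snd x \<otimes> snd y)}"
  have "frac p s \<otimes>\<^bsub>L\<^esub> frac q t = (\<Union>x\<in>frac p s. \<Union>y\<in>frac q t. ?f x y)"
    by (simp add: localization_at_def localization_def)
  also have "\<dots> = ?f (eval_free p, eval_free s) (eval_free q, eval_free t)"
    unfolding frac_def
  proof (rule UN_equiv_class2[OF equiv_fraction_rel equiv_fraction_rel])
    show "congruent2 (fraction_rel R S) (fraction_rel R S) ?f"
    proof (rule congruent_op[where g = "\<lambda>p s q t. p * q"])
      fix p s p' s' q t q' t' :: "'a free_ring"
      assume 1: "p * s' - p' * s \<in> primeI M" and 2: "q * t' - q' * t \<in> primeI M"
      have "p * q * (s' * t') - p' * q' * (s * t) = (q * t') * (p * s' - p' * s) + (p' * s) * (q * t' - q' * t)"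
        by (simp add: algebra_simps)
      also have "\<dots> \<in> primeI M" by (intro primeI_basic(2,3)[OF M] 1 2)
      finally show "p * q * (s' * t') - p' * q' * (s * t) \<in> primeI M" .
    qed (simp add: frac_def eval_free_times)
  qed (use assms in \<open>auto simp: primeM_def\<close>)
  finally show ?thesis by (simp add: frac_def eval_free_times)
qed

lemma add_frac:
  assumes "s \<notin> primeM M" "t \<notin> primeM M"
  shows "frac p s \<oplus>\<^bsub>L\<^esub> frac q t = frac (p * t + q * s) (s * t)"
proof -
  let ?f = "\<lambda>x y. fraction_rel R S `` {(fst x \<otimes> snd y \<oplus> fst y \<otimes> snd x, snd x \<otimes> snd y)}"
  have "frac p s \<oplus>\<^bsub>L\<^esub> frac q t = (\<Union>x\<in>frac p s. \<Union>y\<in>frac q t. ?f x y)"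
    by (simp add: localization_at_def localization_def)
  also have "\<dots> = ?f (eval_free p, eval_free s) (eval_free q, eval_free t)"
    unfolding frac_def
  proof (rule UN_equiv_class2[OF equiv_fraction_rel equiv_fraction_rel])
    show "congruent2 (fraction_rel R S) (fraction_rel R S) ?f"
    proof (rule congruent_op[where g = "\<lambda>p s q t. p * t + q * s"])
      fix p s p' s' q t q' t' :: "'a free_ring"
      assume 1: "p * s' - p' * s \<in> primeI M" and 2: "q * t' - q' * t \<in> primeI M"
      have "(p * t + q * s) * (s' * t') - (p' * t' + q' * s') * (s * t)
          = (t * t') * (p * s' - p' * s) + (s * s') * (q * t' - q' * t)"
        by (simp add: algebra_simps)
      also have "\<dots> \<in> primeI M" by (intro primeI_basic(2,3)[OF M] 1 2)
      finally show "(p * t + q * s) * (s' * t') - (p' * t' + q' * s') * (s * t) \<in> primeI M" .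
    qed (simp add: frac_def eval_free_times eval_free_add)
  qed (use assms in \<open>auto simp: primeM_def\<close>)
  finally show ?thesis by (simp add: frac_def eval_free_times eval_free_add)
qed

lemma zero_frac: "\<zero>\<^bsub>L\<^esub> = frac 0 1" and one_frac: "\<one>\<^bsub>L\<^esub> = frac 1 1"
  by (simp_all add: localization_at_def localization_def frac_def)

lemma frac_carrier: "s \<notin> primeM M \<Longrightarrow> frac p s \<in> carrier L"
  unfolding localization_at_def localization_def frac_def partial_object.simps
  by (rule quotientI) (simp add: primeM_def)

lemma carrier_frac:
  assumes "x \<in> carrier L"
  obtains p s where "x = frac p s" "s \<notin> primeM M"
proof -
  from assms obtain y where "y \<in> carrier R \<times> S" "x = fraction_rel R S `` {y}"
    unfolding localization_at_def localization_def by (auto elim!: quotientE)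
  with that show ?thesis by (elim lift_pair) (auto simp: frac_def)
qed

text \<open>Let \<open>\<gamma>\<close> generate the ideal of the two elements, so that they are
  \<open>x\<close> and \<open>y\<close> times \<open>\<gamma>\<close>. If \<open>\<gamma>\<close> is
  nonzero, cancelling it in its expression by the two elements writes 1 as a combination of
  \<open>x\<close> and \<open>y\<close>; in a local ring one of these is a unit, and the
  corresponding element divides the other.\<close>

theorem chain_pair_of_dvr:
  assumes dvr: "discrete_valuation_ring L"
  shows "chain_pair (primeI M) (primeM M)"
proof -
  interpret L: discrete_valuation_ring L by fact
  have s1: "1 \<notin> primeM M" by (rule PM.one)
  have frac0: "frac p 1 = \<zero>\<^bsub>L\<^esub> \<longleftrightarrow> p \<in> primeI M" for p
    unfolding zero_frac by (simp add: frac_eq_iff[OF s1 s1])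
  show ?thesis
  proof unfold_locales
    show "1 \<notin> primeI M" using primeI_basic(5)[OF M] s1 by blast
    show "a \<in> primeI M \<or> b \<in> primeI M" if ab: "a * b \<in> primeI M" for a b
    proof -
      have "frac a 1 \<otimes>\<^bsub>L\<^esub> frac b 1 = \<zero>\<^bsub>L\<^esub>" using ab frac0 by (simp add: mult_frac[OF s1 s1])
      then have "frac a 1 = \<zero>\<^bsub>L\<^esub> \<or> frac b 1 = \<zero>\<^bsub>L\<^esub>"
        using L.integral frac_carrier[OF s1] by blast
      then show ?thesis by (simp add: frac0)
    qed
    fix a b :: "'a free_ring"
    show "\<exists>s c. s \<notin> primeM M \<and> (s * a - c * b \<in> primeI M \<or> s * b - c * a \<in> primeI M)"
    proof -
      let ?\<alpha> = "frac a 1" and ?\<beta> = "frac b 1"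
      have \<alpha>: "?\<alpha> \<in> carrier L" "?\<beta> \<in> carrier L" by (rule frac_carrier[OF s1])+
      have "ideal (PIdl\<^bsub>L\<^esub> ?\<alpha> <+>\<^bsub>L\<^esub> PIdl\<^bsub>L\<^esub> ?\<beta>) L"
        by (intro L.add_ideals L.cgenideal_ideal \<alpha>)
      then obtain \<gamma> where \<gamma>: "\<gamma> \<in> carrier L" "PIdl\<^bsub>L\<^esub> ?\<alpha> <+>\<^bsub>L\<^esub> PIdl\<^bsub>L\<^esub> ?\<beta> = PIdl\<^bsub>L\<^esub> \<gamma>"
        using L.exists_gen by blast
      have sum: "z \<in> PIdl\<^bsub>L\<^esub> \<gamma> \<longleftrightarrow> (\<exists>x\<in>carrier L. \<exists>y\<in>carrier L. z = x \<otimes>\<^bsub>L\<^esub> ?\<alpha> \<oplus>\<^bsub>L\<^esub> y \<otimes>\<^bsub>L\<^esub> ?\<beta>)" for z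
        unfolding \<gamma>(2)[symmetric] unfolding set_add_def' cgenideal_def by blast
      have "?\<alpha> \<in> PIdl\<^bsub>L\<^esub> \<gamma>" unfolding sum
        by (intro bexI[of _ "\<one>\<^bsub>L\<^esub>"] bexI[of _ "\<zero>\<^bsub>L\<^esub>"]) (use \<alpha> in auto)
      then obtain x where x: "x \<in> carrier L" "?\<alpha> = x \<otimes>\<^bsub>L\<^esub> \<gamma>" by (auto simp: cgenideal_def)
      have "?\<beta> \<in> PIdl\<^bsub>L\<^esub> \<gamma>" unfolding sum
        by (intro bexI[of _ "\<one>\<^bsub>L\<^esub>"] bexI[of _ "\<zero>\<^bsub>L\<^esub>"]) (use \<alpha> in auto)
      then obtain y where y: "y \<in> carrier L" "?\<beta> = y \<otimes>\<^bsub>L\<^esub> \<gamma>" by (auto simp: cgenideal_def)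
      have "\<gamma> \<in> PIdl\<^bsub>L\<^esub> \<gamma>" using L.cgenideal_self[OF \<gamma>(1)] .
      then obtain z w where zw: "z \<in> carrier L" "w \<in> carrier L" "\<gamma> = z \<otimes>\<^bsub>L\<^esub> ?\<alpha> \<oplus>\<^bsub>L\<^esub> w \<otimes>\<^bsub>L\<^esub> ?\<beta>"
        unfolding sum by blast
      show ?thesis
      proof (cases "\<gamma> = \<zero>\<^bsub>L\<^esub>")
        case True
        then have "a \<in> primeI M" using x(1) frac0[of a] unfolding x(2) by simp
        then have "1 * a - 0 * b \<in> primeI M" by simp
        with s1 show ?thesis by blast
      next
        case False
        have "(z \<otimes>\<^bsub>L\<^esub> x \<oplus>\<^bsub>L\<^esub> w \<otimes>\<^bsub>L\<^esub> y) \<otimes>\<^bsub>L\<^esub> \<gamma> = z \<otimes>\<^bsub>L\<^esub> (x \<otimes>\<^bsub>L\<^esub> \<gamma>) \<oplus>\<^bsub>L\<^esub> w \<otimes>\<^bsub>L\<^esub> (y \<otimes>\<^bsub>L\<^esub> \<gamma>)"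
          using zw(1,2) x(1) y(1) \<gamma>(1) by (simp add: L.l_distr L.m_assoc)
        also have "\<dots> = \<gamma>" unfolding x(2)[symmetric] y(2)[symmetric] by (rule zw(3)[symmetric])
        also have "\<dots> = \<one>\<^bsub>L\<^esub> \<otimes>\<^bsub>L\<^esub> \<gamma>" using \<gamma>(1) by simp
        finally have unit: "z \<otimes>\<^bsub>L\<^esub> x \<oplus>\<^bsub>L\<^esub> w \<otimes>\<^bsub>L\<^esub> y = \<one>\<^bsub>L\<^esub>"
          using L.m_rcancel[OF False \<gamma>(1)] zw(1,2) x(1) y(1) by simp
        obtain p s where p: "x = frac p s" "s \<notin> primeM M" using carrier_frac[OF x(1)] .
        obtain q t where q: "y = frac q t" "t \<notin> primeM M" using carrier_frac[OF y(1)] .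
        obtain p' s' where p': "z = frac p' s'" "s' \<notin> primeM M" using carrier_frac[OF zw(1)] .
        obtain q' t' where q': "w = frac q' t'" "t' \<notin> primeM M" using carrier_frac[OF zw(2)] .
        obtain g h where g: "\<gamma> = frac g h" "h \<notin> primeM M" using carrier_frac[OF \<gamma>(1)] .
        note n = notin_mult
        have "frac (p' * p * (t' * t) + q' * q * (s' * s)) ((s' * s) * (t' * t)) = frac 1 1"
          using unit unfolding p q p' q' one_frac by (simp add: mult_frac add_frac p q p' q' n)
        then have "p' * p * (t' * t) + q' * q * (s' * s) - (s' * s) * (t' * t) \<in> primeI M"
          by (simp add: frac_eq_iff n p q p' q' s1)
        then have cong: "p' * p * (t' * t) + q' * q * (s' * s) - (s' * s) * (t' * t) \<in> primeM M"
          using primeI_basic(5)[OF M] by blast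
        \<comment> \<open>The numerators of \<open>x\<close> and \<open>y\<close> cannot both lie in
          \<open>M\<close>, since then so would the product of the denominators.\<close>
        have "p \<notin> primeM M \<or> q \<notin> primeM M"
        proof (rule ccontr)
          assume "\<not> ?thesis"
          then have "p' * p * (t' * t) + q' * q * (s' * s) \<in> primeM M"
            by (intro PM.add PM.mult2 PM.mult) auto
          then have "(s' * s) * (t' * t) \<in> primeM M" using PM.add_cancel[OF cong] by simp
          moreover have "(s' * s) * (t' * t) \<notin> primeM M" by (intro n p q p' q')
          ultimately show False by contradiction
        qed
        have a: "a * (s * h) - p * g \<in> primeI M"
          using x(2) unfolding p g mult_frac[OF p(2) g(2)] by (simp add: frac_eq_iff s1 n p g)
        have b: "b * (t * h) - q * g \<in> primeI M"
          using y(2) unfolding q g mult_frac[OF q(2) g(2)] by (simp add: frac_eq_iff s1 n q g)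
        \<comment> \<open>The numerator \<open>g\<close> of the common divisor is eliminated,
          leaving a relation between \<open>a\<close> and \<open>b\<close> alone.\<close>
        have "q * (a * (s * h) - p * g) + (-p) * (b * (t * h) - q * g) \<in> primeI M"
          by (intro primeI_basic(2,3)[OF M] a b)
        then have ab: "q * s * h * a - p * t * h * b \<in> primeI M" by (simp add: algebra_simps)
        from \<open>p \<notin> primeM M \<or> q \<notin> primeM M\<close> show ?thesis
        proof
          assume "p \<notin> primeM M"
          then have "p * t * h \<notin> primeM M" by (intro n q g)
          moreover have "p * t * h * b - q * s * h * a \<in> primeI M" using I_uminus[OF ab] by simp
          ultimately show ?thesis by blast
        next
          assume "q \<notin> primeM M"
          then have "q * s * h \<notin> primeM M" by (intro n p g)
          with ab show ?thesis by blast
        qed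
      qed
    qed
  qed (use primeI_basic(1-3,5)[OF M] in auto)
qed

end

text \<open>Zorn's lemma, with properness expressed as \<open>\<one> \<notin> I\<close>, a condition
  that passes to unions of chains.\<close>

lemma (in cring) exists_maximalideal:
  assumes J: "ideal J R" "J \<noteq> carrier R"
  shows "\<exists>M. maximalideal M R \<and> J \<subseteq> M"
proof -
  define A where "A = {I. ideal I R \<and> J \<subseteq> I \<and> \<one> \<notin> I}"
  have proper: "\<one> \<notin> I \<longleftrightarrow> I \<noteq> carrier R" if "ideal I R" for I
    using ideal.one_imp_carrier[OF that] by auto
  have "\<exists>M\<in>A. \<forall>Y\<in>A. M \<subseteq> Y \<longrightarrow> Y = M"
  proof (rule subset_Zorn_nonempty)
    show "A \<noteq> {}" using J proper unfolding A_def by blast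
    fix C assume C: "C \<noteq> {}" "subset.chain A C"
    then have "subset.chain {I. ideal I R} C" by (auto simp: subset_chain_def A_def)
    from chain_Union_is_ideal[OF this] C show "\<Union>C \<in> A" by (auto simp: subset_chain_def A_def)
  qed
  then obtain M where M: "M \<in> A" "\<And>Y. Y \<in> A \<Longrightarrow> M \<subseteq> Y \<Longrightarrow> Y = M" by blast
  have "maximalideal M R"
  proof (rule maximalidealI)
    show "ideal M R" using M(1) by (simp add: A_def)
    show "carrier R \<noteq> M" using M(1) proper by (auto simp: A_def)
    show "I = M \<or> I = carrier R" if "ideal I R" "M \<subseteq> I" "I \<subseteq> carrier R" for I
      using M that proper[of I] unfolding A_def by blast
  qed
  with M(1) show ?thesis by (auto simp: A_def)
qed

section \<open>Polynomials and vectors over R as images of those over the free ring\<close>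

context cring
begin

definition to_mpoly :: "'a free_ring mpol \<Rightarrow> nat multiset \<Rightarrow> 'a"
  where "to_mpoly g = (\<lambda>k. eval_free (coef g k))"

lemma to_mpoly_add: "to_mpoly (g + h) = to_mpoly g \<oplus>\<^bsub>mpoly_ring R N\<^esub> to_mpoly h"
  by (simp add: to_mpoly_def mpoly_ring_def indexed_padd_def lookup_add eval_free_add)

lemma to_mpoly_times: "to_mpoly (g * h) = to_mpoly g \<otimes>\<^bsub>mpoly_ring R N\<^esub> to_mpoly h"
  by (simp add: to_mpoly_def mpoly_ring_def coef_times eval_free_sum eval_free_times)

lemma to_mpoly_0: "to_mpoly 0 = \<zero>\<^bsub>mpoly_ring R N\<^esub>"
  by (simp add: to_mpoly_def mpoly_ring_def indexed_const_def fun_eq_iff)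

lemma to_mpoly_carrier:
  assumes "vars_below N g"
  shows "to_mpoly g \<in> carrier (mpoly_ring R N)"
proof -
  have carr: "carrier (mpoly_ring R N) = indexed_pset {..<N} (carrier R)" by (simp add: mpoly_ring_def)
  have mon: "to_mpoly (mon k c) \<in> indexed_pset {..<N} (carrier R)" if "set_mset k \<subseteq> {..<N}" for k c
    using that
  proof (induction k)
    case empty
    have "to_mpoly (mon {#} c) = indexed_const (eval_free c)"
      by (auto simp: to_mpoly_def indexed_const_def lookup_single when_def)
    then show ?case by (simp add: indexed_pset.indexed_const)
  next
    case (add x k)
    have "to_mpoly (mon (add_mset x k) c) = indexed_pmult (to_mpoly (mon k c)) x"
      unfolding to_mpoly_def indexed_pmult_def lookup_single when_def
      by (auto simp: fun_eq_iff multi_member_split)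
    with add show ?case by (auto intro: indexed_pset.indexed_pmult)
  qed
  have "to_mpoly (\<Sum>k\<in>A. mon k (coef g k)) \<in> indexed_pset {..<N} (carrier R)"
    if "finite A" "A \<subseteq> Poly_Mapping.keys g" for A
    using that
  proof (induction A rule: finite_induct)
    case empty
    then show ?case using mon[of "{#}" 0] by simp
  next
    case (insert k A)
    have "set_mset k \<subseteq> {..<N}" using assms insert.prems by (auto simp: vars_below_def in_keys_iff)
    then have "to_mpoly (mon k (coef g k)) \<in> indexed_pset {..<N} (carrier R)" by (rule mon)
    with insert have "indexed_padd (to_mpoly (mon k (coef g k))) (to_mpoly (\<Sum>k\<in>A. mon k (coef g k)))
        \<in> indexed_pset {..<N} (carrier R)"
      by (intro indexed_pset.indexed_padd) auto
    with insert show ?case using to_mpoly_add[of _ _ N] by (simp add: mpoly_ring_def)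
  qed
  from this[of "Poly_Mapping.keys g"] show ?thesis
    using poly_mapping_sum_mons[of g] by (simp add: carr)
qed

lemma mpoly_lift_exists:
  assumes "f \<in> carrier (mpoly_ring R N)"
  shows "\<exists>g. vars_below N g \<and> f = to_mpoly g"
proof -
  have "f \<in> indexed_pset {..<N} (carrier R)" using assms by (simp add: mpoly_ring_def)
  then show ?thesis
  proof (induction rule: indexed_pset.induct)
    case (indexed_const k)
    then obtain p where "eval_free p = k" using eval_free_surj by blast
    then have "indexed_const k = to_mpoly (mon {#} p)"
      by (auto simp: to_mpoly_def indexed_const_def lookup_single when_def)
    then show ?case using vars_below_mon[of "{#}" N p] by auto
  next
    case (indexed_padd P Q)
    then obtain g h where "vars_below N g" "P = to_mpoly g" "vars_below N h" "Q = to_mpoly h" by blast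
    then have "vars_below N (g + h)" "P \<Oplus> Q = to_mpoly (g + h)"
      using to_mpoly_add[of g h N] by (auto simp: vars_below_add mpoly_ring_def)
    then show ?case by blast
  next
    case (indexed_pmult P i)
    then obtain g where g: "vars_below N g" "P = to_mpoly g" by blast
    have "indexed_pmult P i = to_mpoly (mon {#i#} 1 * g)"
      unfolding g(2) to_mpoly_def indexed_pmult_def
      by (auto simp: coef_mon_times fun_eq_iff)
    moreover have "vars_below N (mon {#i#} 1 * g)"
      using g(1) indexed_pmult.hyps(2) by (intro vars_below_times vars_below_mon) auto
    ultimately show ?case by blast
  qed
qed

lemma mpoly_lift:
  assumes "f \<in> carrier (mpoly_ring R N)"
  obtains g where "vars_below N g" "f = to_mpoly g"
  using mpoly_lift_exists[OF assms] by blast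

text \<open>A lift may contain monomials whose coefficients evaluate to 0. Replacing such
  coefficients by 0 gives a lift of the same degree as \<open>f\<close>.\<close>

lemma mpoly_lift_support:
  assumes "f \<in> carrier (mpoly_ring R N)"
  shows "\<exists>g. vars_below N g \<and> f = to_mpoly g \<and> (\<forall>k. coef g k \<noteq> 0 \<longrightarrow> f k \<noteq> \<zero>)"
proof -
  obtain g where g: "vars_below N g" "f = to_mpoly g" using mpoly_lift[OF assms] .
  let ?h = "\<lambda>p. if eval_free p = \<zero> then 0 else p"
  have c: "coef (map_coefs ?h g) k = ?h (coef g k)" for k by (rule coef_map_coefs) simp
  have "vars_below N (map_coefs ?h g)" using g(1) by (rule map_coefs_preserves(3)[rotated]) simp
  moreover have "f = to_mpoly (map_coefs ?h g)" by (simp add: g(2) to_mpoly_def c fun_eq_iff)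
  moreover have "f k \<noteq> \<zero>" if "coef (map_coefs ?h g) k \<noteq> 0" for k
    using that unfolding c g(2) to_mpoly_def by (simp split: if_splits)
  ultimately show ?thesis by blast
qed

lemma mpoly_abelian_monoid: "abelian_monoid (mpoly_ring R N)"
proof (rule abelian_monoidI)
  let ?D = "mpoly_ring R N"
  note hom = to_mpoly_add[symmetric] to_mpoly_0[symmetric]
  fix x y z assume x: "x \<in> carrier ?D" and y: "y \<in> carrier ?D"
  obtain f where f: "vars_below N f" "x = to_mpoly f" using mpoly_lift[OF x] .
  obtain g where g: "vars_below N g" "y = to_mpoly g" using mpoly_lift[OF y] .
  show "x \<oplus>\<^bsub>?D\<^esub> y \<in> carrier ?D" by (simp add: f g hom to_mpoly_carrier vars_below_add)
  show "x \<oplus>\<^bsub>?D\<^esub> y = y \<oplus>\<^bsub>?D\<^esub> x" by (simp add: f g hom add.commute)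
  show "\<zero>\<^bsub>?D\<^esub> \<oplus>\<^bsub>?D\<^esub> x = x" by (simp add: f hom)
  assume z: "z \<in> carrier ?D"
  obtain h where h: "vars_below N h" "z = to_mpoly h" using mpoly_lift[OF z] .
  show "x \<oplus>\<^bsub>?D\<^esub> y \<oplus>\<^bsub>?D\<^esub> z = x \<oplus>\<^bsub>?D\<^esub> (y \<oplus>\<^bsub>?D\<^esub> z)" by (simp add: f g h hom add.assoc)
next
  show "\<zero>\<^bsub>mpoly_ring R N\<^esub> \<in> carrier (mpoly_ring R N)"
    by (simp add: to_mpoly_0[symmetric] to_mpoly_carrier)
qed

lemma to_mpoly_sum:
  fixes n :: nat
  assumes "\<And>j. j < n \<Longrightarrow> vars_below N (h j)"
  shows "to_mpoly (\<Sum>j<n. h j) = (\<Oplus>\<^bsub>mpoly_ring R N\<^esub>j\<in>{..<n}. to_mpoly (h j))"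
  using assms
proof (induction n)
  case 0
  interpret D: abelian_monoid "mpoly_ring R N" by (rule mpoly_abelian_monoid)
  show ?case by (simp add: to_mpoly_0[of N])
next
  case (Suc n)
  interpret D: abelian_monoid "mpoly_ring R N" by (rule mpoly_abelian_monoid)
  have "(\<Oplus>\<^bsub>mpoly_ring R N\<^esub>j\<in>{..<Suc n}. to_mpoly (h j))
      = to_mpoly (h n) \<oplus>\<^bsub>mpoly_ring R N\<^esub> (\<Oplus>\<^bsub>mpoly_ring R N\<^esub>j\<in>{..<n}. to_mpoly (h j))"
    unfolding lessThan_Suc by (rule D.finsum_insert) (auto intro!: to_mpoly_carrier Suc.prems)
  also have "\<dots> = to_mpoly (h n + (\<Sum>j<n. h j))"
    using Suc by (simp add: to_mpoly_add[of _ _ N])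
  finally show ?case by (simp add: add.commute)
qed

definition to_vec :: "nat \<Rightarrow> (nat \<Rightarrow> 'a free_ring mpol) \<Rightarrow> nat \<Rightarrow> nat multiset \<Rightarrow> 'a"
  where "to_vec n y = (\<lambda>j\<in>{..<n}. to_mpoly (y j))"

lemma to_vec_carrier:
  "(\<And>j. j < n \<Longrightarrow> vars_below N (y j)) \<Longrightarrow> to_vec n y \<in> carrier (free_module (mpoly_ring R N) n)"
  by (auto simp: to_vec_def free_module_def to_mpoly_carrier)

lemma vec_lift:
  assumes "y \<in> carrier (free_module (mpoly_ring R N) n)"
  shows "\<exists>g. (\<forall>j<n. vars_below N (g j)) \<and> y = to_vec n g"
proof -
  have y: "y \<in> {..<n} \<rightarrow>\<^sub>E carrier (mpoly_ring R N)" using assms by (simp add: free_module_def)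
  have "\<exists>g. j < n \<longrightarrow> vars_below N g \<and> y j = to_mpoly g" for j
    using y mpoly_lift_exists[of "y j" N] by (cases "j < n") (auto simp: PiE_iff)
  then obtain g where g: "\<And>j. j < n \<longrightarrow> vars_below N (g j) \<and> y j = to_mpoly (g j)" by metis
  have "y = to_vec n g"
  proof
    fix j show "y j = to_vec n g j"
      using y g[of j] by (cases "j < n") (auto simp: to_vec_def PiE_iff extensional_def)
  qed
  with g show ?thesis by blast
qed

lemma to_vec_add:
  "to_vec n x \<oplus>\<^bsub>free_module (mpoly_ring R N) n\<^esub> to_vec n y = to_vec n (\<lambda>j. x j + y j)"
  by (auto simp: to_vec_def free_module_def to_mpoly_add[of _ _ N])

lemma to_vec_smult:
  "to_mpoly c \<odot>\<^bsub>free_module (mpoly_ring R N) n\<^esub> to_vec n y = to_vec n (\<lambda>j. c * y j)"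
  by (auto simp: to_vec_def free_module_def to_mpoly_times[of _ _ N])

lemma to_vec_zero: "\<zero>\<^bsub>free_module (mpoly_ring R N) n\<^esub> = to_vec n (\<lambda>j. 0)"
  by (auto simp: to_vec_def free_module_def to_mpoly_0[of N])

lemma to_vec_cong: "(\<And>j. j < n \<Longrightarrow> x j = y j) \<Longrightarrow> to_vec n x = to_vec n y"
  by (auto simp: to_vec_def)

lemma to_vec_solutions:
  assumes "\<And>i j. i < m \<Longrightarrow> j < n \<Longrightarrow> vars_below N (B i j) \<and> A i j = to_mpoly (B i j)"
    and "\<And>j. j < n \<Longrightarrow> vars_below N (y j)"
  shows "to_vec n y \<in> solutions (mpoly_ring R N) m n A \<longleftrightarrow> (\<forall>i<m. to_mpoly (\<Sum>j<n. B i j * y j) = to_mpoly 0)"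
proof -
  interpret D: abelian_monoid "mpoly_ring R N" by (rule mpoly_abelian_monoid)
  have "(\<Oplus>\<^bsub>mpoly_ring R N\<^esub>j\<in>{..<n}. A i j \<otimes>\<^bsub>mpoly_ring R N\<^esub> to_vec n y j) = to_mpoly (\<Sum>j<n. B i j * y j)"
    if i: "i < m" for i
  proof -
    have "to_mpoly (\<Sum>j<n. B i j * y j) = (\<Oplus>\<^bsub>mpoly_ring R N\<^esub>j\<in>{..<n}. to_mpoly (B i j * y j))"
      using assms i by (intro to_mpoly_sum vars_below_times) auto
    also have "\<dots> = (\<Oplus>\<^bsub>mpoly_ring R N\<^esub>j\<in>{..<n}. A i j \<otimes>\<^bsub>mpoly_ring R N\<^esub> to_vec n y j)"
      using assms i
      by (intro D.finsum_cong') (auto simp: to_vec_def to_mpoly_times[of _ _ N, symmetric] intro!: to_mpoly_carrier vars_below_times)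
    finally show ?thesis by simp
  qed
  then show ?thesis
    using to_vec_carrier[OF assms(2)] by (auto simp: solutions_def to_mpoly_0[of N])
qed

lemma solutions_submodule:
  assumes B: "\<And>i j. i < m \<Longrightarrow> j < n \<Longrightarrow> vars_below N (B i j) \<and> A i j = to_mpoly (B i j)"
  shows "submodule (solutions (mpoly_ring R N) m n A) (mpoly_ring R N) (free_module (mpoly_ring R N) n)"
proof -
  let ?D = "mpoly_ring R N"
  let ?F = "free_module ?D n"
  let ?S = "solutions ?D m n A"
  have sub: "?S \<subseteq> carrier ?F" by (auto simp: solutions_def)
  have lift: thesis if x: "x \<in> ?S" and step: "\<And>f. (\<And>j. j < n \<Longrightarrow> vars_below N (f j)) \<Longrightarrow> x = to_vec n f \<Longrightarrow>
      (\<And>i. i < m \<Longrightarrow> to_mpoly (\<Sum>j<n. B i j * f j) = to_mpoly 0) \<Longrightarrow> thesis" for x thesis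
  proof -
    have "x \<in> carrier ?F" using x sub by blast
    from vec_lift[OF this] obtain f where "\<forall>j<n. vars_below N (f j)" and f2: "x = to_vec n f"
      by (elim exE conjE)
    then have f: "\<And>j. j < n \<Longrightarrow> vars_below N (f j)" "x = to_vec n f" by simp_all
    have "\<forall>i<m. to_mpoly (\<Sum>j<n. B i j * f j) = to_mpoly 0"
      using x to_vec_solutions[OF B f(1)] unfolding f(2) by simp
    then show ?thesis by (intro step[OF f]) simp_all
  qed
  have smult: "c \<odot>\<^bsub>?F\<^esub> x \<in> ?S" if c: "c \<in> carrier ?D" and x: "x \<in> ?S" for c x
    using x
  proof (rule lift)
    fix f assume f: "\<And>j. j < n \<Longrightarrow> vars_below N (f j)" "x = to_vec n f"
      "\<And>i. i < m \<Longrightarrow> to_mpoly (\<Sum>j<n. B i j * f j) = to_mpoly 0"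
    obtain g where g: "vars_below N g" "c = to_mpoly g" using mpoly_lift[OF c] .
    have "to_mpoly (\<Sum>j<n. B i j * (g * f j)) = to_mpoly 0" if "i < m" for i
    proof -
      have "(\<Sum>j<n. B i j * (g * f j)) = g * (\<Sum>j<n. B i j * f j)"
        by (simp add: sum_distrib_left ac_simps)
      also have "to_mpoly \<dots> = to_mpoly (g * 0)"
        unfolding to_mpoly_times[of _ _ N] f(3)[OF that] ..
      finally show ?thesis by simp
    qed
    then show "c \<odot>\<^bsub>?F\<^esub> x \<in> ?S"
      unfolding f(2) g(2) to_vec_smult using f(1) g(1)
      by (subst to_vec_solutions[OF B]) (auto intro: vars_below_times)
  qed
  have add: "x \<oplus>\<^bsub>?F\<^esub> y \<in> ?S" if x: "x \<in> ?S" and y: "y \<in> ?S" for x y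
    using x
  proof (rule lift)
    fix f assume f: "\<And>j. j < n \<Longrightarrow> vars_below N (f j)" "x = to_vec n f"
      "\<And>i. i < m \<Longrightarrow> to_mpoly (\<Sum>j<n. B i j * f j) = to_mpoly 0"
    show "x \<oplus>\<^bsub>?F\<^esub> y \<in> ?S" using y
    proof (rule lift)
      fix g assume g: "\<And>j. j < n \<Longrightarrow> vars_below N (g j)" "y = to_vec n g"
        "\<And>i. i < m \<Longrightarrow> to_mpoly (\<Sum>j<n. B i j * g j) = to_mpoly 0"
      have "to_mpoly (\<Sum>j<n. B i j * (f j + g j)) = to_mpoly 0" if "i < m" for i
      proof -
        have "to_mpoly ((\<Sum>j<n. B i j * f j) + (\<Sum>j<n. B i j * g j)) = to_mpoly (0 + 0)"
          unfolding to_mpoly_add[of _ _ N] f(3)[OF that] g(3)[OF that] ..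
        then show ?thesis by (simp add: distrib_left sum.distrib)
      qed
      then show "x \<oplus>\<^bsub>?F\<^esub> y \<in> ?S"
        unfolding f(2) g(2) to_vec_add using f(1) g(1)
        by (subst to_vec_solutions[OF B]) (auto intro: vars_below_add)
    qed
  qed
  have zero: "\<zero>\<^bsub>?F\<^esub> \<in> ?S"
    unfolding to_vec_zero by (subst to_vec_solutions[OF B]) auto
  \<comment> \<open>The inverse is a definite description, so existence and uniqueness are checked
    directly; it turns out to be the multiple of \<open>x\<close> by \<open>-1\<close>.\<close>
  have inv: "inv\<^bsub>add_monoid ?F\<^esub> x \<in> ?S" if "x \<in> ?S" for x
  proof -
    from that sub have "x \<in> carrier ?F" by blast
    from vec_lift[OF this] obtain f where "\<forall>j<n. vars_below N (f j)" and f2: "x = to_vec n f"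
      by (elim exE conjE)
    then have f: "\<And>j. j < n \<Longrightarrow> vars_below N (f j)" "x = to_vec n f" by simp_all
    have neg: "to_vec n (\<lambda>j. - f j) = to_mpoly (- 1) \<odot>\<^bsub>?F\<^esub> x" by (simp add: f to_vec_smult)
    have "inv\<^bsub>add_monoid ?F\<^esub> x = to_vec n (\<lambda>j. - f j)"
      unfolding m_inv_def
    proof (rule the_equality)
      show "to_vec n (\<lambda>j. - f j) \<in> carrier (add_monoid ?F) \<and> x \<otimes>\<^bsub>add_monoid ?F\<^esub> to_vec n (\<lambda>j. - f j) = \<one>\<^bsub>add_monoid ?F\<^esub>
          \<and> to_vec n (\<lambda>j. - f j) \<otimes>\<^bsub>add_monoid ?F\<^esub> x = \<one>\<^bsub>add_monoid ?F\<^esub>"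
        using f by (simp add: to_vec_carrier to_vec_add to_vec_zero)
      fix y assume y: "y \<in> carrier (add_monoid ?F) \<and> x \<otimes>\<^bsub>add_monoid ?F\<^esub> y = \<one>\<^bsub>add_monoid ?F\<^esub>
          \<and> y \<otimes>\<^bsub>add_monoid ?F\<^esub> x = \<one>\<^bsub>add_monoid ?F\<^esub>"
      then have "y \<in> carrier ?F" by simp
      from vec_lift[OF this] obtain g where "\<forall>j<n. vars_below N (g j)" and g2: "y = to_vec n g"
        by (elim exE conjE)
      then have g: "\<And>j. j < n \<Longrightarrow> vars_below N (g j)" "y = to_vec n g" by simp_all
      from y have "y \<oplus>\<^bsub>?F\<^esub> x = \<zero>\<^bsub>?F\<^esub>" by simp
      then have gf0: "to_vec n (\<lambda>j. g j + f j) = to_vec n (\<lambda>j. 0)"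
        unfolding f(2) g(2) to_vec_add to_vec_zero .
      have gf: "to_mpoly (g j + f j) = to_mpoly 0" if "j < n" for j
        using fun_cong[OF gf0, of j] that by (simp add: to_vec_def)
      have "to_mpoly (g j) = to_mpoly (- f j)" if "j < n" for j
      proof
        fix k
        have "eval_free (coef (g j) k) \<oplus> eval_free (coef (f j) k) = \<zero>"
          using fun_cong[OF gf[OF that], of k] by (simp add: to_mpoly_def lookup_add eval_free_add)
        then show "to_mpoly (g j) k = to_mpoly (- f j) k"
          using minus_equality[of "eval_free (coef (g j) k)"] by (simp add: to_mpoly_def eval_free_uminus)
      qed
      then show "y = to_vec n (\<lambda>j. - f j)" by (auto simp: g to_vec_def)
    qed
    then show ?thesis unfolding neg using smult[OF to_mpoly_carrier that] by simp
  qed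
  show ?thesis
    unfolding submodule_def submodule_axioms_def
    using sub smult add zero inv by (auto intro!: subgroup.intro)
qed

section \<open>Clearing denominators\<close>

lemma kill_finite:
  assumes M: "maximalideal M R" and F: "finite F" "F \<subseteq> primeI M"
  shows "\<exists>u. u \<notin> primeM M \<and> (\<forall>c\<in>F. eval_free (u * c) = \<zero>)"
  using F
proof (induction F rule: finite_induct)
  interpret PM: prime_ideal_set "primeM M" by (rule primeM_prime[OF M])
  {
    case empty
    then show ?case using PM.one by blast
  next
    case (insert c F)
    then obtain u where u: "u \<notin> primeM M" "\<And>c. c \<in> F \<Longrightarrow> eval_free (u * c) = \<zero>" by auto
    from insert.prems obtain v where v: "v \<notin> primeM M" "eval_free (v * c) = \<zero>" by (auto simp: primeI_def)
    have "u * v \<notin> primeM M" using PM.prime[of u v] u(1) v(1) by blast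
    moreover have "eval_free (u * v * x) = \<zero>" if "x \<in> insert c F" for x
    proof (cases "x = c")
      case True
      have "eval_free (u * v * x) = eval_free u \<otimes> eval_free (v * c)"
        by (simp add: True mult.assoc flip: eval_free_times)
      then show ?thesis by (simp add: v)
    next
      case False
      have "eval_free (u * v * x) = eval_free (v * (u * x))" by (simp add: ac_simps)
      also have "\<dots> = eval_free v \<otimes> eval_free (u * x)" by (rule eval_free_times)
      also have "\<dots> = \<zero>" using False that by (simp add: u(2))
      finally show ?thesis .
    qed
    ultimately show ?case by blast
  }
qed

text \<open>Finitely many congruences modulo \<open>primeI M\<close> become equations over
  \<open>R\<close> after multiplication by one element outside \<open>M\<close>.\<close>

lemma kill_mpoly:
  assumes M: "maximalideal M R" and G: "finite G" "G \<subseteq> coefs_in (primeI M)"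
  shows "\<exists>u. u \<notin> primeM M \<and> (\<forall>g\<in>G. to_mpoly (mon 0 u * g) = to_mpoly 0)"
proof -
  let ?F = "\<Union>g\<in>G. coef g ` Poly_Mapping.keys g"
  have "finite ?F" using G(1) by simp
  moreover have "?F \<subseteq> primeI M" using G(2) by (auto simp: coefs_in_def)
  ultimately have "\<exists>u. u \<notin> primeM M \<and> (\<forall>c\<in>?F. eval_free (u * c) = \<zero>)" by (rule kill_finite[OF M])
  then obtain u where u: "u \<notin> primeM M" "\<And>c. c \<in> ?F \<Longrightarrow> eval_free (u * c) = \<zero>" by auto
  have "to_mpoly (mon 0 u * g) = to_mpoly 0" if "g \<in> G" for g
  proof
    fix k
    have "eval_free (u * coef g k) = \<zero>"
    proof (cases "coef g k = 0")
      case False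
      then show ?thesis by (intro u(2) UN_I[OF that]) (simp add: in_keys_iff)
    qed simp
    then show "to_mpoly (mon 0 u * g) k = to_mpoly 0 k" by (simp add: to_mpoly_def)
  qed
  with u(1) show ?thesis by blast
qed

text \<open>The coefficients in a combination witnessing membership in \<open>gen\<close> may contain variables
  with index \<open>\<ge> N\<close>; \<open>dehomogenize N\<close> removes them.\<close>

lemma gen_in_submodule:
  assumes M: "maximalideal M R"
    and H: "submodule H (mpoly_ring R N) (free_module (mpoly_ring R N) n)"
    and B: "\<And>i j. i < m \<Longrightarrow> j < n \<Longrightarrow> vars_below N (B i j)"
    and base: "\<And>z. (\<And>j. j < n \<Longrightarrow> vars_below N (z j)) \<Longrightarrow> (\<And>j. j < n \<Longrightarrow> deg_le b (z j)) \<Longrightarrow>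
      (\<And>i. i < m \<Longrightarrow> to_mpoly (\<Sum>j<n. B i j * z j) = to_mpoly 0) \<Longrightarrow> to_vec n z \<in> H"
    and z: "z \<in> gen (primeI M) (primeM M) m n B b"
    and I: "prime_ideal_set (primeI M)"
  shows "\<exists>u. u \<notin> primeM M \<and> to_vec n (\<lambda>j. mon 0 u * dehomogenize N (z j)) \<in> H"
proof -
  interpret PM: prime_ideal_set "primeM M" by (rule primeM_prime[OF M])
  interpret sg: subgroup H "add_monoid (free_module (mpoly_ring R N) n)"
    using H by (simp add: submodule_def)
  have Hadd: "to_vec n (\<lambda>j. x j + y j) \<in> H" if "to_vec n x \<in> H" "to_vec n y \<in> H" for x y
    using sg.m_closed[OF that] by (simp add: to_vec_add)
  have Hzero: "to_vec n (\<lambda>j. 0) \<in> H" using sg.one_closed by (simp add: to_vec_zero)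
  have Hsmult: "to_vec n (\<lambda>j. c * y j) \<in> H" if "vars_below N c" "to_vec n y \<in> H" for c y
    using submodule.smult_closed[OF H to_mpoly_carrier[OF that(1)] that(2)] by (simp add: to_vec_smult)
  let ?\<pi> = "dehomogenize N :: 'a free_ring mpol \<Rightarrow> _"
  have \<pi>: "?\<pi> (f * g) = ?\<pi> f * ?\<pi> g" "?\<pi> (f + g) = ?\<pi> f + ?\<pi> g" "?\<pi> (mon 0 c) = mon 0 c"
    "?\<pi> (\<Sum>j<n. h j) = (\<Sum>j<n. ?\<pi> (h j))" for f g c h
    by (simp_all add: dehomogenize_def psubst_times psubst_add psubst_sum)
  have \<pi>I: "?\<pi> f \<in> coefs_in (primeI M)" if "f \<in> coefs_in (primeI M)" for f
    unfolding dehomogenize_def by (rule coefs_in_psubst[OF I that])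
  have vmon: "vars_below N (mon 0 u)" for u :: "'a free_ring" by (rule vars_below_mon) simp
  show ?thesis using z
  proof (induction rule: gen.induct)
    case (gen_syz z)
    \<comment> \<open>A generator solves the equations only in the localization. One multiplier
      \<open>u\<close> makes all \<open>m\<close> of them true over \<open>R\<close>, and as a
      constant it does not affect the degree bound.\<close>
    let ?G = "(\<lambda>i. \<Sum>j<n. B i j * ?\<pi> (z j)) ` {..<m}"
    have "(\<Sum>j<n. B i j * ?\<pi> (z j)) \<in> coefs_in (primeI M)" if "i < m" for i
    proof -
      have "(\<Sum>j<n. B i j * ?\<pi> (z j)) = ?\<pi> (\<Sum>j<n. B i j * z j)"
        unfolding \<pi> by (intro sum.cong refl) (simp add: dehomogenize_id B that)
      then show ?thesis using gen_syz.hyps(1) that by (simp add: syz_def \<pi>I)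
    qed
    then have "?G \<subseteq> coefs_in (primeI M)" by auto
    then obtain u where u: "u \<notin> primeM M" "\<forall>g\<in>?G. to_mpoly (mon 0 u * g) = to_mpoly 0"
      using kill_mpoly[OF M, of ?G] by auto
    have "to_vec n (\<lambda>j. mon 0 u * ?\<pi> (z j)) \<in> H"
    proof (rule base)
      show "vars_below N (mon 0 u * ?\<pi> (z j))" for j
        by (intro vars_below_times vmon dehomogenize_vars_below)
      show "deg_le b (mon 0 u * ?\<pi> (z j))" if "j < n" for j
        using deg_le_times[of 0 "mon 0 u" b "?\<pi> (z j)"] dehomogenize_deg_le[OF gen_syz.hyps(2)[OF that], of N]
        by (simp add: deg_le_mon_iff)
      show "to_mpoly (\<Sum>j<n. B i j * (mon 0 u * ?\<pi> (z j))) = to_mpoly 0" if "i < m" for i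
      proof -
        have "(\<Sum>j<n. B i j * (mon 0 u * ?\<pi> (z j))) = mon 0 u * (\<Sum>j<n. B i j * ?\<pi> (z j))"
          by (simp add: sum_distrib_left ac_simps)
        then show ?thesis using u(2) that by auto
      qed
    qed
    with u(1) show ?case by blast
  next
    case (gen_null z)
    let ?G = "(\<lambda>j. ?\<pi> (z j)) ` {..<n}"
    have "?G \<subseteq> coefs_in (primeI M)" using gen_null \<pi>I by auto
    then obtain u where u: "u \<notin> primeM M" "\<forall>g\<in>?G. to_mpoly (mon 0 u * g) = to_mpoly 0"
      using kill_mpoly[OF M, of ?G] by auto
    have "to_vec n (\<lambda>j. mon 0 u * ?\<pi> (z j)) = to_vec n (\<lambda>j. 0)"
      unfolding to_vec_def using u(2) by (intro restrict_ext) auto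
    with u(1) Hzero show ?case by metis
  next
    case (gen_add y z)
    then obtain u v where u: "u \<notin> primeM M" "to_vec n (\<lambda>j. mon 0 u * ?\<pi> (y j)) \<in> H"
      and v: "v \<notin> primeM M" "to_vec n (\<lambda>j. mon 0 v * ?\<pi> (z j)) \<in> H" by blast
    have "to_vec n (\<lambda>j. mon 0 v * (mon 0 u * ?\<pi> (y j)) + mon 0 u * (mon 0 v * ?\<pi> (z j))) \<in> H"
      by (intro Hadd Hsmult vmon u v)
    moreover have "mon 0 v * (mon 0 u * ?\<pi> (y j)) + mon 0 u * (mon 0 v * ?\<pi> (z j))
        = mon 0 (u * v) * ?\<pi> (y j + z j)" for j
      unfolding \<pi> mon_0_mult by (simp add: algebra_simps)
    moreover have "u * v \<notin> primeM M" using PM.prime[of u v] u(1) v(1) by blast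
    ultimately show ?case by auto
  next
    case (gen_smult y c)
    then obtain u where u: "u \<notin> primeM M" "to_vec n (\<lambda>j. mon 0 u * ?\<pi> (y j)) \<in> H" by blast
    have "to_vec n (\<lambda>j. ?\<pi> c * (mon 0 u * ?\<pi> (y j))) \<in> H"
      by (intro Hsmult dehomogenize_vars_below u)
    moreover have "?\<pi> c * (mon 0 u * ?\<pi> (y j)) = mon 0 u * ?\<pi> (c * y j)" for j
      unfolding \<pi> by (simp add: ac_simps)
    ultimately show ?case using u(1) by auto
  next
    case (gen_div s y)
    then obtain u where u: "u \<notin> primeM M" "to_vec n (\<lambda>j. mon 0 u * ?\<pi> (mon 0 s * y j)) \<in> H" by blast
    moreover have "mon 0 u * ?\<pi> (mon 0 s * y j) = mon 0 (u * s) * ?\<pi> (y j)" for j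
      unfolding \<pi> mon_0_mult by (simp add: ac_simps)
    moreover have "u * s \<notin> primeM M" using PM.prime[of u s] u(1) gen_div.hyps(1) by blast
    ultimately show ?case by auto
  qed
qed

end

section \<open>From the localizations back to R\<close>

lemma (in cring) vec_degree_le:
  assumes "\<And>j. j < n \<Longrightarrow> deg_le b (z j)"
  shows "vec_degree R n (to_vec n z) \<le> ereal (real b)"
  unfolding vec_degree_def total_degree_def
proof (intro SUP_least)
  fix j k assume j: "j \<in> {..<n}" and "k \<in> {k. to_vec n z j k \<noteq> \<zero>}"
  then have "coef (z j) k \<noteq> 0" by (auto simp: to_vec_def to_mpoly_def)
  with assms[of j] j show "ereal (real (size k)) \<le> ereal (real b)" by (simp add: deg_le_def)
qed

theorem theorem4p1:
  fixes R :: "('a, 'b) ring_scheme"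
    and N m n :: nat
    and A :: "nat \<Rightarrow> nat \<Rightarrow> nat multiset \<Rightarrow> 'a"
  assumes "almost_hereditary R"
    and "\<And>i j. i < m \<Longrightarrow> j < n \<Longrightarrow> A i j \<in> carrier (mpoly_ring R N)"
    and "\<exists>i<m. \<exists>j<n. A i j \<noteq> \<zero>\<^bsub>mpoly_ring R N\<^esub>"
  shows "\<exists>G \<subseteq> solutions (mpoly_ring R N) m n A.
      (\<forall>y\<in>G. vec_degree R n y
         \<le> (2 * ereal (real m) * mat_degree R m n A) ^ (2 * ((N + 1) ^ N - 1))) \<and>
      generated_submodule (mpoly_ring R N) (free_module (mpoly_ring R N) n) G
        = solutions (mpoly_ring R N) m n A"
proof -
  interpret almost_hereditary R by fact
  let ?D = "mpoly_ring R N"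
  let ?F = "free_module ?D n"
  let ?sol = "solutions ?D m n A"
  have "\<exists>g. i < m \<and> j < n \<longrightarrow>
      vars_below N g \<and> A i j = to_mpoly g \<and> (\<forall>k. coef g k \<noteq> 0 \<longrightarrow> A i j k \<noteq> \<zero>\<^bsub>R\<^esub>)" for i j
    using mpoly_lift_support[OF assms(2), of i j] by (cases "i < m \<and> j < n") auto
  then obtain B where B_all: "\<And>i j. i < m \<and> j < n \<longrightarrow>
      vars_below N (B i j) \<and> A i j = to_mpoly (B i j) \<and> (\<forall>k. coef (B i j) k \<noteq> 0 \<longrightarrow> A i j k \<noteq> \<zero>\<^bsub>R\<^esub>)"
    by metis
  have B: "vars_below N (B i j) \<and> A i j = to_mpoly (B i j)" if "i < m" "j < n" for i j
    using B_all that by blast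
  have supp: "A i j k \<noteq> \<zero>\<^bsub>R\<^esub> \<longleftrightarrow> coef (B i j) k \<noteq> 0" if "i < m" "j < n" for i j k
  proof -
    have "A i j k = eval_free (coef (B i j) k)" using B[OF that] by (simp add: to_mpoly_def)
    then have "A i j k \<noteq> \<zero>\<^bsub>R\<^esub> \<Longrightarrow> coef (B i j) k \<noteq> 0" by auto
    then show ?thesis using B_all[of i j] that by blast
  qed
  define sizes where "sizes = (\<Union>i<m. \<Union>j<n. size ` Poly_Mapping.keys (B i j))"
  define d where "d = Max sizes"
  have fin: "finite sizes" by (simp add: sizes_def)
  \<comment> \<open>Since the matrix is nonzero its degree is a natural number, attained by some
    monomial; otherwise \<open>Max\<close> would be unspecified.\<close>
  have "sizes \<noteq> {}"
  proof -
    obtain i j where ij: "i < m" "j < n" "A i j \<noteq> \<zero>\<^bsub>?D\<^esub>" using assms(3) by blast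
    have "B i j \<noteq> 0"
    proof
      assume "B i j = 0"
      with B[OF ij(1,2)] ij(3) show False by (simp add: to_mpoly_0[of N])
    qed
    then show ?thesis using ij(1,2) by (auto simp: sizes_def)
  qed
  then have "d \<in> sizes" unfolding d_def by (intro Max_in fin)
  then obtain i0 j0 k0 where d: "i0 < m" "j0 < n" "coef (B i0 j0) k0 \<noteq> 0" "d = size k0"
    by (auto simp: sizes_def in_keys_iff)
  have Bd: "deg_le d (B i j)" if "i < m" "j < n" for i j
    unfolding deg_le_def
  proof (intro allI impI)
    fix k assume "coef (B i j) k \<noteq> 0"
    then have "size k \<in> sizes" using that
      unfolding sizes_def by (intro UN_I[of i] UN_I[of j]) (simp_all add: in_keys_iff)
    then show "size k \<le> d" unfolding d_def using fin by simp
  qed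
  have mat: "mat_degree R m n A = ereal (real d)"
  proof (rule antisym)
    show "mat_degree R m n A \<le> ereal (real d)"
      unfolding mat_degree_def total_degree_def
    proof (intro SUP_least)
      fix i j k assume "i \<in> {..<m}" "j \<in> {..<n}" "k \<in> {k. A i j k \<noteq> \<zero>\<^bsub>R\<^esub>}"
      then show "ereal (real (size k)) \<le> ereal (real d)"
        using Bd[of i j] supp[of i j k] by (simp add: deg_le_def)
    qed
    have "A i0 j0 k0 \<noteq> \<zero>\<^bsub>R\<^esub>" using supp d by simp
    then show "ereal (real d) \<le> mat_degree R m n A"
      unfolding mat_degree_def total_degree_def using d
      by (intro SUP_upper2[of i0] SUP_upper2[of j0] SUP_upper2[of k0]) auto
  qed
  define b where "b = (2 * m * d) ^ (2 * ((N + 1) ^ N - 1))"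
  have "2 * ereal (real m) * mat_degree R m n A = ereal (real (2 * m * d))"
    unfolding mat numeral_eq_ereal by simp
  then have bound: "(2 * ereal (real m) * mat_degree R m n A) ^ (2 * ((N + 1) ^ N - 1)) = ereal (real b)"
    unfolding b_def by (simp only: ereal_power of_nat_power)
  \<comment> \<open>All solutions within the bound; any submodule \<open>H\<close> containing them
    must be shown to contain every solution.\<close>
  define G where "G = {y \<in> ?sol. vec_degree R n y \<le> ereal (real b)}"
  have "generated_submodule ?D ?F G = ?sol"
  proof
    have "submodule ?sol ?D ?F \<and> G \<subseteq> ?sol"
      using solutions_submodule[OF B] by (auto simp: G_def)
    then show "generated_submodule ?D ?F G \<subseteq> ?sol" unfolding generated_submodule_def by blast
  next
    show "?sol \<subseteq> generated_submodule ?D ?F G" unfolding generated_submodule_def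
    proof (intro subsetI InterI)
      fix y H assume y: "y \<in> ?sol" and "H \<in> {H. submodule H ?D ?F \<and> G \<subseteq> H}"
      then have H: "submodule H ?D ?F" "G \<subseteq> H" by auto
      interpret sg: subgroup H "add_monoid ?F" using H(1) by (simp add: submodule_def)
      have "y \<in> carrier ?F" using y by (simp add: solutions_def)
      from vec_lift[OF this] obtain f where fv: "\<forall>j<n. vars_below N (f j)" and f: "y = to_vec n f"
        by (elim exE conjE)
      have f0: "\<forall>i<m. to_mpoly (\<Sum>j<n. B i j * f j) = to_mpoly 0"
        using y fv to_vec_solutions[OF B, where y = f] unfolding f by simp
      \<comment> \<open>Elements of the free ring that multiply the given solution into
        \<open>H\<close>. Their values form an ideal of \<open>R\<close>, and
        \<open>y \<in> H\<close> once it contains 1.\<close>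
      define P where "P = {p. to_vec n (\<lambda>j. mon 0 p * f j) \<in> H}"
      have vmon: "vars_below N (mon 0 u)" for u :: "'a free_ring" by (rule vars_below_mon) simp
      have P0: "0 \<in> P" using sg.one_closed by (simp add: P_def to_vec_zero)
      have Padd: "p + q \<in> P" if "p \<in> P" "q \<in> P" for p q
        using sg.m_closed[of "to_vec n (\<lambda>j. mon 0 p * f j)" "to_vec n (\<lambda>j. mon 0 q * f j)"] that
        by (simp add: P_def to_vec_add single_add distrib_right)
      have Pmult: "c * p \<in> P" if "p \<in> P" for c p
        using submodule.smult_closed[OF H(1) to_mpoly_carrier[OF vmon[of c]], of "to_vec n (\<lambda>j. mon 0 p * f j)"] that
        by (simp add: P_def to_vec_smult mon_0_mult mult.assoc)
      have J: "ideal (eval_free ` P) R"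
      proof (rule idealI)
        show "ring R" by (rule ring_axioms)
        show "subgroup (eval_free ` P) (add_monoid R)"
        proof (rule add.subgroupI)
          show "eval_free ` P \<subseteq> carrier R" by auto
          show "eval_free ` P \<noteq> {}" using P0 by auto
          show "\<ominus>\<^bsub>R\<^esub> a \<in> eval_free ` P" if "a \<in> eval_free ` P" for a
          proof -
            from that obtain p where p: "p \<in> P" "a = eval_free p" by blast
            then show ?thesis using Pmult[OF p(1), of "-1"] by (auto simp flip: eval_free_uminus)
          qed
          show "a \<oplus>\<^bsub>R\<^esub> c \<in> eval_free ` P" if ac: "a \<in> eval_free ` P" "c \<in> eval_free ` P" for a c
          proof -
            from ac obtain p q where "p \<in> P" "a = eval_free p" "q \<in> P" "c = eval_free q" by blast
            then show ?thesis using Padd[of p q] by (auto simp flip: eval_free_add)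
          qed
        qed
        fix a c assume "a \<in> eval_free ` P" and c: "c \<in> carrier R"
        then obtain p where p: "p \<in> P" "a = eval_free p" by blast
        obtain q where q: "c = eval_free q" using eval_free_surj[OF c] by blast
        show "c \<otimes>\<^bsub>R\<^esub> a \<in> eval_free ` P" "a \<otimes>\<^bsub>R\<^esub> c \<in> eval_free ` P"
          using Pmult[OF p(1), of q] by (auto simp: p(2) q mult.commute[of p] simp flip: eval_free_times)
      qed
      have "eval_free ` P = carrier R"
      proof (rule ccontr)
        assume "eval_free ` P \<noteq> carrier R"
        then obtain M where M: "maximalideal M R" "eval_free ` P \<subseteq> M"
          using exists_maximalideal[OF J] by blast
        interpret Loc: maximal_localization R M
          by (intro maximal_localization.intro maximal_localization_axioms.intro cring_axioms M(1))
        interpret CP: chain_pair "primeI M" "primeM M"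
          by (rule Loc.chain_pair_of_dvr[OF localization_dvr[OF M(1)]])
        have "g \<in> coefs_in (primeI M)" if "to_mpoly g = to_mpoly 0" for g
          unfolding coefs_in_def primeI_def
        proof (intro CollectI allI exI[of _ 1] conjI)
          show "1 \<notin> primeM M" by (rule Loc.PM.one)
          show "eval_free (1 * coef g k) = \<zero>\<^bsub>R\<^esub>" for k
            using fun_cong[OF that, of k] by (simp add: to_mpoly_def)
        qed
        then have "f \<in> syz (primeI M) m n B" using f0 by (simp add: syz_def)
        then have fgen: "f \<in> gen (primeI M) (primeM M) m n B b"
          unfolding b_def using B Bd fv by (intro CP.syzygies_bounded') auto
        have "\<exists>u. u \<notin> primeM M \<and> to_vec n (\<lambda>j. mon 0 u * dehomogenize N (f j)) \<in> H"
        proof (rule gen_in_submodule[OF M(1) H(1) _ _ fgen CP.I.prime_ideal_set_axioms])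
          show "vars_below N (B i j)" if "i < m" "j < n" for i j
            by (rule conjunct1[OF B[OF that]])
          fix z assume z: "\<And>j. j < n \<Longrightarrow> vars_below N (z j)" "\<And>j. j < n \<Longrightarrow> deg_le b (z j)"
            "\<And>i. i < m \<Longrightarrow> to_mpoly (\<Sum>j<n. B i j * z j) = to_mpoly 0"
          have "to_vec n z \<in> ?sol" using to_vec_solutions[OF B z(1)] z(3) by simp
          then have "to_vec n z \<in> G" using vec_degree_le[OF z(2)] by (simp add: G_def)
          then show "to_vec n z \<in> H" using H(2) by blast
        qed
        then obtain u where u: "u \<notin> primeM M" "to_vec n (\<lambda>j. mon 0 u * dehomogenize N (f j)) \<in> H"
          by (elim exE conjE)
        \<comment> \<open>The local bound at \<open>M\<close> provides \<open>u\<close> in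
          \<open>P\<close> with value outside \<open>M\<close>, against the choice of
          \<open>M\<close> containing the whole ideal.\<close>
        have "to_vec n (\<lambda>j. mon 0 u * dehomogenize N (f j)) = to_vec n (\<lambda>j. mon 0 u * f j)"
          by (rule to_vec_cong) (simp add: dehomogenize_id fv)
        with u(2) have "u \<in> P" by (simp add: P_def)
        with M(2) u(1) show False by (auto simp: primeM_def)
      qed
      then obtain p where p: "p \<in> P" "eval_free p = \<one>\<^bsub>R\<^esub>" using one_closed by (metis imageE)
      have "to_vec n (\<lambda>j. mon 0 p * f j) = to_vec n f"
        by (auto simp: to_vec_def to_mpoly_def fun_eq_iff eval_free_times p(2))
      with p(1) show "y \<in> H" by (simp add: P_def f)
    qed
  qed
  then show ?thesis unfolding bound by (intro exI[of _ G]) (auto simp: G_def)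
qed

end
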